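(* Let $f(u,v)$ be an isothermic cylinder from a fundamental piece with axis $\mathrm A$ and whose second family ($v$-curves) of curvature lines are spherical. Then the centers $Z(u)$ of the spheres containing the spherical curvature lines $v\mapsto f(u,v)$ are collinear, and $$\pm\mathrm A=\frac{Z'(\omega)}{|Z'(\omega)|}=z_1(s(v))\left(e^{-h(\omega,v)}f_u(\omega,v)\right)+z_2(s(v))\left(e^{-h(\omega,v)}f_v(\omega,v)\right)+z_3(s(v))\,n(\omega,v),$$ where $$z_1(s)=\frac{s^{-1}}{|Z'(\omega)|}\left(1+sR(\omega)^2\left(U'(\omega)+s_1s_2U_1'(\omega)\right)\right),\qquad z_2(s)=\frac{s^{-1}R(\omega)\delta^{-1}}{|Z'(\omega)|}\sqrt{Q(s)},$$ $$z_3(s)=\frac{s^{-1}R(\omega)\delta^{-1}}{|Z'(\omega)|}\left(-\delta^2U_1'(\omega)s+(s-s_1)(s-s_2)\right),$$ and $$|Z'(\omega)|^2=R(\omega)^2\left(2(s_1+s_2)U_1'(\omega)+\delta^2U_1'(\omega)^2-U_2(\omega)\right)+R(\omega)^4\left(U'(\omega)+s_1s_2U_1'(\omega)\right)^2.$$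
   Context: Theta functions (Whittaker–Watson convention): for $\operatorname{Im}\tau>0$, $q=e^{i\pi\tau}$, $q^{c}=e^{i\pi\tau c}$, $\vartheta_1(z)=2\sum_{n\ge0}(-1)^nq^{(n+1/2)^2}\sin((2n+1)z)$, $\vartheta_2(z)=2\sum_{n\ge0}q^{(n+1/2)^2}\cos((2n+1)z)$, $\vartheta_3(z)=1+2\sum_{n\ge1}q^{n^2}\cos2nz$, $\vartheta_4(z)=1+2\sum_{n\ge1}(-1)^nq^{n^2}\cos2nz$; primes on theta functions denote $d/dz$. Quaternions: $\mathbb{R}^3$ is identified with the imaginary quaternions $\mathrm{span}\{\mathbf i,\mathbf j,\mathbf k\}$, $\mathbf{ij}=\mathbf k$, and $\mathbb{C}$ with $\mathrm{span}\{1,\mathbf i\}$ ($i=\mathbf i$). Isothermic cylinder with one generic family ($u$-curves) of closed planar curvature lines (generic: the normals of the curvature line planes span three dimensional space), in normal form: $\tau\in\frac12+i\mathbb{R}$, $0<\operatorname{Im}\tau<\operatorname{Im}\tau_0\approx0.3547$ ($\tau_0\in\frac12+i\mathbb{R}$ with $\vartheta_2''(0|\tau_0)=0$), $\omega\in(0,\pi/4)$ the unique value with $\vartheta_2'(\omega|\tau)=0$, $$f(u,v)=\Phi^{-1}(v)\gamma(u,\mathrm{w}(v))\mathbf j\Phi(v),\qquad\gamma(u,\mathrm{w})=-iR(\omega)\frac{\vartheta_1\left(\frac12(u+i\mathrm{w}-3\omega)\right)}{\vartheta_1\left(\frac12(u+i\mathrm{w}+\omega)\right)},\qquad R(\omega)=\frac{2\vartheta_2(\omega)^2}{\vartheta_1'(0)\vartheta_1(2\omega)},$$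 $$\Phi'\Phi^{-1}=\sqrt{1-\mathrm{w}'(v)^2}\,W_1(\mathrm{w}(v))\mathbf k,\qquad W_1(\mathrm{w})=i\frac{\vartheta_1'(0)}{2\vartheta_2(\omega)}\frac{\vartheta_2(\omega-i\mathrm{w})}{\vartheta_1(i\mathrm{w})},$$ with $\Phi$ unit quaternion valued and $\mathrm{w}$ $\tau$-admissible ($\mathrm{w}:\mathbb{R}\to(0,2\pi\operatorname{Im}\tau)$ smooth, and $\sqrt{1-\mathrm{w}'^2}$ a smooth, possibly sign changing, real function). Its metric is $e^{2h}(du^2+dv^2)$ with $e^{h}=|\gamma_u(u,\mathrm{w}(v))|$, written $e^{h(u,\mathrm{w})}$ or $e^{h(u,v)}$; its Gauss map is $n=f_u\times f_v/|f_u\times f_v|$. It is an isothermic cylinder from a fundamental piece if $\mathrm{w}$ (with the signed root) is $\mathcal V$-periodic but $f(u,v+\mathcal V)\ne f(u,v)$; the axis $\mathrm A$ (unit imaginary quaternion) and angle $\theta\in[0,\pi]$ are defined by $\Phi(0)^{-1}\Phi(\mathcal V)=\cos(\theta/2)+\sin(\theta/2)\mathrm A$ (overall sign irrelevant). Data for spherical $v$-curves: write $s(v)=e^{-h(\omega,\mathrm{w}(v))}$. If the $v$-curves are spherical, there are $0\neq\delta\in\mathbb{R}$ and $s_1,s_2$ (both real or complex conjugate) such that $$h_{\mathrm{w}}(\omega,\mathrm{w}(v))\sqrt{1-\mathrm{w}'(v)^2}=s^{-1}\delta^{-1}(s-s_1)(s-s_2),\qquad s'(v)=\delta^{-1}\sqrt{Q(s)},$$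 $$Q(s)=-(s-s_1)^2(s-s_2)^2+\delta^2Q_3(s),\qquad Q_3(s)=2U_1'(\omega)s^3-U_2(\omega)s^2-2U'(\omega)s-U(\omega)^2,$$ where the sign of $\sqrt{Q(s)}$ is that of $\delta s'(v)$; these are the $\delta,s_1,s_2$ in the claim. The constants are $$U(\omega)=-R(\omega)^{-1},\quad U'(\omega)=-\frac12\frac{\vartheta_1'(0)\vartheta_1'(2\omega)}{\vartheta_2(\omega)^2},\quad U_1'(\omega)=\frac12\frac{\vartheta_1'(0)^2}{\vartheta_2(\omega)^2},\quad U_2(\omega)=\frac{\vartheta_1'(0)^2}{\vartheta_2(\omega)^2}\left(\frac{\vartheta_1(\omega)^2}{\vartheta_2(0)^2}+\frac{\vartheta_4(\omega)^2}{\vartheta_3(0)^2}+\frac{\vartheta_3(\omega)^2}{\vartheta_4(0)^2}\right).$$ *)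

theory Defs
  imports "HOL-Analysis.Analysis"
begin

section \<open>Theta functions\<close>

text \<open>Whittaker--Watson convention; \<open>nome \<tau> c\<close> is $q^c$ with the branch $e^{i\pi\tau c}$.
  The derivatives $\vartheta_k'$ are taken in the argument, i.e. \<open>deriv (theta\<^sub>k \<tau>)\<close>.\<close>

definition nome :: "complex \<Rightarrow> complex \<Rightarrow> complex" where
  "nome \<tau> c = exp (\<i> * of_real pi * \<tau> * c)"

definition theta1 :: "complex \<Rightarrow> complex \<Rightarrow> complex" where
  "theta1 \<tau> z = 2 * (\<Sum>n. (-1) ^ n * nome \<tau> ((of_nat n + 1/2)\<^sup>2) * sin ((2 * of_nat n + 1) * z))"

definition theta2 :: "complex \<Rightarrow> complex \<Rightarrow> complex" where
  "theta2 \<tau> z = 2 * (\<Sum>n. nome \<tau> ((of_nat n + 1/2)\<^sup>2) * cos ((2 * of_nat n + 1) * z))"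

definition theta3 :: "complex \<Rightarrow> complex \<Rightarrow> complex" where
  "theta3 \<tau> z = 1 + 2 * (\<Sum>n. nome \<tau> ((of_nat (Suc n))\<^sup>2) * cos (2 * of_nat (Suc n) * z))"

definition theta4 :: "complex \<Rightarrow> complex \<Rightarrow> complex" where
  "theta4 \<tau> z = 1 + 2 * (\<Sum>n. (-1) ^ Suc n * nome \<tau> ((of_nat (Suc n))\<^sup>2) * cos (2 * of_nat (Suc n) * z))"


section \<open>Quaternions\<close>

text \<open>The pair \<open>(a, b)\<close> of complex numbers stands for $a + b\,\mathbf j$, where
  $\mathbb C = \mathrm{span}\{1,\mathbf i\}$; thus $(x_0 + x_1 i,\ x_2 + x_3 i)$ is
  $x_0 + x_1\mathbf i + x_2\mathbf j + x_3\mathbf k$. The vector space structure, norm and topology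
  of the product type are those of the quaternions; the product uses
  $\mathbf j c = \bar c\,\mathbf j$.\<close>

type_synonym quat = "complex \<times> complex"

definition qmult :: "quat \<Rightarrow> quat \<Rightarrow> quat" (infixl "\<otimes>\<^sub>q" 70) where
  "p \<otimes>\<^sub>q q = (fst p * fst q - snd p * cnj (snd q), fst p * snd q + snd p * cnj (fst q))"

definition qinv :: "quat \<Rightarrow> quat" where
  "qinv p = (1 / (norm p)\<^sup>2) *\<^sub>R (cnj (fst p), - snd p)"

definition qcomplex :: "complex \<Rightarrow> quat" where
  "qcomplex c = (c, 0)"

definition qi :: quat where "qi = (\<i>, 0)"
definition qj :: quat where "qj = (0, 1)"
definition qk :: quat where "qk = (0, \<i>)"

lemma qi_qj: "qi \<otimes>\<^sub>q qj = qk" and qj_qk: "qj \<otimes>\<^sub>q qk = qi" and qk_qi: "qk \<otimes>\<^sub>q qi = qj"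
  by (simp_all add: qmult_def qi_def qj_def qk_def)

lemma qmult_assoc: "(p \<otimes>\<^sub>q q) \<otimes>\<^sub>q r = p \<otimes>\<^sub>q (q \<otimes>\<^sub>q r)"
  by (simp add: qmult_def algebra_simps)

lemma qinv_left: "p \<noteq> 0 \<Longrightarrow> qinv p \<otimes>\<^sub>q p = (1, 0)"
  and qinv_right: "p \<noteq> 0 \<Longrightarrow> p \<otimes>\<^sub>q qinv p = (1, 0)"
proof -
  assume p: "p \<noteq> 0"
  obtain a b where ab: "p = (a, b)" by (cases p)
  have nz: "(norm p)\<^sup>2 \<noteq> 0" using p by simp
  have "complex_of_real ((norm p)\<^sup>2) = a * cnj a + b * cnj b"
    by (simp add: ab norm_Pair of_real_add complex_norm_square [symmetric] del: of_real_power)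
  moreover have "complex_of_real ((norm p)\<^sup>2) \<noteq> 0"
    using nz by (simp only: of_real_eq_0_iff not_False_eq_True)
  ultimately have "(a * cnj a + b * cnj b) / complex_of_real ((norm p)\<^sup>2) = 1"
    by (metis divide_self)
  then show "qinv p \<otimes>\<^sub>q p = (1, 0)" "p \<otimes>\<^sub>q qinv p = (1, 0)"
    unfolding qinv_def ab
    by (simp_all add: qmult_def scaleR_conv_of_real add_divide_distrib mult.commute)
qed

text \<open>$\mathbb R^3$ as the imaginary quaternions, with basis $\mathbf i, \mathbf j, \mathbf k$.\<close>

definition quat_of_vec :: "real^3 \<Rightarrow> quat" where
  "quat_of_vec x = (Complex 0 (x $ 1), Complex (x $ 2) (x $ 3))"

definition vec_of_quat :: "quat \<Rightarrow> real^3" where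
  "vec_of_quat p = vector [Im (fst p), Re (snd p), Im (snd p)]"

lemma vec_of_quat_of_vec: "vec_of_quat (quat_of_vec x) = x"
  by (simp add: vec_of_quat_def quat_of_vec_def vec_eq_iff forall_3)

lemma quat_of_vec_of_quat: "Re (fst p) = 0 \<Longrightarrow> quat_of_vec (vec_of_quat p) = p"
  by (cases p) (simp add: vec_of_quat_def quat_of_vec_def complex_eq_iff)

lemma cross3_quat: "cross3 x y = vec_of_quat (quat_of_vec x \<otimes>\<^sub>q quat_of_vec y)" for x y :: "real^3"
  by (simp add: vec_of_quat_def quat_of_vec_def qmult_def cross3_def algebra_simps)


section \<open>Parametrised surfaces\<close>

type_synonym surface = "real \<Rightarrow> real \<Rightarrow> real^3"

definition partial_u :: "surface \<Rightarrow> real \<Rightarrow> real \<Rightarrow> real^3" where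
  "partial_u f u v = vector_derivative (\<lambda>x. f x v) (at u)"

definition partial_v :: "surface \<Rightarrow> real \<Rightarrow> real \<Rightarrow> real^3" where
  "partial_v f u v = vector_derivative (\<lambda>y. f u y) (at v)"

definition gauss_map :: "surface \<Rightarrow> real \<Rightarrow> real \<Rightarrow> real^3" where
  "gauss_map f u v = (let N = cross3 (partial_u f u v) (partial_v f u v) in N /\<^sub>R norm N)"

definition planar_curve :: "(real \<Rightarrow> real^3) \<Rightarrow> bool" where
  "planar_curve c \<longleftrightarrow> (\<exists>N d. N \<noteq> 0 \<and> (\<forall>t. N \<bullet> c t = d))"

definition on_sphere_about :: "(real \<Rightarrow> real^3) \<Rightarrow> real^3 \<Rightarrow> bool" where
  "on_sphere_about c z \<longleftrightarrow> (\<exists>\<rho>>0. range c \<subseteq> sphere z \<rho>)"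

text \<open>A plane counts as a sphere of infinite radius. This is unavoidable: in a family of
  spherical \<open>v\<close>-curves the centre in general runs to infinity at some values of \<open>u\<close>, where the
  curve is planar.\<close>

definition spherical_v_curves :: "surface \<Rightarrow> bool" where
  "spherical_v_curves f \<longleftrightarrow> (\<forall>u. (\<exists>z. on_sphere_about (f u) z) \<or> planar_curve (f u))"

text \<open>A non-planar curve lies on at most one sphere, so \<open>Z u\<close> is determined for every \<open>u\<close> in
  \<open>proper_spheres f\<close>. For planar \<open>v\<close>-curves there is no sphere of finite radius or (for a circle)
  no distinguished one.\<close>

definition proper_spheres :: "surface \<Rightarrow> real set" where
  "proper_spheres f = {u. \<not> planar_curve (f u)}"

definition sphere_centers :: "surface \<Rightarrow> (real \<Rightarrow> real^3) \<Rightarrow> bool" where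
  "sphere_centers f Z \<longleftrightarrow> (\<forall>u\<in>proper_spheres f. on_sphere_about (f u) (Z u))"


section \<open>Isothermic cylinders with one family of planar curvature lines\<close>

definition R :: "complex \<Rightarrow> real \<Rightarrow> complex" where
  "R \<tau> \<omega> = 2 * (theta2 \<tau> \<omega>)\<^sup>2 / (deriv (theta1 \<tau>) 0 * theta1 \<tau> (2 * \<omega>))"

definition gamma :: "complex \<Rightarrow> real \<Rightarrow> real \<Rightarrow> real \<Rightarrow> complex" where
  "gamma \<tau> \<omega> u x =
     - \<i> * R \<tau> \<omega> * theta1 \<tau> ((of_real u + \<i> * of_real x - 3 * of_real \<omega>) / 2)
       / theta1 \<tau> ((of_real u + \<i> * of_real x + of_real \<omega>) / 2)"

definition W1 :: "complex \<Rightarrow> real \<Rightarrow> real \<Rightarrow> complex" where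
  "W1 \<tau> \<omega> x =
     \<i> * (deriv (theta1 \<tau>) 0 / (2 * theta2 \<tau> \<omega>)) * (theta2 \<tau> (of_real \<omega> - \<i> * of_real x) / theta1 \<tau> (\<i> * of_real x))"

definition h :: "complex \<Rightarrow> real \<Rightarrow> real \<Rightarrow> real \<Rightarrow> real" where
  "h \<tau> \<omega> u x = ln (cmod (vector_derivative (\<lambda>y. gamma \<tau> \<omega> y x) (at u)))"

definition cyl :: "complex \<Rightarrow> real \<Rightarrow> (real \<Rightarrow> real) \<Rightarrow> (real \<Rightarrow> quat) \<Rightarrow> surface" where
  "cyl \<tau> \<omega> w \<Phi> u v =
     vec_of_quat (qinv (\<Phi> v) \<otimes>\<^sub>q qcomplex (gamma \<tau> \<omega> u (w v)) \<otimes>\<^sub>q qj \<otimes>\<^sub>q \<Phi> v)"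

definition smooth :: "(real \<Rightarrow> real) \<Rightarrow> bool" where
  "smooth g \<longleftrightarrow> (\<forall>n t. (deriv ^^ n) g differentiable at t)"

text \<open>\<open>r\<close> is the smooth, possibly sign changing root $\sqrt{1 - \mathrm w'^2}$.\<close>

definition admissible :: "complex \<Rightarrow> (real \<Rightarrow> real) \<Rightarrow> (real \<Rightarrow> real) \<Rightarrow> bool" where
  "admissible \<tau> w r \<longleftrightarrow>
     (\<forall>v. 0 < w v \<and> w v < 2 * pi * Im \<tau>) \<and> smooth w \<and>
     (\<forall>v. (r v)\<^sup>2 = 1 - (deriv w v)\<^sup>2) \<and> smooth r"

definition frame :: "complex \<Rightarrow> real \<Rightarrow> (real \<Rightarrow> real) \<Rightarrow> (real \<Rightarrow> real) \<Rightarrow> (real \<Rightarrow> quat) \<Rightarrow> bool" where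
  "frame \<tau> \<omega> w r \<Phi> \<longleftrightarrow>
     (\<forall>v. norm (\<Phi> v) = 1 \<and> \<Phi> differentiable at v \<and>
        vector_derivative \<Phi> (at v) \<otimes>\<^sub>q qinv (\<Phi> v) = qcomplex (of_real (r v) * W1 \<tau> \<omega> (w v)) \<otimes>\<^sub>q qk)"

text \<open>The normals of the planes containing the \<open>u\<close>-curves span the whole space.\<close>

definition generic_planes :: "surface \<Rightarrow> bool" where
  "generic_planes f \<longleftrightarrow> span {N. \<exists>v d. \<forall>u. N \<bullet> f u v = d} = UNIV"

definition planar_isothermic_cylinder ::
    "complex \<Rightarrow> complex \<Rightarrow> real \<Rightarrow> (real \<Rightarrow> real) \<Rightarrow> (real \<Rightarrow> real) \<Rightarrow> (real \<Rightarrow> quat) \<Rightarrow> bool" where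
  "planar_isothermic_cylinder \<tau>\<^sub>0 \<tau> \<omega> w r \<Phi> \<longleftrightarrow>
     Re \<tau>\<^sub>0 = 1/2 \<and> 0 < Im \<tau>\<^sub>0 \<and> (deriv ^^ 2) (theta2 \<tau>\<^sub>0) 0 = 0 \<and>
     Re \<tau> = 1/2 \<and> 0 < Im \<tau> \<and> Im \<tau> < Im \<tau>\<^sub>0 \<and>
     0 < \<omega> \<and> \<omega> < pi/4 \<and> deriv (theta2 \<tau>) \<omega> = 0 \<and>
     admissible \<tau> w r \<and> frame \<tau> \<omega> w r \<Phi> \<and> generic_planes (cyl \<tau> \<omega> w \<Phi>)"

definition from_fundamental_piece ::
    "surface \<Rightarrow> (real \<Rightarrow> real) \<Rightarrow> (real \<Rightarrow> real) \<Rightarrow> real \<Rightarrow> bool" where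
  "from_fundamental_piece f w r \<V> \<longleftrightarrow>
     0 < \<V> \<and> (\<forall>v. w (v + \<V>) = w v \<and> r (v + \<V>) = r v) \<and> \<not> (\<forall>u v. f u (v + \<V>) = f u v)"

definition axis_angle :: "(real \<Rightarrow> quat) \<Rightarrow> real \<Rightarrow> real^3 \<Rightarrow> real \<Rightarrow> bool" where
  "axis_angle \<Phi> \<V> A \<theta> \<longleftrightarrow>
     norm A = 1 \<and> 0 \<le> \<theta> \<and> \<theta> \<le> pi \<and>
     (\<exists>\<epsilon>\<in>{1, -1}. qinv (\<Phi> 0) \<otimes>\<^sub>q \<Phi> \<V> =
        \<epsilon> *\<^sub>R (qcomplex (of_real (cos (\<theta>/2))) + sin (\<theta>/2) *\<^sub>R quat_of_vec A))"


section \<open>Data of spherical curvature lines\<close>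

text \<open>\<open>U\<close>, \<open>U'\<close>, \<open>U1'\<close>, \<open>U2\<close> are the values at \<open>\<omega>\<close>. Like \<open>R \<tau> \<omega>\<close> they are real numbers when
  \<open>Re \<tau> = 1/2\<close>: for real arguments the values of \<open>theta1 \<tau>\<close>, \<open>theta2 \<tau>\<close> and of their derivatives
  are real multiples of $e^{i\pi/8}$, while \<open>theta3 \<tau>\<close> and \<open>theta4 \<tau>\<close> are complex conjugates.\<close>

definition U :: "complex \<Rightarrow> real \<Rightarrow> complex" where
  "U \<tau> \<omega> = - 1 / R \<tau> \<omega>"

definition U' :: "complex \<Rightarrow> real \<Rightarrow> complex" where
  "U' \<tau> \<omega> = - (1/2) * (deriv (theta1 \<tau>) 0 * deriv (theta1 \<tau>) (2 * \<omega>)) / (theta2 \<tau> \<omega>)\<^sup>2"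

definition U1' :: "complex \<Rightarrow> real \<Rightarrow> complex" where
  "U1' \<tau> \<omega> = (1/2) * (deriv (theta1 \<tau>) 0)\<^sup>2 / (theta2 \<tau> \<omega>)\<^sup>2"

definition U2 :: "complex \<Rightarrow> real \<Rightarrow> complex" where
  "U2 \<tau> \<omega> = (deriv (theta1 \<tau>) 0)\<^sup>2 / (theta2 \<tau> \<omega>)\<^sup>2 *
     ((theta1 \<tau> \<omega>)\<^sup>2 / (theta2 \<tau> 0)\<^sup>2 + (theta4 \<tau> \<omega>)\<^sup>2 / (theta3 \<tau> 0)\<^sup>2
        + (theta3 \<tau> \<omega>)\<^sup>2 / (theta4 \<tau> 0)\<^sup>2)"

definition Q3 :: "complex \<Rightarrow> real \<Rightarrow> real \<Rightarrow> complex" where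
  "Q3 \<tau> \<omega> s = 2 * U1' \<tau> \<omega> * of_real s ^ 3 - U2 \<tau> \<omega> * (of_real s)\<^sup>2
     - 2 * U' \<tau> \<omega> * of_real s - (U \<tau> \<omega>)\<^sup>2"

definition Q :: "complex \<Rightarrow> real \<Rightarrow> real \<Rightarrow> complex \<Rightarrow> complex \<Rightarrow> real \<Rightarrow> complex" where
  "Q \<tau> \<omega> \<delta> s\<^sub>1 s\<^sub>2 s =
     - ((of_real s - s\<^sub>1)\<^sup>2 * (of_real s - s\<^sub>2)\<^sup>2) + of_real (\<delta>\<^sup>2) * Q3 \<tau> \<omega> s"

definition s_fun :: "complex \<Rightarrow> real \<Rightarrow> (real \<Rightarrow> real) \<Rightarrow> real \<Rightarrow> real" where
  "s_fun \<tau> \<omega> w v = exp (- h \<tau> \<omega> \<omega> (w v))"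

text \<open>$\sqrt{Q(s(v))}$ with the sign of $\delta s'(v)$; \<open>Q\<close> is real since \<open>s\<^sub>1\<close>, \<open>s\<^sub>2\<close> are both
  real or complex conjugate.\<close>

definition sqrtQ ::
    "complex \<Rightarrow> real \<Rightarrow> (real \<Rightarrow> real) \<Rightarrow> real \<Rightarrow> complex \<Rightarrow> complex \<Rightarrow> real \<Rightarrow> real" where
  "sqrtQ \<tau> \<omega> w \<delta> s\<^sub>1 s\<^sub>2 v =
     sgn (\<delta> * deriv (s_fun \<tau> \<omega> w) v) * sqrt (Re (Q \<tau> \<omega> \<delta> s\<^sub>1 s\<^sub>2 (s_fun \<tau> \<omega> w v)))"

definition spherical_data ::
    "complex \<Rightarrow> real \<Rightarrow> (real \<Rightarrow> real) \<Rightarrow> (real \<Rightarrow> real) \<Rightarrow> real \<Rightarrow> complex \<Rightarrow> complex \<Rightarrow> bool" where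
  "spherical_data \<tau> \<omega> w r \<delta> s\<^sub>1 s\<^sub>2 \<longleftrightarrow>
     \<delta> \<noteq> 0 \<and> (s\<^sub>1 \<in> \<real> \<and> s\<^sub>2 \<in> \<real> \<or> s\<^sub>2 = cnj s\<^sub>1) \<and>
     (\<forall>v. complex_of_real (deriv (h \<tau> \<omega> \<omega>) (w v) * r v) =
            (of_real (s_fun \<tau> \<omega> w v) - s\<^sub>1) * (of_real (s_fun \<tau> \<omega> w v) - s\<^sub>2)
              / of_real (s_fun \<tau> \<omega> w v * \<delta>)) \<and>
     (\<forall>v. (s_fun \<tau> \<omega> w has_real_derivative sqrtQ \<tau> \<omega> w \<delta> s\<^sub>1 s\<^sub>2 v / \<delta>) (at v))"

text \<open>The coefficients of the axis; \<open>N\<close> stands for $|Z'(\omega)|$ and the argument \<open>q\<close> of \<open>z2\<close> for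
  the signed root $\sqrt{Q(s)}$.\<close>

definition z1 :: "complex \<Rightarrow> real \<Rightarrow> complex \<Rightarrow> complex \<Rightarrow> real \<Rightarrow> real \<Rightarrow> complex" where
  "z1 \<tau> \<omega> s\<^sub>1 s\<^sub>2 N s =
     1 / of_real (s * N) * (1 + of_real s * (R \<tau> \<omega>)\<^sup>2 * (U' \<tau> \<omega> + s\<^sub>1 * s\<^sub>2 * U1' \<tau> \<omega>))"

definition z2 :: "complex \<Rightarrow> real \<Rightarrow> real \<Rightarrow> real \<Rightarrow> real \<Rightarrow> real \<Rightarrow> complex" where
  "z2 \<tau> \<omega> \<delta> N s q = R \<tau> \<omega> / of_real (s * \<delta> * N) * of_real q"

definition z3 :: "complex \<Rightarrow> real \<Rightarrow> real \<Rightarrow> complex \<Rightarrow> complex \<Rightarrow> real \<Rightarrow> real \<Rightarrow> complex" where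
  "z3 \<tau> \<omega> \<delta> s\<^sub>1 s\<^sub>2 N s =
     R \<tau> \<omega> / of_real (s * \<delta> * N) *
       (- of_real (\<delta>\<^sup>2) * U1' \<tau> \<omega> * of_real s + (of_real s - s\<^sub>1) * (of_real s - s\<^sub>2))"

end

theory Submission
  imports Defs "HOL-Complex_Analysis.Complex_Analysis" "HOL-Library.Nat_Bijection"
begin

text \<open>Write $\gamma_u = G = |G| E$ with $e^h = |G|$. The condition $\vartheta_2'(\omega) = 0$ makes \<open>G\<close> a square of
  a quotient of theta functions, and the three-term relation of $\vartheta_1$ gives
  $e^h = 2\,\mathrm{Re}(\gamma\,\overline{W_1})$; with it the frame \<open>e1, e2, nv\<close> of the surface has the
  structure equations of a curvature line parametrisation. By Joachimsthal's theorem the centre of a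
  spherical \<open>v\<close>-curve is $Z = f + \alpha\,$\<open>e1\<close>$\,+ \beta\,$\<open>nv\<close> with $\alpha, \beta$ depending on \<open>u\<close>
  only, subject to one linear equation for each \<open>v\<close>. At $u = \omega$ the curve lies on a sphere about
  the origin, so $\alpha(\omega) = R$ and $\beta(\omega) = 0$; differentiating the linear equation there and
  inserting the equations for \<open>s\<close> yields $\alpha'(\omega) = R^2(U' + s_1 s_2 U_1')$ and
  $\beta'(\omega) = -\delta R U_1'$, hence $Z'(\omega)$. The identity $s_{\mathrm w}^2 = Q_3(s)$ used in this step
  is read off from the hypotheses on \<open>s\<close> instead of being proved for theta functions. The centres lie on the axis
  because the monodromy of the frame maps each \<open>v\<close>-curve to itself.\<close>

section \<open>Theta functions as bilateral series\<close>

text \<open>Nothing is known about the regularity of \<open>Z\<close>: it is an arbitrary choice of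
  centres, constrained only where the \<open>v\<close>-curve is not planar. Non-planarity near
  \<omega>, differentiability there and the value of Z' all come from solving the linear contact
  equation at two parameters \<open>a\<close>, \<open>b\<close> with s(a) \<noteq> s(b). Genericity
  of the planes supplies a point with w' \<noteq> 0; there s' \<noteq> 0, so such parameters exist.
  The identities for \<open>s\<close> are available only where w' \<noteq> 0, since the signed root
  carries the factor sgn (\<delta> s'). The coefficients \<alpha>', \<beta>' found there do not
  depend on \<open>v\<close>, so the formula for Z' holds for every \<open>v\<close> nonetheless.
  Dividing by theta values requires knowledge of their zeros, which the Jacobi triple product gives.
  The delicate value is theta1 (i w) in \<open>W1\<close>: w runs up to 2 pi Im \<tau>, twice as far
  as a comparison of moduli reaches. There Re \<tau> = 1/2 makes q^2 negative, which moves the first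
  zero off the imaginary axis.\<close>

text \<open>Completing the square. It dominates Gaussian decay times exponential growth by the
  geometric sequence e^(-m), which gives every theta series a summable majorant.\<close>

lemma gaussian_exponent_bound:
  fixes a B m :: real
  assumes "a > 0"
  shows "- (a * m\<^sup>2) + B * m \<le> (B + 1)\<^sup>2 / (4 * a) - m"
proof -
  have "0 \<le> (2 * a * m - (B + 1))\<^sup>2 / (4 * a)" using assms by simp
  also have "\<dots> = a * m\<^sup>2 - (B + 1) * m + (B + 1)\<^sup>2 / (4 * a)"
    using assms by (simp add: field_simps power2_eq_square)
  finally show ?thesis by (simp add: algebra_simps)
qed

lemma summable_exp_minus: "summable (\<lambda>n. exp (- real n))"
proof -
  have "(\<lambda>n. exp (-1) ^ n) = (\<lambda>n. exp (- real n))" by (auto simp: exp_of_nat_mult[symmetric])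
  moreover have "summable (\<lambda>n. exp (-1 :: real) ^ n)" by (rule summable_geometric) simp
  ultimately show ?thesis by simp
qed

text \<open>The pairing of n with -n-1 is the symmetry m \<mapsto> -m of the half-integers m = n +
  1/2; it folds a bilateral series with characteristic 1/2 into a cosine series.\<close>

lemma UNIV_int_split: "(UNIV :: int set) = range int \<union> range (\<lambda>n. - int n - 1)"
proof -
  have "x \<in> range int \<union> range (\<lambda>n. - int n - 1)" for x :: int
  proof (cases "x \<ge> 0")
    case True then show ?thesis by (metis UnI1 nonneg_int_cases rangeI)
  next
    case False
    then have "x = - int (nat (- x - 1)) - 1" by simp
    then show ?thesis by blast
  qed
  then show ?thesis by blast
qed

lemma summable_on_intI:
  fixes f :: "int \<Rightarrow> 'a :: banach"
  assumes "(\<lambda>n. f (int n)) summable_on UNIV" "(\<lambda>n. f (- int n - 1)) summable_on UNIV"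
  shows "f summable_on UNIV"
proof -
  have "f summable_on range int" "f summable_on range (\<lambda>n. - int n - 1)"
    using assms by (auto simp: summable_on_reindex inj_on_def o_def)
  then show ?thesis unfolding UNIV_int_split by (rule summable_on_Un_disjoint) auto
qed

lemma infsum_int_eq_suminf:
  fixes f :: "int \<Rightarrow> 'a :: banach"
  assumes "f summable_on UNIV"
  shows "(\<lambda>n. f (int n) + f (- int n - 1)) sums infsum f UNIV"
proof -
  have s: "f summable_on range int" "f summable_on range (\<lambda>n. - int n - 1)"
    using assms summable_on_subset_banach by blast+
  have "infsum f UNIV = infsum f (range int) + infsum f (range (\<lambda>n. - int n - 1))"
    unfolding UNIV_int_split using s by (intro infsum_Un_disjoint) auto
  moreover have "(\<lambda>n. f (int n)) sums infsum f (range int)"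
    using s(1) by (intro has_sum_imp_sums) (simp add: has_sum_iff infsum_reindex summable_on_reindex o_def inj_on_def)
  moreover have "(\<lambda>n. f (- int n - 1)) sums infsum f (range (\<lambda>n. - int n - 1))"
    using s(2) by (intro has_sum_imp_sums) (simp add: has_sum_iff infsum_reindex summable_on_reindex o_def inj_on_def)
  ultimately show ?thesis using sums_add by force
qed

text \<open>Theta series with characteristic \<open>c\<close>: c = 1/2 belongs to theta2 and c = 0
  to theta3. The bilateral index is what allows a change of lattice in a product of two
  series.\<close>

definition theta_term :: "complex \<Rightarrow> real \<Rightarrow> complex \<Rightarrow> int \<Rightarrow> complex" where
  "theta_term \<tau> c z n = exp (\<i> * of_real pi * \<tau> * of_real ((of_int n + c)\<^sup>2) + 2 * \<i> * of_real (of_int n + c) * z)"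

definition theta_char :: "complex \<Rightarrow> real \<Rightarrow> complex \<Rightarrow> complex" where
  "theta_char \<tau> c z = infsum (theta_term \<tau> c z) UNIV"

lemma theta_term_abs_summable:
  assumes "Im \<tau> > 0"
  shows "(\<lambda>n. norm (theta_term \<tau> c z n)) summable_on UNIV"
proof -
  define a where "a = pi * Im \<tau>"
  define B where "B = 2 * \<bar>Im z\<bar>"
  define K where "K = (B + 1)\<^sup>2 / (4 * a) + \<bar>c\<bar>"
  have a: "a > 0" using assms by (simp add: a_def)
  have bd: "norm (theta_term \<tau> c z n) \<le> exp K * exp (- \<bar>of_int n\<bar>)" for n
  proof -
    define m where "m = of_int n + c"
    have "- (a * \<bar>m\<bar>\<^sup>2) + B * \<bar>m\<bar> \<le> (B + 1)\<^sup>2 / (4 * a) - \<bar>m\<bar>"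
      by (rule gaussian_exponent_bound[OF a])
    moreover have "- (2 * m * Im z) \<le> B * \<bar>m\<bar>"
      using abs_ge_self[of "- (2 * m * Im z)"] by (simp add: B_def abs_mult mult_ac)
    moreover have "\<bar>of_int n\<bar> \<le> \<bar>m\<bar> + \<bar>c\<bar>" unfolding m_def by linarith
    ultimately have "- (a * m\<^sup>2) - 2 * m * Im z \<le> K - \<bar>of_int n\<bar>"
      unfolding K_def by simp
    moreover have "norm (theta_term \<tau> c z n) = exp (- (a * m\<^sup>2) - 2 * m * Im z)"
      unfolding theta_term_def norm_exp_eq_Re m_def[symmetric] a_def
      by (simp add: algebra_simps power2_eq_square)
    ultimately show ?thesis by (simp add: mult_exp_exp)
  qed
  have g: "(\<lambda>n. exp (- real n)) summable_on UNIV"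
    by (intro summable_nonneg_imp_summable_on summable_exp_minus) simp
  have "(\<lambda>n::int. exp (- \<bar>of_int n\<bar>) :: real) summable_on UNIV"
  proof (rule summable_on_intI)
    have "(\<lambda>n. exp (- real n) * exp (-1)) summable_on UNIV"
      by (rule summable_on_cmult_left) (rule g)
    moreover have "(\<lambda>n. exp (- real n) * exp (-1)) = (\<lambda>n. exp (- \<bar>of_int (- int n - 1)\<bar>))"
      by (auto simp: exp_add[symmetric])
    ultimately show "(\<lambda>n. exp (- \<bar>of_int (- int n - 1)\<bar>) :: real) summable_on UNIV" by simp
  qed (use g in simp)
  then have "(\<lambda>n::int. exp K * exp (- \<bar>of_int n\<bar>)) summable_on UNIV"
    by (rule summable_on_cmult_right)
  then show ?thesis
    by (rule summable_on_comparison_test) (use bd in auto)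
qed

lemma theta_term_summable: "Im \<tau> > 0 \<Longrightarrow> theta_term \<tau> c z summable_on UNIV"
  using theta_term_abs_summable abs_summable_summable by blast

lemma theta_term_half:
  "theta_term \<tau> (1/2) z (int n) + theta_term \<tau> (1/2) z (- int n - 1)
    = 2 * (nome \<tau> ((of_nat n + 1/2)\<^sup>2) * cos ((2 * of_nat n + 1) * z))"
proof -
  have "theta_term \<tau> (1/2) z (int n) = nome \<tau> ((of_nat n + 1/2)\<^sup>2) * exp (\<i> * ((2 * of_nat n + 1) * z))"
    unfolding theta_term_def nome_def exp_add[symmetric] by (simp add: algebra_simps)
  moreover have "theta_term \<tau> (1/2) z (- int n - 1) = nome \<tau> ((of_nat n + 1/2)\<^sup>2) * exp (- (\<i> * ((2 * of_nat n + 1) * z)))"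
    unfolding theta_term_def nome_def exp_add[symmetric] by (simp add: algebra_simps power2_eq_square)
  ultimately show ?thesis
    by (simp add: cos_exp_eq algebra_simps)
qed

lemma theta2_sums:
  assumes "Im \<tau> > 0"
  shows "(\<lambda>n. 2 * (nome \<tau> ((of_nat n + 1/2)\<^sup>2) * cos ((2 * of_nat n + 1) * z))) sums theta_char \<tau> (1/2) z"
  using infsum_int_eq_suminf[OF theta_term_summable[OF assms, of "1/2" z]]
  unfolding theta_term_half theta_char_def .

lemma theta2_summable:
  assumes "Im \<tau> > 0"
  shows "summable (\<lambda>n. nome \<tau> ((of_nat n + 1/2)\<^sup>2) * cos ((2 * of_nat n + 1) * z))"
  using sums_summable[OF theta2_sums[OF assms]] by (subst (asm) summable_cmult_iff) auto

lemma theta2_eq_theta_char: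
  assumes "Im \<tau> > 0"
  shows "theta2 \<tau> z = theta_char \<tau> (1/2) z"
  unfolding theta2_def using theta2_sums[OF assms, of z] suminf_mult[OF theta2_summable[OF assms, of z], of 2]
  by (simp add: sums_iff)

lemma sin_minus_nat_pi: "sin (y - of_nat n * of_real pi) = (-1) ^ n * sin (y::complex)"
proof (induction n)
  case (Suc n)
  have "sin (y - of_nat (Suc n) * of_real pi) = sin (y - of_nat n * of_real pi - of_real pi)"
    by (simp add: algebra_simps)
  also have "\<dots> = - sin (y - of_nat n * of_real pi)" by (simp add: sin_diff)
  finally show ?case using Suc by simp
qed simp

lemma cos_odd_shift:
  "cos ((2 * of_nat n + 1) * (z - of_real pi / 2)) = (-1) ^ n * sin ((2 * of_nat n + 1) * (z::complex))"
proof -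
  have "cos ((2 * of_nat n + 1) * (z - of_real pi / 2)) = cos ((2 * of_nat n + 1) * z - of_nat n * of_real pi - of_real pi / 2)"
    by (simp add: algebra_simps add_divide_distrib)
  also have "\<dots> = sin ((2 * of_nat n + 1) * z - of_nat n * of_real pi)"
    by (simp only: cos_diff[of _ "of_real pi / 2"] cos_of_real_pi_half sin_of_real_pi_half)
      simp
  finally show ?thesis by (simp only: sin_minus_nat_pi)
qed

text \<open>Through this shift the analytic facts about theta1 are inherited from theta2, so series
  are handled only for the latter.\<close>

lemma theta1_eq_theta2: "theta1 \<tau> z = theta2 \<tau> (z - of_real pi / 2)"
  unfolding theta1_def theta2_def cos_odd_shift by (simp add: mult_ac)

lemma theta2_minus [simp]: "theta2 \<tau> (- z) = theta2 \<tau> z"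
  unfolding theta2_def by simp

lemma theta2_plus_pi:
  assumes "Im \<tau> > 0"
  shows "theta2 \<tau> (z + of_real pi) = - theta2 \<tau> z"
proof -
  have c: "cos ((2 * of_nat n + 1) * (z + of_real pi)) = - cos ((2 * of_nat n + 1) * z)" for n
  proof -
    have "cos (y + of_nat k * of_real pi) = (-1) ^ k * cos y" for k and y :: complex
      by (induction k) (simp_all add: distrib_right cos_add add.assoc[symmetric] add.commute[of "of_real pi"])
    from this[of "(2 * of_nat n + 1) * z" "2 * n + 1"] show ?thesis by (simp add: algebra_simps)
  qed
  show ?thesis unfolding theta2_def c using theta2_summable[OF assms] by (simp add: suminf_minus)
qed

lemma theta1_minus [simp]:
  assumes "Im \<tau> > 0"
  shows "theta1 \<tau> (- z) = - theta1 \<tau> z"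
proof -
  have "theta1 \<tau> (- z) = theta2 \<tau> (- (z - of_real pi / 2 + of_real pi))"
    unfolding theta1_eq_theta2 by (rule arg_cong[where f = "theta2 \<tau>"]) simp
  also have "\<dots> = - theta1 \<tau> z"
    unfolding theta2_minus theta2_plus_pi[OF assms] theta1_eq_theta2 ..
  finally show ?thesis .
qed

section \<open>Products of theta series and the three-term relation\<close>

lemma theta_product_infsum:
  assumes "Im \<sigma> > 0"
  shows theta_product_summable: "(\<lambda>(m, n). theta_term \<sigma> c u m * theta_term \<sigma> d v n) summable_on UNIV \<times> UNIV"
    and "infsum (\<lambda>(m, n). theta_term \<sigma> c u m * theta_term \<sigma> d v n) (UNIV \<times> UNIV) = theta_char \<sigma> c u * theta_char \<sigma> d v"
proof -
  let ?f = "\<lambda>(m, n). theta_term \<sigma> c u m * theta_term \<sigma> d v n"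
  have n: "(\<lambda>n. norm (theta_term \<sigma> c u n)) summable_on UNIV" for c u
    by (rule theta_term_abs_summable[OF assms])
  have "(\<lambda>p. norm (?f p)) summable_on UNIV \<times> UNIV"
    by (rule Infinite_Sum.abs_summable_on_Sigma_iff[THEN iffD2])
      (auto simp: norm_mult infsum_cmult_right' infsum_nonneg intro!: summable_on_cmult_left summable_on_cmult_right n)
  then show s: "?f summable_on UNIV \<times> UNIV"
    by (rule abs_summable_summable)
  have "infsum ?f (UNIV \<times> UNIV) = (\<Sum>\<^sub>\<infinity>m. \<Sum>\<^sub>\<infinity>n. theta_term \<sigma> c u m * theta_term \<sigma> d v n)"
    using infsum_Sigma'_banach[OF s] by simp
  then show "infsum ?f (UNIV \<times> UNIV) = theta_char \<sigma> c u * theta_char \<sigma> d v"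
    by (simp add: infsum_cmult_right' infsum_cmult_left' theta_char_def)
qed

text \<open>The product is an absolutely convergent sum over pairs of half-integers. Passing to
  half-sum and half-difference diagonalises both the quadratic and the linear exponent and doubles
  \<tau>; the parity of m + n decides which of the two new indices is a half-integer, hence two
  terms.\<close>

lemma theta2_add_diff:
  assumes "Im \<tau> > 0"
  shows "theta2 \<tau> (x + y) * theta2 \<tau> (x - y)
    = theta_char (2 * \<tau>) 0 (2 * x) * theta_char (2 * \<tau>) (1/2) (2 * y)
    + theta_char (2 * \<tau>) (1/2) (2 * x) * theta_char (2 * \<tau>) 0 (2 * y)"
proof -
  define F where "F = (\<lambda>(m, n). theta_term \<tau> (1/2) (x + y) m * theta_term \<tau> (1/2) (x - y) n)"
  define G where "G = (\<lambda>c d (k, l). theta_term (2 * \<tau>) c (2 * x) k * theta_term (2 * \<tau>) d (2 * y) l)"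
  \<comment> \<open>With j = 1 the half-integers are m + 1/2 = k + (l + 1/2) and n + 1/2 = k - (l +
    1/2); with j = 0 they are (k + 1/2) + l and (k + 1/2) - l. Since m + n = 2k - j, the two ranges
    are the two parity classes.\<close>
  define p where "p = (\<lambda>j (k, l). (k + l, k - l - j :: int))"
  have \<tau>2: "Im (2 * \<tau>) > 0" using assms by simp
  have F1: "F (p 1 q) = G 0 (1/2) q" for q
    unfolding F_def G_def p_def theta_term_def mult_exp_exp case_prod_unfold fst_conv snd_conv
    by (rule arg_cong[where f = exp]) (simp add: field_simps power2_eq_square)
  have F2: "F (p 0 q) = G (1/2) 0 q" for q
    unfolding F_def G_def p_def theta_term_def mult_exp_exp case_prod_unfold fst_conv snd_conv
    by (rule arg_cong[where f = exp]) (simp add: field_simps power2_eq_square)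
  have inj: "inj_on (p j) UNIV" for j by (auto simp: inj_on_def p_def)
  have disj: "range (p 1) \<inter> range (p 0) = {}"
  proof -
    have "False" if "k + l = k' + l'" "k - l - 1 = k' - l'" for k l k' l' :: int
      using that by presburger
    then show ?thesis by (auto simp: p_def)
  qed
  have un: "UNIV \<times> UNIV = range (p 1) \<union> range (p 0)"
  proof -
    have "(m, n) \<in> range (p 1) \<union> range (p 0)" for m n
    proof (cases "even (m + n)")
      case True
      then have "(m, n) = p 0 ((m + n) div 2, (m - n) div 2)" unfolding p_def prod.case prod.inject by presburger
      then show ?thesis by blast
    next
      case False
      then have "(m, n) = p 1 ((m + n + 1) div 2, (m - n - 1) div 2)" unfolding p_def prod.case prod.inject by presburger
      then show ?thesis by blast
    qed
    then show ?thesis by auto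
  qed
  have s: "F summable_on range (p j)" for j
    using theta_product_summable[OF assms] unfolding F_def
    by (rule summable_on_subset_banach) auto
  have "infsum F (UNIV \<times> UNIV) = infsum F (range (p 1)) + infsum F (range (p 0))"
    unfolding un by (intro infsum_Un_disjoint s disj)
  also have "infsum F (range (p 1)) = infsum (G 0 (1/2)) (UNIV \<times> UNIV)"
    by (simp add: infsum_reindex[OF inj] o_def F1)
  also have "infsum F (range (p 0)) = infsum (G (1/2) 0) (UNIV \<times> UNIV)"
    by (simp add: infsum_reindex[OF inj] o_def F2)
  finally show ?thesis
    unfolding F_def G_def theta_product_infsum(2)[OF assms] theta_product_infsum(2)[OF \<tau>2] theta2_eq_theta_char[OF assms] .
qed

text \<open>The Pluecker relation: by the preceding lemma the products
  $\vartheta_1(x+y)\vartheta_1(x-y)$ are the $2\times2$ minors of one matrix with two rows.\<close>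

lemma theta1_three_term:
  assumes "Im \<tau> > 0"
  shows "theta1 \<tau> (a + b) * theta1 \<tau> (a - b) * theta1 \<tau> (c + d) * theta1 \<tau> (c - d)
    + theta1 \<tau> (a + c) * theta1 \<tau> (a - c) * theta1 \<tau> (d + b) * theta1 \<tau> (d - b)
    + theta1 \<tau> (a + d) * theta1 \<tau> (a - d) * theta1 \<tau> (b + c) * theta1 \<tau> (b - c) = 0"
proof -
  define A where "A x = theta_char (2 * \<tau>) 0 (2 * x - of_real pi)" for x
  define B where "B x = theta_char (2 * \<tau>) (1/2) (2 * x - of_real pi)" for x
  define A' where "A' y = theta_char (2 * \<tau>) 0 (2 * y)" for y
  define B' where "B' y = theta_char (2 * \<tau>) (1/2) (2 * y)" for y
  have \<tau>2: "Im (2 * \<tau>) > 0" using assms by simp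
  have P: "theta1 \<tau> (x + y) * theta1 \<tau> (x - y) = A x * B' y + B x * A' y" for x y
    using theta2_add_diff[OF assms, of "x - of_real pi / 2" y]
    by (simp add: theta1_eq_theta2 A_def B_def A'_def B'_def algebra_simps)
  \<comment> \<open>The shift by pi fixes the series with characteristic 0 and negates the one with
    characteristic 1/2. Hence \<open>P\<close> becomes A'(x) B'(y) - B'(x) A'(y), a minor of the
    matrix with rows A' and B'.\<close>
  have "theta_term (2 * \<tau>) 0 (2 * x - of_real pi) n = theta_term (2 * \<tau>) 0 (2 * x) n" for x n
  proof -
    have "exp (- (\<i> * (of_int n * (of_real pi * 2)))) = 1"
      using exp_integer_2pi[of "- of_int n"] by (simp add: mult_ac)
    then show ?thesis by (simp add: theta_term_def algebra_simps exp_add exp_diff exp_minus)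
  qed
  then have AA': "A x = A' x" for x
    unfolding A_def A'_def theta_char_def by presburger
  have BB': "B x = - B' x" for x
    using theta2_plus_pi[OF \<tau>2, of "2 * x - of_real pi"]
    unfolding B_def B'_def theta2_eq_theta_char[OF \<tau>2] by simp
  show ?thesis
    unfolding mult.assoc[symmetric] P unfolding mult.assoc P AA' BB' by (simp add: algebra_simps)
qed

section \<open>Holomorphy and behaviour under complex conjugation\<close>

lemma norm_nome: "norm (nome \<tau> (of_real x)) = exp (- (pi * Im \<tau> * x))"
  by (simp add: nome_def)

lemma norm_cos_le_exp: "norm (cos (z::complex)) \<le> exp \<bar>Im z\<bar>"
proof -
  have "norm (cos z) \<le> (norm (exp (\<i> * z)) + norm (exp (- (\<i> * z)))) / 2"
    unfolding cos_exp_eq norm_divide norm_numeral by (intro divide_right_mono norm_triangle_ineq) auto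
  also have "\<dots> \<le> exp \<bar>Im z\<bar>" by (cases "Im z \<ge> 0") auto
  finally show ?thesis .
qed

lemma theta2_term_bound:
  assumes "Im \<tau> > 0" "\<bar>Im z\<bar> \<le> B"
  shows "norm (nome \<tau> ((of_nat n + 1/2)\<^sup>2) * cos ((2 * of_nat n + 1) * z))
    \<le> exp ((2 * B + 1)\<^sup>2 / (4 * (pi * Im \<tau>))) * exp (- real n)"
proof -
  define m where "m = real n + 1/2"
  have "- (pi * Im \<tau> * m\<^sup>2) + 2 * B * m \<le> (2 * B + 1)\<^sup>2 / (4 * (pi * Im \<tau>)) - m"
    by (rule gaussian_exponent_bound) (use assms in simp)
  moreover have "2 * m * \<bar>Im z\<bar> \<le> 2 * B * m"
    using mult_left_mono[OF assms(2), of "2 * m"] by (simp add: m_def mult_ac)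
  ultimately have *: "- (pi * Im \<tau> * m\<^sup>2) + 2 * m * \<bar>Im z\<bar> \<le> (2 * B + 1)\<^sup>2 / (4 * (pi * Im \<tau>)) - real n"
    unfolding m_def by linarith
  have c: "(of_nat n + 1/2)\<^sup>2 = complex_of_real (m\<^sup>2)" "2 * of_nat n + 1 = complex_of_real (2 * m)"
    by (simp_all add: m_def)
  have "norm (cos ((2 * of_nat n + 1) * z)) \<le> exp (2 * m * \<bar>Im z\<bar>)"
    using norm_cos_le_exp[of "of_real (2 * m) * z"] unfolding c by (simp add: abs_mult m_def)
  then have "norm (nome \<tau> ((of_nat n + 1/2)\<^sup>2) * cos ((2 * of_nat n + 1) * z))
     \<le> exp (- (pi * Im \<tau> * m\<^sup>2)) * exp (2 * m * \<bar>Im z\<bar>)"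
    unfolding norm_mult c norm_nome by (intro mult_left_mono) auto
  also have "\<dots> \<le> exp ((2 * B + 1)\<^sup>2 / (4 * (pi * Im \<tau>)) - real n)"
    unfolding mult_exp_exp using * by simp
  finally show ?thesis by (simp add: exp_diff exp_minus field_simps)
qed

lemma theta2_holomorphic:
  assumes "Im \<tau> > 0"
  shows "theta2 \<tau> holomorphic_on A"
proof -
  have "(\<lambda>z. \<Sum>n. nome \<tau> ((of_nat n + 1/2)\<^sup>2) * cos ((2 * of_nat n + 1) * z)) holomorphic_on UNIV"
  proof (rule holomorphic_uniform_sequence)
    show "\<exists>d. 0 < d \<and> cball x d \<subseteq> UNIV \<and> uniform_limit (cball x d)
        (\<lambda>N z. \<Sum>n<N. nome \<tau> ((of_nat n + 1/2)\<^sup>2) * cos ((2 * of_nat n + 1) * z))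
        (\<lambda>z. \<Sum>n. nome \<tau> ((of_nat n + 1/2)\<^sup>2) * cos ((2 * of_nat n + 1) * z)) sequentially" for x
    proof (intro exI[of _ 1] conjI Weierstrass_m_test)
      fix n z assume z: "z \<in> cball x 1"
      then have "\<bar>Im z\<bar> \<le> \<bar>Im x\<bar> + 1"
        using abs_Im_le_cmod[of "x - z"] by (auto simp: dist_norm)
      then show "norm (nome \<tau> ((of_nat n + 1/2)\<^sup>2) * cos ((2 * of_nat n + 1) * z))
          \<le> exp ((2 * (\<bar>Im x\<bar> + 1) + 1)\<^sup>2 / (4 * (pi * Im \<tau>))) * exp (- real n)"
        by (rule theta2_term_bound[OF assms])
    qed (auto intro: summable_mult summable_exp_minus)
  qed (auto intro!: holomorphic_intros)
  then have "theta2 \<tau> holomorphic_on UNIV" unfolding theta2_def by (intro holomorphic_intros)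
  then show ?thesis by (rule holomorphic_on_subset) auto
qed

lemma theta1_holomorphic:
  assumes "Im \<tau> > 0"
  shows "theta1 \<tau> holomorphic_on A"
proof -
  have "theta2 \<tau> \<circ> (\<lambda>z. z - of_real pi / 2) holomorphic_on UNIV"
    by (intro holomorphic_on_compose theta2_holomorphic assms holomorphic_intros)
  then have "theta1 \<tau> holomorphic_on UNIV" by (simp add: o_def flip: theta1_eq_theta2)
  then show ?thesis by (rule holomorphic_on_subset) auto
qed

lemma theta_has_field_derivative:
  assumes "Im \<tau> > 0"
  shows "(theta1 \<tau> has_field_derivative deriv (theta1 \<tau>) z) (at z within A)"
    and "(theta2 \<tau> has_field_derivative deriv (theta2 \<tau>) z) (at z within A)"
  using holomorphic_derivI[OF theta1_holomorphic[OF assms, of UNIV], of z]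
    holomorphic_derivI[OF theta2_holomorphic[OF assms, of UNIV], of z]
  by (auto intro: has_field_derivative_at_within)

lemmas theta_derivative_intros [derivative_intros] =
  theta_has_field_derivative[THEN DERIV_chain2]

text \<open>Here cnj \<tau> = 1 - \<tau>, and (n + 1/2)^2 = n(n + 1) + 1/4 with n(n + 1) even, so
  the additional factor has the same phase for all n and can be pulled out of the series.\<close>

lemma cnj_nome_odd_square:
  assumes "Re \<tau> = 1/2"
  shows "cnj (nome \<tau> ((of_nat n + 1/2)\<^sup>2)) = exp (- (\<i> * of_real (pi / 4))) * nome \<tau> ((of_nat n + 1/2)\<^sup>2)"
proof -
  define x where "x = (real n + 1/2)\<^sup>2"
  obtain k where k: "n * (n + 1) = 2 * k" by (metis even_mult_iff even_plus_one_iff evenE)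
  then have "real n * (real n + 1) = 2 * real k" by (metis of_nat_1 of_nat_add of_nat_mult of_nat_numeral)
  then have x: "x = 2 * real k + 1/4" unfolding x_def by (simp add: power2_eq_square field_simps)
  have \<tau>: "cnj \<tau> = 1 - \<tau>" using assms by (simp add: complex_eq_iff)
  have "cnj (nome \<tau> (of_real x)) = exp (- (\<i> * of_real pi * (1 - \<tau>) * of_real x))"
    by (simp add: nome_def exp_cnj \<tau>)
  also have "\<dots> = exp (- (\<i> * of_real pi * of_real x)) * nome \<tau> (of_real x)"
    by (simp add: nome_def mult_exp_exp algebra_simps)
  also have "exp (- (\<i> * of_real pi * of_real x)) = exp (- (\<i> * of_real (pi / 4))) * exp (of_real (2 * real_of_int (- int k) * pi) * \<i>)"
    unfolding mult_exp_exp x by (rule arg_cong[where f = exp]) (simp add: algebra_simps)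
  also have "exp (of_real (2 * real_of_int (- int k) * pi) * \<i>) = 1"
    by (rule exp_integer_2pi) simp
  finally show ?thesis by (simp add: x_def)
qed

lemma cnj_theta:
  assumes "Im \<tau> > 0" "Re \<tau> = 1/2"
  shows cnj_theta1: "cnj (theta1 \<tau> z) = exp (- (\<i> * of_real (pi / 4))) * theta1 \<tau> (cnj z)"
    and cnj_theta2: "cnj (theta2 \<tau> z) = exp (- (\<i> * of_real (pi / 4))) * theta2 \<tau> (cnj z)"
proof -
  show *: "cnj (theta2 \<tau> z) = exp (- (\<i> * of_real (pi / 4))) * theta2 \<tau> (cnj z)" for z
  proof -
    have "(\<lambda>n. cnj (nome \<tau> ((of_nat n + 1/2)\<^sup>2) * cos ((2 * of_nat n + 1) * z))) sums
        cnj (\<Sum>n. nome \<tau> ((of_nat n + 1/2)\<^sup>2) * cos ((2 * of_nat n + 1) * z))"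
      by (rule sums_cnj[THEN iffD2] summable_sums theta2_summable assms)+
    moreover have "cnj (nome \<tau> ((of_nat n + 1/2)\<^sup>2) * cos ((2 * of_nat n + 1) * z))
       = exp (- (\<i> * of_real (pi / 4))) * (nome \<tau> ((of_nat n + 1/2)\<^sup>2) * cos ((2 * of_nat n + 1) * cnj z))" for n
      unfolding complex_cnj_mult cnj_nome_odd_square[OF assms(2)] by (simp add: cnj_cos)
    ultimately show ?thesis
      unfolding theta2_def using suminf_mult[OF theta2_summable[OF assms(1), of "cnj z"]]
      by (simp add: sums_iff)
  qed
  show "cnj (theta1 \<tau> z) = exp (- (\<i> * of_real (pi / 4))) * theta1 \<tau> (cnj z)"
    unfolding theta1_eq_theta2 * by simp
qed

lemma cnj_deriv_theta:
  assumes "Im \<tau> > 0" "Re \<tau> = 1/2"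
  shows "cnj (deriv (theta1 \<tau>) z) = exp (- (\<i> * of_real (pi / 4))) * deriv (theta1 \<tau>) (cnj z)"
proof -
  let ?c = "exp (- (\<i> * of_real (pi / 4)))"
  have "(cnj \<circ> theta1 \<tau> \<circ> cnj has_field_derivative cnj (deriv (theta1 \<tau>) z)) (at (cnj z))"
    using theta_has_field_derivative(1)[OF assms(1)]
    by (subst has_field_derivative_cnj_cnj) auto
  moreover have "cnj \<circ> theta1 \<tau> \<circ> cnj = (\<lambda>w. ?c * theta1 \<tau> w)"
    by (auto simp: cnj_theta1[OF assms])
  moreover have "((\<lambda>w. ?c * theta1 \<tau> w) has_field_derivative ?c * deriv (theta1 \<tau>) (cnj z)) (at (cnj z))"
    by (intro DERIV_cmult theta_has_field_derivative assms)
  ultimately show ?thesis using DERIV_unique by metis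
qed

text \<open>For integer squares the additional phase is (-1)^(n^2) = (-1)^n, precisely the sign that
  distinguishes theta4 from theta3.\<close>

lemma cnj_theta3_of_real:
  assumes "Im \<tau> > 0" "Re \<tau> = 1/2"
  shows "cnj (theta3 \<tau> (of_real x)) = theta4 \<tau> (of_real x)"
proof -
  let ?t = "\<lambda>n. nome \<tau> ((of_nat (Suc n))\<^sup>2) * cos (2 * of_nat (Suc n) * of_real x)"
  have "norm (?t n) \<le> exp (1 / (4 * (pi * Im \<tau>))) * exp (- real n)" for n
  proof -
    have c: "(of_nat (Suc n))\<^sup>2 = complex_of_real ((real (Suc n))\<^sup>2)" by simp
    have "norm (cos (complex_of_real (2 * real (Suc n) * x))) \<le> 1"
      unfolding cos_of_real norm_of_real by simp
    then have "norm (?t n) \<le> exp (- (pi * Im \<tau> * (real (Suc n))\<^sup>2)) * 1"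
      unfolding norm_mult c norm_nome by (intro mult_left_mono) auto
    also have "\<dots> \<le> exp (1 / (4 * (pi * Im \<tau>)) - real n)"
      using gaussian_exponent_bound[of "pi * Im \<tau>" "real (Suc n)" 0] assms by simp
    finally show ?thesis by (simp add: exp_diff exp_minus field_simps)
  qed
  then have "summable ?t"
    by (rule summable_comparison_test'[rotated]) (auto intro: summable_mult summable_exp_minus)
  then have "(\<lambda>n. cnj (?t n)) sums cnj (\<Sum>n. ?t n)"
    by (intro sums_cnj[THEN iffD2] summable_sums)
  moreover have "cnj (?t n) = (-1) ^ Suc n * ?t n" for n
  proof -
    define x where "x = (real (Suc n))\<^sup>2"
    have \<tau>: "cnj \<tau> = 1 - \<tau>" using assms by (simp add: complex_eq_iff)
    have "cnj (nome \<tau> (of_real x)) = exp (- (\<i> * of_real pi * (1 - \<tau>) * of_real x))"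
      by (simp add: nome_def exp_cnj \<tau>)
    also have "\<dots> = exp (- (\<i> * of_real pi * of_real x)) * nome \<tau> (of_real x)"
      by (simp add: nome_def mult_exp_exp algebra_simps)
    also have "exp (- (\<i> * of_real pi * of_real x)) = (exp (- (\<i> * of_real pi))) ^ ((Suc n) ^ 2)"
      by (simp add: x_def exp_of_nat_mult[symmetric] mult_ac)
    also have "\<dots> = (-1) ^ Suc n" by (cases "even n") (simp_all add: exp_minus)
    finally show ?thesis by (simp add: x_def cnj_cos)
  qed
  ultimately show ?thesis
    unfolding theta3_def theta4_def by (simp add: sums_iff mult.assoc)
qed

section \<open>The Jacobi triple product and the zeros of the theta functions\<close>

text \<open>Coefficients of the partial products in the basis cos ((2n + 1) z), one factor per step.
  The truncated subtraction at n = 0 is intended: the index -1 folds back to 0 because cos (-z) =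
  cos z.\<close>

primrec triple_coeff :: "complex \<Rightarrow> nat \<Rightarrow> nat \<Rightarrow> complex" where
  "triple_coeff p 0 n = (if n = 0 then 1 else 0)"
| "triple_coeff p (Suc N) n = (1 + p ^ (2 * N + 2)) * triple_coeff p N n
     + p ^ (N + 1) * (triple_coeff p N (n + 1) + triple_coeff p N (n - 1))"

lemma triple_coeff_eq_0: "n > N \<Longrightarrow> triple_coeff p N n = 0"
  by (induction N arbitrary: n) auto

lemma finite_triple_product:
  fixes p z :: complex
  shows "cos z * (\<Prod>m<N. 1 + 2 * p ^ Suc m * cos (2 * z) + p ^ (2 * Suc m))
    = (\<Sum>n\<le>N. triple_coeff p N n * cos ((2 * of_nat n + 1) * z))"
proof (induction N)
  case (Suc N)
  let ?e = "triple_coeff p N" and ?C = "\<lambda>n. cos ((2 * of_nat n + 1) * z)"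
  have C: "2 * cos (2 * z) * ?C n = ?C (n + 1) + ?C (n - 1)" for n
  proof (cases n)
    case 0 then show ?thesis
      using cos_times_cos[of "2 * z" z] by (simp add: algebra_simps)
  next
    case (Suc k)
    have "2 * cos (2 * z) * ?C n = cos (2 * z - (2 * of_nat n + 1) * z) + cos (2 * z + (2 * of_nat n + 1) * z)"
      by (subst mult.assoc, subst cos_times_cos) simp
    also have "cos (2 * z - (2 * of_nat n + 1) * z) = cos (- ((2 * of_nat k + 1) * z))"
      by (rule arg_cong[where f = cos]) (simp add: Suc algebra_simps)
    finally show ?thesis unfolding cos_minus by (simp add: Suc algebra_simps)
  qed
  have shift: "(\<Sum>n\<le>Suc N. (?e (n + 1) + ?e (n - 1)) * ?C n) = (\<Sum>n\<le>N. ?e n * (?C (n + 1) + ?C (n - 1)))"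
  proof -
    have "(\<Sum>n\<le>Suc N. ?e (n - 1) * ?C n) = ?e 0 * ?C 0 + (\<Sum>n\<le>N. ?e n * ?C (n + 1))"
      by (subst sum.atMost_Suc_shift) simp
    moreover have "(\<Sum>n\<le>Suc N. ?e (n + 1) * ?C n) = (\<Sum>n<N. ?e (Suc n) * ?C n)"
      by (simp add: triple_coeff_eq_0 lessThan_Suc_atMost[symmetric])
    moreover have "(\<Sum>n\<le>N. ?e n * ?C (n - 1)) = ?e 0 * ?C 0 + (\<Sum>n<N. ?e (Suc n) * ?C n)"
      by (simp add: lessThan_Suc_atMost[symmetric] sum.lessThan_Suc_shift del: sum.lessThan_Suc)
    ultimately show ?thesis
      by (simp only: distrib_left[of "?e _"] distrib_right[of "?e _"] sum.distrib add.commute add.left_commute)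
  qed
  have "(\<Sum>n\<le>Suc N. triple_coeff p (Suc N) n * ?C n)
     = (1 + p ^ (2 * N + 2)) * (\<Sum>n\<le>Suc N. ?e n * ?C n) + p ^ (N + 1) * (\<Sum>n\<le>Suc N. (?e (n + 1) + ?e (n - 1)) * ?C n)"
  proof -
    have "triple_coeff p (Suc N) n * ?C n = (1 + p ^ (2 * N + 2)) * (?e n * ?C n) + p ^ (N + 1) * ((?e (n + 1) + ?e (n - 1)) * ?C n)" for n
      by (simp only: triple_coeff.simps distrib_right mult.assoc)
    then show ?thesis by (simp only: sum.distrib sum_distrib_left)
  qed
  also have "\<dots> = (1 + p ^ (2 * N + 2)) * (\<Sum>n\<le>N. ?e n * ?C n) + p ^ (N + 1) * (\<Sum>n\<le>N. ?e n * (2 * cos (2 * z) * ?C n))"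
    unfolding shift C by (simp add: triple_coeff_eq_0)
  also have "\<dots> = (1 + 2 * p ^ Suc N * cos (2 * z) + p ^ (2 * Suc N)) * (\<Sum>n\<le>N. ?e n * ?C n)"
    by (simp add: sum_distrib_left algebra_simps flip: sum.distrib)
  finally show ?case using Suc by (simp add: mult_ac)
qed simp

lemma triple_coeff_diag: "triple_coeff p N N = p ^ triangle N"
  by (induction N) (simp_all add: triple_coeff_eq_0 power_add)

text \<open>The q-Pochhammer symbol (p; p)_n.\<close>

definition qfac :: "complex \<Rightarrow> nat \<Rightarrow> complex" where
  "qfac p n = (\<Prod>k<n. 1 - p ^ Suc k)"

lemma qfac_Suc: "qfac p (Suc n) = qfac p n * (1 - p ^ Suc n)"
  by (simp add: qfac_def)

lemma qfac_0 [simp]: "qfac p 0 = 1" by (simp add: qfac_def)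

text \<open>The coefficient is p^(n(n+1)/2) times the Gaussian binomial of 2N + 1 over N - n. The
  multiplied-out form avoids division, so the induction is polynomial algebra valid for every
  \<open>p\<close>.\<close>

lemma triple_coeff_closed:
  assumes "n \<le> N"
  shows "triple_coeff p N n * (qfac p (N - n) * qfac p (N + n + 1)) = p ^ triangle n * qfac p (2 * N + 1)"
  using assms
proof (induction N arbitrary: n)
  case 0 then show ?case by simp
next
  case (Suc N)
  define M where "M = qfac p (2 * N + 1)"
  have M: "qfac p (2 * Suc N + 1) = M * (1 - p ^ (2 * N + 2)) * (1 - p ^ (2 * N + 3))"
    by (simp add: M_def qfac_Suc numeral_3_eq_3)
  \<comment> \<open>The recursion looks at n - 1, n and n + 1. The induction hypothesis covers all
    three only in the last case; the others are the edges where an index folds back to 0 or a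
    coefficient vanishes because it exceeds N.\<close>
  consider "n = Suc N" | "n = 0" "N = 0" | k where "n = Suc k" "N = Suc k" | a where "n = 0" "N = Suc a"
    | k a where "n = Suc k" "N = k + a + 2"
  proof -
    have "n = Suc N \<or> n = 0 \<and> N = 0 \<or> (\<exists>k. n = Suc k \<and> N = Suc k) \<or> (\<exists>a. n = 0 \<and> N = Suc a)
       \<or> (\<exists>k a. n = Suc k \<and> N = k + a + 2)"
      using Suc.prems by presburger
    then show ?thesis using that by blast
  qed
  then show ?case
  proof cases
    case 1
    show ?thesis unfolding 1 triple_coeff_diag by (simp add: mult_2)
  next
    case 2
    then show ?thesis by (simp add: qfac_Suc algebra_simps power_numeral_reduce)
  next
    case (3 k)
    define e where "e = triple_coeff p N k"
    define x where "x = p ^ k"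
    define t where "t = p ^ triangle k"
    define B where "B = qfac p (2 * N)"
    have IH: "e * (qfac p (Suc 0) * qfac p (2 * N)) = t * M"
      using Suc.IH[of k] 3 unfolding M_def e_def t_def by (simp only: diff_Suc_Suc) (simp add: mult_2)
    have q: "qfac p (2 * N + 2) = M * (1 - x\<^sup>2 * p ^ 4)" "qfac p (Suc 0) = 1 - p" "M = B * (1 - x\<^sup>2 * p ^ 3)"
      unfolding B_def by (simp_all add: M_def 3 qfac_Suc x_def power_add power_mult numeral_eq_Suc mult_ac mult_2)
    have pw: "p ^ (2 * N + 2) = x\<^sup>2 * p ^ 4" "p ^ (2 * N + 3) = x\<^sup>2 * p ^ 5" "p ^ (N + 1) = x * p\<^sup>2" "p ^ triangle N = t * x * p"
      by (simp_all add: 3 x_def t_def power_add power_mult numeral_eq_Suc mult_ac)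
    have idx: "Suc N - n = Suc 0" "Suc N + n + 1 = 2 * N + 2" "n + 1 = Suc N" "n - 1 = k" "n = N" "triple_coeff p N (Suc N) = 0"
      using 3 by (auto simp: triple_coeff_eq_0)
    have "triple_coeff p (Suc N) n * (qfac p (Suc N - n) * qfac p (Suc N + n + 1))
       = ((1 + x\<^sup>2 * p ^ 4) * (t * x * p) + x * p\<^sup>2 * (0 + e)) * (qfac p (Suc 0) * qfac p (2 * N + 2))"
      unfolding triple_coeff.simps idx(1-4) unfolding idx(5,6) triple_coeff_diag pw e_def ..
    also have "\<dots> = (1 + x\<^sup>2 * p ^ 4) * (t * x * p) * ((1 - p) * M * (1 - x\<^sup>2 * p ^ 4))
        + x * p\<^sup>2 * (1 - x\<^sup>2 * p ^ 3) * (1 - x\<^sup>2 * p ^ 4) * (e * (qfac p (Suc 0) * B))"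
      unfolding q by algebra
    also have "\<dots> = t * x * p * (M * (1 - x\<^sup>2 * p ^ 4) * (1 - x\<^sup>2 * p ^ 5))"
      unfolding IH[folded B_def] by algebra
    finally show ?thesis unfolding M idx(5) pw .
  next
    case (4 a)
    define e0 where "e0 = triple_coeff p N 0"
    define e1 where "e1 = triple_coeff p N 1"
    define A where "A = qfac p a"
    define x where "x = p ^ a"
    have idx: "N - 0 = Suc a" "N + 0 + 1 = a + 2" "N - 1 = a" "N + 1 + 1 = a + 3"
       "Suc N - 0 = a + 2" "Suc N + 0 + 1 = a + 3" "0 + 1 = (1::nat)" "0 - 1 = (0::nat)" "0 \<le> N" "1 \<le> N"
      using 4 by auto
    have IH0: "e0 * (qfac p (Suc a) * qfac p (a + 2)) = M"
      using Suc.IH[OF idx(9)] unfolding idx(1,2) by (simp add: M_def e0_def)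
    have IH1: "e1 * (A * qfac p (a + 3)) = p * M"
      using Suc.IH[OF idx(10)] unfolding idx(3,4) by (simp add: M_def e1_def A_def)
    have q: "qfac p (Suc a) = A * (1 - x * p)" "qfac p (a + 2) = A * (1 - x * p) * (1 - x * p\<^sup>2)"
      "qfac p (a + 3) = A * (1 - x * p) * (1 - x * p\<^sup>2) * (1 - x * p ^ 3)"
      by (simp_all add: A_def x_def qfac_Suc numeral_eq_Suc mult_ac)
    have pw: "p ^ (2 * N + 2) = x\<^sup>2 * p ^ 4" "p ^ (2 * N + 3) = x\<^sup>2 * p ^ 5" "p ^ (N + 1) = x * p\<^sup>2" "p ^ triangle 0 = 1"
      by (simp_all add: 4 x_def power_add power_mult numeral_eq_Suc mult_ac)
    have "triple_coeff p (Suc N) 0 * (qfac p (Suc N - 0) * qfac p (Suc N + 0 + 1))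
       = ((1 + x\<^sup>2 * p ^ 4) * e0 + x * p\<^sup>2 * (e1 + e0)) * (qfac p (a + 2) * qfac p (a + 3))"
      unfolding triple_coeff.simps idx(5-8) pw e0_def e1_def ..
    also have "\<dots> = (1 + x\<^sup>2 * p ^ 4 + x * p\<^sup>2) * ((1 - x * p\<^sup>2) * (1 - x * p ^ 3)) * (e0 * (qfac p (Suc a) * qfac p (a + 2)))
        + x * p\<^sup>2 * ((1 - x * p) * (1 - x * p\<^sup>2)) * (e1 * (A * qfac p (a + 3)))"
      unfolding q by algebra
    also have "\<dots> = 1 * (M * (1 - x\<^sup>2 * p ^ 4) * (1 - x\<^sup>2 * p ^ 5))"
      unfolding IH0 IH1 by algebra
    finally show ?thesis unfolding M 4(1) pw .
  next
    case (5 k a)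
    define e0 where "e0 = triple_coeff p N k"
    define e1 where "e1 = triple_coeff p N (Suc k)"
    define e2 where "e2 = triple_coeff p N (Suc (Suc k))"
    define A where "A = qfac p a"
    define B where "B = qfac p (2 * k + a + 3)"
    define x where "x = p ^ k"
    define y where "y = p ^ a"
    define t where "t = p ^ triangle k"
    have qA: "qfac p (Suc a) = A * (1 - y * p)" "qfac p (a + 2) = A * (1 - y * p) * (1 - y * p\<^sup>2)"
      by (simp_all add: A_def y_def qfac_Suc power2_eq_square mult_ac)
    have qB: "qfac p (2 * k + a + 4) = B * (1 - x\<^sup>2 * y * p ^ 4)"
       "qfac p (2 * k + a + 5) = B * (1 - x\<^sup>2 * y * p ^ 4) * (1 - x\<^sup>2 * y * p ^ 5)"
      by (simp_all add: B_def x_def y_def qfac_Suc power_add power_mult numeral_eq_Suc mult_ac mult_2)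
    have idx: "N - k = a + 2" "N + k + 1 = 2 * k + a + 3" "N - Suc k = Suc a" "N + Suc k + 1 = 2 * k + a + 4"
      "N - Suc (Suc k) = a" "N + Suc (Suc k) + 1 = 2 * k + a + 5" "k \<le> N" "Suc k \<le> N" "Suc (Suc k) \<le> N"
      "Suc N - Suc k = a + 2" "Suc N + Suc k + 1 = 2 * k + a + 5" "Suc k + 1 = Suc (Suc k)" "Suc k - 1 = k"
      using 5 by auto
    have tri: "p ^ triangle (Suc k) = t * x * p" "p ^ triangle (Suc (Suc k)) = t * x\<^sup>2 * p ^ 3"
      by (simp_all add: t_def x_def power_add power2_eq_square numeral_3_eq_3)
    have IH0: "e0 * (qfac p (a + 2) * B) = t * M"
      using Suc.IH[OF idx(7)] unfolding idx M_def t_def B_def e0_def .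
    have IH1: "e1 * (qfac p (Suc a) * qfac p (2 * k + a + 4)) = t * x * p * M"
      using Suc.IH[OF idx(8)] unfolding idx tri M_def e1_def .
    have IH2: "e2 * (A * qfac p (2 * k + a + 5)) = t * x\<^sup>2 * p ^ 3 * M"
      using Suc.IH[OF idx(9)] unfolding idx tri M_def e2_def A_def .
    have pw: "p ^ (2 * N + 2) = x\<^sup>2 * y\<^sup>2 * p ^ 6" "p ^ (2 * N + 3) = x\<^sup>2 * y\<^sup>2 * p ^ 7" "p ^ (N + 1) = x * y * p ^ 3"
      by (simp_all add: 5 x_def y_def power_add power_mult numeral_eq_Suc mult_ac mult_2)
    have "triple_coeff p (Suc N) (Suc k) * (qfac p (Suc N - Suc k) * qfac p (Suc N + Suc k + 1))
       = ((1 + x\<^sup>2 * y\<^sup>2 * p ^ 6) * e1 + x * y * p ^ 3 * (e2 + e0)) * (qfac p (a + 2) * qfac p (2 * k + a + 5))"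
      unfolding triple_coeff.simps idx pw e0_def e1_def e2_def ..
    also have "\<dots> = (1 + x\<^sup>2 * y\<^sup>2 * p ^ 6) * ((1 - y * p\<^sup>2) * (1 - x\<^sup>2 * y * p ^ 5)) * (e1 * (qfac p (Suc a) * qfac p (2 * k + a + 4)))
        + x * y * p ^ 3 * ((1 - y * p) * (1 - y * p\<^sup>2)) * (e2 * (A * qfac p (2 * k + a + 5)))
        + x * y * p ^ 3 * ((1 - x\<^sup>2 * y * p ^ 4) * (1 - x\<^sup>2 * y * p ^ 5)) * (e0 * (qfac p (a + 2) * B))"
      unfolding qA qB by algebra
    also have "\<dots> = t * x * p * (M * (1 - x\<^sup>2 * y\<^sup>2 * p ^ 6) * (1 - x\<^sup>2 * y\<^sup>2 * p ^ 7))"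
      unfolding IH0 IH1 IH2 by algebra
    finally show ?thesis unfolding M 5(1) pw tri .
  qed
qed

lemma convergent_prod_power_factors:
  fixes p :: complex
  assumes "norm p < 1"
  shows "convergent_prod (\<lambda>m. 1 + c * p ^ Suc m + d * p ^ (2 * Suc m))"
proof -
  have "summable (\<lambda>m. norm p ^ m)" using assms by (intro summable_geometric) auto
  then have s: "summable (\<lambda>m. (norm c + norm d) * norm p ^ m)" by (rule summable_mult)
  have "norm (c * p ^ Suc m + d * p ^ (2 * Suc m)) \<le> (norm c + norm d) * norm p ^ m" for m
  proof -
    have "norm (c * p ^ Suc m + d * p ^ (2 * Suc m)) \<le> norm c * norm p ^ Suc m + norm d * norm p ^ (2 * Suc m)"
      using norm_triangle_ineq[of "c * p ^ Suc m" "d * p ^ (2 * Suc m)"] by (simp add: norm_mult norm_power)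
    also have "\<dots> \<le> norm c * norm p ^ m + norm d * norm p ^ m"
      using assms by (intro add_mono mult_left_mono power_decreasing) auto
    finally show ?thesis by (simp add: algebra_simps)
  qed
  then have "summable (\<lambda>m. norm ((1 + c * p ^ Suc m + d * p ^ (2 * Suc m)) - 1))"
    by (intro summable_comparison_test'[OF s, of 0]) (simp add: algebra_simps)
  then show ?thesis
    by (intro abs_convergent_prod_imp_convergent_prod) (simp only: abs_convergent_prod_conv_summable)
qed

lemma convergent_prod_lessThan_LIMSEQ:
  fixes f :: "nat \<Rightarrow> complex"
  assumes "convergent_prod f"
  shows "(\<lambda>n. \<Prod>i<n. f i) \<longlonglongrightarrow> prodinf f"
  using convergent_prod_LIMSEQ[OF assms] unfolding lessThan_Suc_atMost[symmetric] by (rule LIMSEQ_imp_Suc)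

lemma power_Suc_neq_1: "norm p < 1 \<Longrightarrow> p ^ Suc k \<noteq> (1::complex)"
  by (metis norm_one norm_power power_Suc_less_one norm_ge_zero less_irrefl power_0_left zero_neq_one nat.distinct(1) order_le_less)

lemma qfac_tendsto:
  assumes "norm p < 1"
  obtains L where "qfac p \<longlonglongrightarrow> L" "L \<noteq> 0" "\<And>n. qfac p n \<noteq> 0"
proof
  have c: "convergent_prod (\<lambda>k. 1 - p ^ Suc k)"
    using convergent_prod_power_factors[OF assms, of "-1" 0] by simp
  have nz: "1 - p ^ Suc k \<noteq> 0" for k using power_Suc_neq_1[OF assms, of k] by auto
  show "qfac p \<longlonglongrightarrow> prodinf (\<lambda>k. 1 - p ^ Suc k)"
    using convergent_prod_lessThan_LIMSEQ[OF c] by (simp add: qfac_def[abs_def])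
  show "prodinf (\<lambda>k. 1 - p ^ Suc k) \<noteq> 0" by (rule prodinf_nonzero[OF c nz])
  show "qfac p n \<noteq> 0" for n using nz by (simp add: qfac_def)
qed

lemma nome_odd_square:
  "nome \<tau> ((of_nat n + 1/2)\<^sup>2) = nome \<tau> (1/4) * (nome \<tau> 2) ^ triangle n"
proof -
  have "2 * of_nat (triangle n) = (of_nat n * (of_nat n + 1) :: complex)"
  proof -
    have "2 * triangle n = n * (n + 1)" by (simp add: triangle_def)
    then show ?thesis by (metis of_nat_1 of_nat_add of_nat_mult of_nat_numeral)
  qed
  then have "(of_nat n + 1/2)\<^sup>2 = (1/4 + of_nat (triangle n) * 2 :: complex)"
    by (simp add: power2_eq_square algebra_simps)
  then show ?thesis unfolding nome_def exp_of_nat_mult[symmetric] mult_exp_exp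
    by (intro arg_cong[where f = exp]) (simp add: algebra_simps)
qed

text \<open>By Tannery's theorem the expansions of cos z times the partial products converge
  termwise to a nonzero multiple of theta2. If that limit is zero, the infinite product vanishes,
  and a convergent product vanishes only through one of its factors.\<close>

lemma theta2_zero_imp:
  assumes "Im \<tau> > 0" "theta2 \<tau> z = 0" "cos z \<noteq> 0"
  obtains m where "1 + 2 * (nome \<tau> 2) ^ Suc m * cos (2 * z) + (nome \<tau> 2) ^ (2 * Suc m) = 0"
proof -
  define p where "p = nome \<tau> 2"
  define f where "f = (\<lambda>m. 1 + 2 * p ^ Suc m * cos (2 * z) + p ^ (2 * Suc m))"
  define C where "C = (\<lambda>n. cos ((2 * of_nat n + 1) * z))"
  have p: "norm p < 1" using assms(1) by (simp add: p_def nome_def)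
  obtain L where L: "qfac p \<longlonglongrightarrow> L" "L \<noteq> 0" "\<And>n. qfac p n \<noteq> 0"
    using qfac_tendsto[OF p] by blast
  obtain K1 where K1: "\<And>n. norm (qfac p n) \<le> K1"
    using convergent_imp_Bseq[of "qfac p"] L(1) by (auto simp: convergent_def Bseq_def)
  obtain K2 where K2: "\<And>n. norm (inverse (qfac p n)) \<le> K2"
    using convergent_imp_Bseq[of "\<lambda>n. inverse (qfac p n)"] tendsto_inverse[OF L(1,2)] by (auto simp: convergent_def Bseq_def)
  have K: "K1 \<ge> 0" "K2 \<ge> 0" using order.trans[OF norm_ge_zero K1] order.trans[OF norm_ge_zero K2] by auto
  have closed: "triple_coeff p N n = p ^ triangle n * qfac p (2 * N + 1) * inverse (qfac p (N - n)) * inverse (qfac p (N + n + 1))" 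
    if "n \<le> N" for n N
    using triple_coeff_closed[OF that, of p] L(3) by (simp add: field_simps)
  \<comment> \<open>Bounds on \<open>qfac\<close> and on its inverse, uniform in the index, make the
    majorant in Tannery's theorem independent of N.\<close>
  have bd: "norm (triple_coeff p N n * C n) \<le> K1 * K2 * K2 * norm (p ^ triangle n * C n)" for N n
  proof (cases "n \<le> N")
    case True
    have "norm (triple_coeff p N n * C n) = norm (qfac p (2 * N + 1)) * norm (inverse (qfac p (N - n))) * norm (inverse (qfac p (N + n + 1))) * norm (p ^ triangle n * C n)"
      unfolding closed[OF True] by (simp add: norm_mult)
    also have "\<dots> \<le> K1 * K2 * K2 * norm (p ^ triangle n * C n)"
      using K by (intro mult_right_mono mult_mono K1 K2) auto
    finally show ?thesis .
  next
    case False
    then show ?thesis using K by (simp add: triple_coeff_eq_0)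
  qed
  \<comment> \<open>Of the three factors that tend to \<open>L\<close>, one stands in the numerator
    and two in the denominator, which leaves 1/L.\<close>
  have lim: "(\<lambda>N. triple_coeff p N n * C n) \<longlonglongrightarrow> p ^ triangle n * C n / L" for n
  proof -
    have "(\<lambda>N. qfac p (2 * N + 1)) \<longlonglongrightarrow> L"
      using LIMSEQ_subseq_LIMSEQ[OF L(1), of "\<lambda>N. 2 * N + 1"] by (simp add: strict_mono_def o_def)
    moreover have "(\<lambda>N. qfac p (N - n)) \<longlonglongrightarrow> L"
      by (rule LIMSEQ_offset[of _ n]) (simp add: L(1))
    moreover have "(\<lambda>N. qfac p (N + n + 1)) \<longlonglongrightarrow> L"
      using LIMSEQ_ignore_initial_segment[OF L(1), of "n + 1"] by (simp add: add.assoc)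
    ultimately have "(\<lambda>N. p ^ triangle n * qfac p (2 * N + 1) * inverse (qfac p (N - n)) * inverse (qfac p (N + n + 1)) * C n)
       \<longlonglongrightarrow> p ^ triangle n * L * inverse L * inverse L * C n"
      using L(2) by (intro tendsto_intros)
    moreover have "p ^ triangle n * L * inverse L * inverse L * C n = p ^ triangle n * C n / L"
      using L(2) by (simp add: field_simps)
    moreover have "eventually (\<lambda>N. p ^ triangle n * qfac p (2 * N + 1) * inverse (qfac p (N - n)) * inverse (qfac p (N + n + 1)) * C n = triple_coeff p N n * C n) sequentially"
      using eventually_ge_at_top[of n] by eventually_elim (simp add: closed)
    ultimately show ?thesis using Lim_transform_eventually by fastforce
  qed
  have nome0: "nome \<tau> (1/4) \<noteq> 0" by (simp add: nome_def)
  have trm: "nome \<tau> ((of_nat n + 1/2)\<^sup>2) * cos ((2 * of_nat n + 1) * z) = nome \<tau> (1/4) * (p ^ triangle n * C n)" for n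
    by (simp add: nome_odd_square p_def C_def)
  have sm0: "summable (\<lambda>n. norm (nome \<tau> (1/4)) * norm (p ^ triangle n * C n))"
  proof (rule summable_comparison_test')
    show "summable (\<lambda>n. exp ((2 * \<bar>Im z\<bar> + 1)\<^sup>2 / (4 * (pi * Im \<tau>))) * exp (- real n))"
      by (intro summable_mult summable_exp_minus)
    show "norm (norm (nome \<tau> (1/4)) * norm (p ^ triangle n * C n)) \<le> exp ((2 * \<bar>Im z\<bar> + 1)\<^sup>2 / (4 * (pi * Im \<tau>))) * exp (- real n)" for n
      using theta2_term_bound[OF assms(1) order.refl, of n z] unfolding trm by (simp add: norm_mult)
  qed
  then have sm: "summable (\<lambda>n. norm (p ^ triangle n * C n))"
    using nome0 by (subst (asm) summable_cmult_iff) auto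
  have "(\<lambda>N. \<Sum>n. triple_coeff p N n * C n) \<longlonglongrightarrow> (\<Sum>n. p ^ triangle n * C n / L)"
    using tannerys_theorem[of "\<lambda>n N. triple_coeff p N n * C n" "\<lambda>n. p ^ triangle n * C n / L" sequentially "\<lambda>n. K1 * K2 * K2 * norm (p ^ triangle n * C n)"]
      lim bd summable_mult[OF sm] by (auto simp: case_prod_unfold)
  moreover have "(\<Sum>n. triple_coeff p N n * C n) = cos z * (\<Prod>m<N. f m)" for N
    unfolding f_def finite_triple_product C_def
    by (rule suminf_finite) (auto simp: triple_coeff_eq_0)
  moreover have "(\<Sum>n. p ^ triangle n * C n / L) = 0"
  proof -
    have "theta2 \<tau> z = 2 * (nome \<tau> (1/4) * (\<Sum>n. p ^ triangle n * C n))"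
      unfolding theta2_def trm using suminf_mult[OF summable_norm_cancel[OF sm]] by simp
    then have "(\<Sum>n. p ^ triangle n * C n) = 0" using assms nome0 by simp
    then show ?thesis using suminf_divide[OF summable_norm_cancel[OF sm]] by simp
  qed
  ultimately have "(\<lambda>N. cos z * (\<Prod>m<N. f m)) \<longlonglongrightarrow> 0" by simp
  moreover have cp: "convergent_prod f"
    unfolding f_def using convergent_prod_power_factors[OF p, of "2 * cos (2 * z)" 1] by (simp add: mult_ac)
  then have "(\<lambda>N. cos z * (\<Prod>m<N. f m)) \<longlonglongrightarrow> cos z * prodinf f"
    by (intro tendsto_intros convergent_prod_lessThan_LIMSEQ)
  ultimately have "cos z * prodinf f = 0" using LIMSEQ_unique by blast
  then have "prodinf f = 0" using assms(3) by simp
  then obtain m where "f m = 0" using prodinf_nonzero[OF cp] by auto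
  then show ?thesis using that by (simp add: f_def p_def)
qed

text \<open>With x = q^(2m+2) and e e' = 1 for e, e' = exp (\<plusminus>2iz), the product factor
  splits as (x e + 1)(x e' + 1).\<close>

lemma theta2_zero_cases:
  assumes "Im \<tau> > 0" "theta2 \<tau> z = 0" "cos z \<noteq> 0"
  obtains m where "(nome \<tau> 2) ^ Suc m * exp (2 * \<i> * z) = - 1 \<or> (nome \<tau> 2) ^ Suc m * exp (- (2 * \<i> * z)) = - 1"
proof -
  obtain m where m: "1 + 2 * (nome \<tau> 2) ^ Suc m * cos (2 * z) + (nome \<tau> 2) ^ (2 * Suc m) = 0"
    using theta2_zero_imp[OF assms] by blast
  define x where "x = (nome \<tau> 2) ^ Suc m"
  define e where "e = exp (2 * \<i> * z)"
  define e' where "e' = exp (- (2 * \<i> * z))"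
  have ee: "e * e' = 1" by (simp add: e_def e'_def exp_minus)
  have "2 * cos (2 * z) = e + e'" by (simp add: cos_exp_eq e_def e'_def mult_ac)
  moreover have "(nome \<tau> 2) ^ (2 * Suc m) = x ^ 2" unfolding x_def power_mult[symmetric] by (simp add: mult_ac)
  ultimately have "1 + x * (e + e') + x ^ 2 = 0" using m unfolding x_def[symmetric] by (simp add: mult_ac)
  then have "(x * e + 1) * (x * e' + 1) = 0" using ee by algebra
  then have "x * e = - 1 \<or> x * e' = - 1" by (simp add: eq_neg_iff_add_eq_0)
  then show ?thesis using that by (simp add: x_def e_def e'_def)
qed

lemma norm_nome_power: "norm ((nome \<tau> 2) ^ n) = exp (- (2 * pi * Im \<tau> * real n))"
  by (simp add: norm_power nome_def exp_of_nat_mult[symmetric] mult_ac)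

text \<open>Comparing moduli in the factor equation puts every zero that is not a zero of cos on a
  line |Im z| = pi Im \<tau> (m + 1).\<close>

lemma theta2_nonzero:
  assumes "Im \<tau> > 0" "\<bar>Im z\<bar> < pi * Im \<tau>" "cos z \<noteq> 0"
  shows "theta2 \<tau> z \<noteq> 0"
proof
  assume "theta2 \<tau> z = 0"
  then obtain m where m: "(nome \<tau> 2) ^ Suc m * exp (2 * \<i> * z) = - 1 \<or> (nome \<tau> 2) ^ Suc m * exp (- (2 * \<i> * z)) = - 1"
    using theta2_zero_cases assms by metis
  then have "norm ((nome \<tau> 2) ^ Suc m * exp (2 * \<i> * z)) = 1 \<or> norm ((nome \<tau> 2) ^ Suc m * exp (- (2 * \<i> * z))) = 1"
    by auto
  then have "exp (- (2 * pi * Im \<tau> * real (Suc m)) - 2 * Im z) = 1 \<or> exp (- (2 * pi * Im \<tau> * real (Suc m)) + 2 * Im z) = 1"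
    unfolding norm_mult norm_nome_power by (simp add: mult_exp_exp)
  then have "- (2 * (pi * Im \<tau> * real (Suc m))) - 2 * Im z = 0 \<or> - (2 * (pi * Im \<tau> * real (Suc m))) + 2 * Im z = 0"
    by (simp only: exp_eq_one_iff mult.assoc)
  moreover have "pi * Im \<tau> * real (Suc m) > 0" using assms(1) by simp
  ultimately have "\<bar>Im z\<bar> = pi * Im \<tau> * real (Suc m)" by linarith
  moreover have "pi * Im \<tau> * real (Suc m) \<ge> pi * Im \<tau> * 1"
    using assms(1) by (intro mult_left_mono) auto
  ultimately show False using assms(2) by simp
qed

lemma cos_nonzero_if_Im: "Im z \<noteq> 0 \<Longrightarrow> cos z \<noteq> 0"
  by (auto simp: cos_eq_0 simp del: of_int_add)

lemma sin_nonzero_if_Im: "Im z \<noteq> 0 \<Longrightarrow> sin z \<noteq> 0"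
  by (auto simp: sin_eq_0)

lemma theta1_nonzero:
  assumes "Im \<tau> > 0" "\<bar>Im z\<bar> < pi * Im \<tau>" "sin z \<noteq> 0"
  shows "theta1 \<tau> z \<noteq> 0"
  unfolding theta1_eq_theta2
  by (rule theta2_nonzero) (use assms in \<open>simp_all add: cos_diff\<close>)

text \<open>The range of \<open>w\<close> exceeds the strip controlled by moduli. Since Re \<tau> =
  1/2, q^2 = -\<rho> with \<rho> > 0, and on the imaginary axis the factor equation reads
  (-\<rho>)^(m+1) exp (\<plusminus>2w) = 1. The sign forces m + 1 to be even, hence at least 2, and
  then w would be at least 2 pi Im \<tau>.\<close>

lemma theta1_imaginary_nonzero:
  assumes "Re \<tau> = 1/2" "0 < w" "w < 2 * pi * Im \<tau>"
  shows "theta1 \<tau> (\<i> * of_real w) \<noteq> 0"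
proof
  assume "theta1 \<tau> (\<i> * of_real w) = 0"
  define z where "z = \<i> * of_real w - of_real pi / 2"
  have t: "Im \<tau> > 0" using assms by (metis less_trans mult_less_cancel_left_pos mult_zero_right pi_gt_zero zero_less_mult_pos zero_less_numeral)
  have "theta2 \<tau> z = 0" using \<open>theta1 \<tau> _ = 0\<close> by (simp add: theta1_eq_theta2 z_def)
  moreover have "cos z \<noteq> 0" by (rule cos_nonzero_if_Im) (use assms in \<open>simp add: z_def\<close>)
  ultimately obtain m where m: "(nome \<tau> 2) ^ Suc m * exp (2 * \<i> * z) = - 1 \<or> (nome \<tau> 2) ^ Suc m * exp (- (2 * \<i> * z)) = - 1"
    using theta2_zero_cases t by metis
  define \<rho> where "\<rho> = exp (- (2 * pi * Im \<tau>))"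
  have n: "nome \<tau> 2 = of_real (- \<rho>)"
  proof -
    have "\<tau> = Complex (1/2) (Im \<tau>)" using assms by (simp add: complex_eq_iff)
    then have "\<i> * of_real pi * \<tau> * 2 = \<i> * of_real pi + of_real (- (2 * pi * Im \<tau>))"
      by (simp add: complex_eq_iff)
    then have "nome \<tau> 2 = - exp (of_real (- (2 * pi * Im \<tau>)))"
      by (simp only: nome_def exp_add exp_pi_i') simp
    then show ?thesis unfolding exp_of_real by (simp add: \<rho>_def)
  qed
  have z2: "2 * \<i> * z = of_real (- 2 * w) - \<i> * of_real pi" "- (2 * \<i> * z) = of_real (2 * w) + \<i> * of_real pi"
    by (simp_all add: z_def algebra_simps)
  have "exp (2 * \<i> * z) = exp (of_real (- 2 * w)) / exp (\<i> * of_real pi)"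
    by (subst z2(1)) (rule exp_diff)
  also have "\<dots> = of_real (exp (- 2 * w)) / (- 1)" by (subst exp_of_real) (simp only: exp_pi_i')
  finally have e1: "exp (2 * \<i> * z) = of_real (- exp (- 2 * w))" by simp
  have "exp (- (2 * \<i> * z)) = exp (of_real (2 * w)) * exp (\<i> * of_real pi)"
    by (subst z2(2)) (rule exp_add)
  also have "\<dots> = of_real (exp (2 * w)) * (- 1)" by (subst exp_of_real) (simp only: exp_pi_i')
  finally have e2: "exp (- (2 * \<i> * z)) = of_real (- exp (2 * w))" by simp
  from m have "complex_of_real ((- \<rho>) ^ Suc m * (- exp (- 2 * w))) = of_real (- 1) \<or>
      complex_of_real ((- \<rho>) ^ Suc m * (- exp (2 * w))) = of_real (- 1)"
    unfolding n e1 e2 by (simp only: of_real_mult of_real_power of_real_minus of_real_1)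
  then have "(- \<rho>) ^ Suc m * (- exp (- 2 * w)) = - 1 \<or> (- \<rho>) ^ Suc m * (- exp (2 * w)) = - 1"
    by (simp only: of_real_eq_iff)
  then have *: "(- \<rho>) ^ Suc m * exp (- 2 * w) = 1 \<or> (- \<rho>) ^ Suc m * exp (2 * w) = 1" by auto
  have "even (Suc m)"
  proof (rule ccontr)
    assume "odd (Suc m)"
    then have "(- \<rho>) ^ Suc m < 0" by (simp add: \<rho>_def power_less_zero_eq)
    then have "(- \<rho>) ^ Suc m * exp (- 2 * w) < 0" "(- \<rho>) ^ Suc m * exp (2 * w) < 0"
      by (simp_all only: mult_neg_pos exp_gt_zero)
    with * show False by linarith
  qed
  then have "(- \<rho>) ^ Suc m = \<rho> ^ Suc m" by (rule power_minus_even)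
  also have "\<dots> = exp (- (2 * pi * Im \<tau> * real (Suc m)))"
    unfolding \<rho>_def exp_of_nat_mult[symmetric] by (rule arg_cong[where f = exp]) (simp add: mult_ac)
  finally have "(- \<rho>) ^ Suc m = exp (- (2 * pi * Im \<tau> * real (Suc m)))" .
  with * have "- (2 * (pi * Im \<tau> * real (Suc m))) + - 2 * w = 0 \<or> - (2 * (pi * Im \<tau> * real (Suc m))) + 2 * w = 0"
    by (simp only: mult_exp_exp exp_eq_one_iff mult.assoc)
  moreover have "real (Suc m) \<ge> 2" using \<open>even (Suc m)\<close> by (cases m) auto
  then have "pi * Im \<tau> * real (Suc m) \<ge> pi * Im \<tau> * 2"
    using t by (intro mult_left_mono) auto
  ultimately show False using assms(2,3) by argo
qed

section \<open>Half-period shifts, the Wronskian relation and theta1'(0)\<close>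

lemma theta1_zero [simp]: "theta1 \<tau> 0 = 0" by (simp add: theta1_def)

lemma theta1_shift:
  assumes "Im \<tau> > 0"
  shows "theta1 \<tau> (z + of_real pi / 2) = theta2 \<tau> z"
    and "theta1 \<tau> (z - of_real pi / 2) = - theta2 \<tau> z"
    and "theta1 \<tau> (of_real pi / 2 - z) = theta2 \<tau> z"
proof -
  show 1: "theta1 \<tau> (z + of_real pi / 2) = theta2 \<tau> z" for z by (simp add: theta1_eq_theta2)
  show "theta1 \<tau> (of_real pi / 2 - z) = theta2 \<tau> z" using 1[of "- z"] by (simp add: algebra_simps)
  then show "theta1 \<tau> (z - of_real pi / 2) = - theta2 \<tau> z"
    using theta1_minus[OF assms, of "of_real pi / 2 - z"] by simp
qed

lemma deriv_theta1_shift: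
  assumes "Im \<tau> > 0"
  shows "deriv (theta1 \<tau>) (z + of_real pi / 2) = deriv (theta2 \<tau>) z"
    and "deriv (theta1 \<tau>) (z - of_real pi / 2) = - deriv (theta2 \<tau>) z"
    and "deriv (theta1 \<tau>) (- z) = deriv (theta1 \<tau>) z"
proof -
  have "((\<lambda>z. theta1 \<tau> (z + of_real pi / 2)) has_field_derivative deriv (theta1 \<tau>) (z + of_real pi / 2)) (at z)"
    by (rule derivative_eq_intros assms refl)+ simp
  then show "deriv (theta1 \<tau>) (z + of_real pi / 2) = deriv (theta2 \<tau>) z"
    unfolding theta1_shift[OF assms] by (simp add: DERIV_imp_deriv)
  have "((\<lambda>z. - theta1 \<tau> (z - of_real pi / 2)) has_field_derivative - deriv (theta1 \<tau>) (z - of_real pi / 2)) (at z)"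
    by (rule derivative_eq_intros assms refl)+ simp
  then show "deriv (theta1 \<tau>) (z - of_real pi / 2) = - deriv (theta2 \<tau>) z"
    unfolding theta1_shift[OF assms] by (simp add: DERIV_imp_deriv)
  have "((\<lambda>z. - theta1 \<tau> (- z)) has_field_derivative deriv (theta1 \<tau>) (- z)) (at z)"
    by (rule derivative_eq_intros assms refl)+ simp
  then show "deriv (theta1 \<tau>) (- z) = deriv (theta1 \<tau>) z"
    unfolding theta1_minus[OF assms] by (simp add: DERIV_imp_deriv)
qed

text \<open>The infinitesimal three-term relation, obtained by letting \<open>b\<close> tend to \<open>a\<close>.\<close>

lemma theta1_wronskian:
  assumes \<tau>: "Im \<tau> > 0"
  defines "P x y \<equiv> theta1 \<tau> (x + y) * theta1 \<tau> (x - y)"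
    and "P' x y \<equiv> deriv (theta1 \<tau>) (x + y) * theta1 \<tau> (x - y) + theta1 \<tau> (x + y) * deriv (theta1 \<tau>) (x - y)"
  shows "P a d * P' a c - P a c * P' a d = theta1 \<tau> (2 * a) * deriv (theta1 \<tau>) 0 * P c d"
proof -
  have PD: "((\<lambda>x. P x y) has_field_derivative P' x y) (at x)" for x y
    unfolding P_def P'_def by (rule derivative_eq_intros \<tau> refl)+ (simp add: algebra_simps)
  \<comment> \<open>At b = a the factor theta1 (a - b) vanishes, so only its derivative
    survives.\<close>
  have PD': "((\<lambda>b. P a b) has_field_derivative - (theta1 \<tau> (2 * a) * deriv (theta1 \<tau>) 0)) (at a)"
    unfolding P_def by (rule derivative_eq_intros \<tau> refl)+ simp
  have "((\<lambda>b. P a b * P c d - P a c * P b d + P a d * P b c) has_field_derivative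
      - (theta1 \<tau> (2 * a) * deriv (theta1 \<tau>) 0) * P c d - P a c * P' a d + P a d * P' a c) (at a)"
    by (rule derivative_eq_intros PD PD' refl)+ simp
  moreover have "P a b * P c d - P a c * P b d + P a d * P b c = 0" for b
    using theta1_three_term[OF \<tau>, of a b c d] theta1_minus[OF \<tau>, of "b - d"]
    unfolding P_def by (simp add: algebra_simps)
  ultimately have "((\<lambda>_. 0) has_field_derivative
      - (theta1 \<tau> (2 * a) * deriv (theta1 \<tau>) 0) * P c d - P a c * P' a d + P a d * P' a c) (at a)"
    by simp
  then have "- (theta1 \<tau> (2 * a) * deriv (theta1 \<tau>) 0) * P c d - P a c * P' a d + P a d * P' a c = 0"
    using DERIV_unique DERIV_const by blast
  then show ?thesis by (simp add: algebra_simps)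
qed

text \<open>If theta1'(0) were 0, the Wronskian relation with shifts pi/2 and 0 would make (theta1 /
  theta2)^2 constant on the strip above the real axis. Letting a tend to 0 gives the constant 0,
  because theta1 (0) = 0 and theta2 (0) \<noteq> 0; but theta1 has no zero in that strip.\<close>

lemma deriv_theta1_0_nonzero:
  assumes \<tau>: "Im \<tau> > 0"
  shows "deriv (theta1 \<tau>) 0 \<noteq> 0"
proof
  assume z: "deriv (theta1 \<tau>) 0 = 0"
  define S where "S = {z. 0 < Im z \<and> Im z < pi * Im \<tau>}"
  have "S = {z. Im z > 0} \<inter> {z. Im z < pi * Im \<tau>}" by (auto simp: S_def)
  then have S: "convex S" by (simp add: convex_Int convex_halfspace_Im_lt convex_halfspace_Im_gt)
  have nz: "theta2 \<tau> a \<noteq> 0" "theta1 \<tau> a \<noteq> 0" if "a \<in> S" for a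
  proof -
    have "Im a \<noteq> 0" "\<bar>Im a\<bar> < pi * Im \<tau>" using that by (auto simp: S_def)
    then show "theta2 \<tau> a \<noteq> 0" "theta1 \<tau> a \<noteq> 0"
      using theta2_nonzero[OF \<tau>] theta1_nonzero[OF \<tau>] cos_nonzero_if_Im sin_nonzero_if_Im by blast+
  qed
  have "\<exists>C. \<forall>a\<in>S. (theta1 \<tau> a / theta2 \<tau> a)\<^sup>2 = C"
  proof (rule has_field_derivative_zero_constant[OF S])
    fix a assume a: "a \<in> S"
    let ?D = "2 * (theta1 \<tau> a / theta2 \<tau> a) * ((deriv (theta1 \<tau>) a * theta2 \<tau> a - theta1 \<tau> a * deriv (theta2 \<tau>) a) / (theta2 \<tau> a * theta2 \<tau> a))"
    have "((\<lambda>a. (theta1 \<tau> a / theta2 \<tau> a)\<^sup>2) has_field_derivative ?D) (at a within S)"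
      using DERIV_power[OF DERIV_divide[OF theta_has_field_derivative[OF \<tau>] nz(1)[OF a]], where n = 2]
      by (simp add: mult_ac)
    moreover have "theta1 \<tau> a * theta2 \<tau> a * (deriv (theta1 \<tau>) a * theta2 \<tau> a - theta1 \<tau> a * deriv (theta2 \<tau>) a) = 0"
      using theta1_wronskian[OF \<tau>, of a "of_real pi / 2" 0]
      unfolding theta1_shift[OF \<tau>] deriv_theta1_shift[OF \<tau>] z add_0_right diff_0_right by algebra
    ultimately show "((\<lambda>a. (theta1 \<tau> a / theta2 \<tau> a)\<^sup>2) has_field_derivative 0) (at a within S)"
      using nz[OF a] by (simp only: mult_eq_0_iff) simp
  qed
  then obtain C where "\<And>a. a \<in> S \<Longrightarrow> (theta1 \<tau> a / theta2 \<tau> a)\<^sup>2 = C" by blast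
  then have C: "(theta1 \<tau> a)\<^sup>2 = C * (theta2 \<tau> a)\<^sup>2" if "a \<in> S" for a
    using nz[OF that] that by (metis nonzero_divide_eq_eq power_divide power_not_zero)
  define a where "a n = \<i> * of_real (pi * Im \<tau> / real (n + 2))" for n
  have aS: "a n \<in> S" for n using \<tau> by (auto simp: a_def S_def pos_divide_less_eq intro!: mult_strict_left_mono)
  have "(\<lambda>n. pi * Im \<tau> / real (n + 2)) \<longlonglongrightarrow> 0"
    by (rule LIMSEQ_ignore_initial_segment[OF lim_const_over_n])
  from tendsto_mult[OF tendsto_const[of \<i>] tendsto_of_real[OF this]] have lim: "a \<longlonglongrightarrow> 0"
    unfolding a_def by simp
  have cont: "isCont (theta1 \<tau>) 0" "isCont (theta2 \<tau>) 0"
    using theta_has_field_derivative[OF \<tau>] DERIV_isCont by blast+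
  have "(\<lambda>n. (theta1 \<tau> (a n))\<^sup>2) \<longlonglongrightarrow> (theta1 \<tau> 0)\<^sup>2" "(\<lambda>n. C * (theta2 \<tau> (a n))\<^sup>2) \<longlonglongrightarrow> C * (theta2 \<tau> 0)\<^sup>2"
    by (intro tendsto_intros isCont_tendsto_compose[OF cont(1) lim] isCont_tendsto_compose[OF cont(2) lim])+
  then have "(theta1 \<tau> 0)\<^sup>2 = C * (theta2 \<tau> 0)\<^sup>2"
    unfolding C[OF aS] by (rule LIMSEQ_unique)
  moreover have "theta2 \<tau> 0 \<noteq> 0" by (rule theta2_nonzero) (use \<tau> in auto)
  ultimately have "C = 0" by simp
  then show False using C[OF aS[of 0]] nz[OF aS[of 0]] by simp
qed

section \<open>The planar curves of the cylinder\<close>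

locale theta_cylinder =
  fixes \<tau> :: complex and \<omega> :: real
  assumes Re_tau: "Re \<tau> = 1/2" and Im_tau: "0 < Im \<tau>"
    and omega: "0 < \<omega>" "\<omega> < pi / 4" and omega_crit: "deriv (theta2 \<tau>) \<omega> = 0"
begin

abbreviation "\<theta>1 \<equiv> theta1 \<tau>"
abbreviation "\<theta>2 \<equiv> theta2 \<tau>"

lemmas [simp] = theta1_minus[OF Im_tau]
lemmas shift = theta1_shift[OF Im_tau]

definition strip :: "complex set" where
  "strip = {z. 0 < Im z \<and> Im z < 2 * pi * Im \<tau>}"

text \<open>\<open>Gam\<close> is $\gamma$ as a function of $z = u + i\mathrm w$ and \<open>G\<close> will be its derivative, so that
  $e^h = |G|$.\<close>

definition Gam :: "complex \<Rightarrow> complex" where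
  "Gam z = - \<i> * R \<tau> \<omega> * \<theta>1 ((z - 3 * of_real \<omega>) / 2) / \<theta>1 ((z + of_real \<omega>) / 2)"

definition G :: "complex \<Rightarrow> complex" where
  "G z = - \<i> * (\<theta>2 ((z - of_real \<omega>) / 2))\<^sup>2 / (\<theta>1 ((z + of_real \<omega>) / 2))\<^sup>2"

lemma gamma_eq_Gam: "gamma \<tau> \<omega> u x = Gam (of_real u + \<i> * of_real x)"
  by (simp add: gamma_def Gam_def)

lemma open_strip: "open strip"
proof -
  have "strip = {z. Im z > 0} \<inter> {z. Im z < 2 * pi * Im \<tau>}" by (auto simp: strip_def)
  then show ?thesis by (simp add: open_Int open_halfspace_Im_lt open_halfspace_Im_gt)
qed

lemma strip_mem [simp]: "of_real u + \<i> * of_real x \<in> strip \<longleftrightarrow> 0 < x \<and> x < 2 * pi * Im \<tau>"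
  by (simp add: strip_def)

lemma theta1_2omega_nonzero: "\<theta>1 (2 * of_real \<omega>) \<noteq> 0"
proof (rule theta1_nonzero[OF Im_tau])
  have "sin (2 * \<omega>) > 0" using omega by (intro sin_gt_zero) auto
  then show "sin (2 * complex_of_real \<omega>) \<noteq> 0" by (metis less_irrefl of_real_eq_0_iff of_real_mult of_real_numeral sin_of_real)
qed (use Im_tau in simp)

lemma theta2_omega_nonzero: "\<theta>2 (of_real \<omega>) \<noteq> 0"
proof (rule theta2_nonzero[OF Im_tau])
  have "cos \<omega> > 0" using omega by (intro cos_gt_zero) auto
  then show "cos (complex_of_real \<omega>) \<noteq> 0" by (metis less_irrefl of_real_eq_0_iff cos_of_real)
qed (use Im_tau in simp)

lemmas deriv_nonzero = deriv_theta1_0_nonzero[OF Im_tau]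

lemma theta1_strip: "z \<in> strip \<Longrightarrow> \<theta>1 ((z + of_real \<omega>) / 2) \<noteq> 0"
  and theta2_strip: "z \<in> strip \<Longrightarrow> \<theta>2 ((z - of_real \<omega>) / 2) \<noteq> 0"
  by (rule theta1_nonzero[OF Im_tau] theta2_nonzero[OF Im_tau];
      simp add: strip_def sin_nonzero_if_Im cos_nonzero_if_Im)+

lemma G_nonzero: "z \<in> strip \<Longrightarrow> G z \<noteq> 0"
  using theta1_strip theta2_strip by (simp add: G_def)

text \<open>The left-hand side is the numerator of $\gamma_u$; it has a double zero at $\pi/2$ because
  $\vartheta_2'(\omega) = 0$.\<close>

lemma numerator_square:
  "deriv \<theta>1 (y - of_real \<omega>) * \<theta>1 (y + of_real \<omega>) - \<theta>1 (y - of_real \<omega>) * deriv \<theta>1 (y + of_real \<omega>)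
   = deriv \<theta>1 0 * \<theta>1 (2 * of_real \<omega>) / (\<theta>2 (of_real \<omega>))\<^sup>2 * (\<theta>2 y)\<^sup>2"
proof -
  have e: "\<theta>1 (of_real \<omega> - y) = - \<theta>1 (y - of_real \<omega>)" "deriv \<theta>1 (of_real \<omega> - y) = deriv \<theta>1 (y - of_real \<omega>)"
    using theta1_minus[OF Im_tau, of "y - of_real \<omega>"] deriv_theta1_shift(3)[OF Im_tau, of "y - of_real \<omega>"] by auto
  have "- (\<theta>2 (of_real \<omega>))\<^sup>2 * (deriv \<theta>1 (of_real \<omega> + y) * \<theta>1 (of_real \<omega> - y) + \<theta>1 (of_real \<omega> + y) * deriv \<theta>1 (of_real \<omega> - y))
     = - \<theta>1 (2 * of_real \<omega>) * deriv \<theta>1 0 * (\<theta>2 y)\<^sup>2"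
    using theta1_wronskian[OF Im_tau, of "of_real \<omega>" "of_real pi / 2" y]
    unfolding shift deriv_theta1_shift[OF Im_tau] omega_crit by algebra
  then show ?thesis
    unfolding e using theta2_omega_nonzero by (simp add: field_simps add.commute)
qed

lemma R_nonzero: "R \<tau> \<omega> \<noteq> 0"
  using theta1_2omega_nonzero theta2_omega_nonzero deriv_nonzero by (simp add: R_def)

lemma Gam_has_derivative:
  assumes "\<theta>1 ((z + of_real \<omega>) / 2) \<noteq> 0"
  shows "(Gam has_field_derivative G z) (at z)"
proof -
  define y where "y = (z - of_real \<omega>) / 2"
  have y: "(z - 3 * of_real \<omega>) / 2 = y - of_real \<omega>" "(z + of_real \<omega>) / 2 = y + of_real \<omega>"
    by (simp_all add: y_def field_simps)
  have d: "((\<lambda>z. \<theta>1 ((z - 3 * of_real \<omega>) / 2)) has_field_derivative deriv \<theta>1 (y - of_real \<omega>) * (1/2)) (at z)"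
    "((\<lambda>z. \<theta>1 ((z + of_real \<omega>) / 2)) has_field_derivative deriv \<theta>1 (y + of_real \<omega>) * (1/2)) (at z)"
    unfolding y[symmetric] by (rule derivative_eq_intros Im_tau refl | simp)+
  have "((\<lambda>z. - \<i> * R \<tau> \<omega> * (\<theta>1 ((z - 3 * of_real \<omega>) / 2) / \<theta>1 ((z + of_real \<omega>) / 2))) has_field_derivative
     - \<i> * R \<tau> \<omega> * ((deriv \<theta>1 (y - of_real \<omega>) * (1/2) * \<theta>1 (y + of_real \<omega>) - \<theta>1 (y - of_real \<omega>) * (deriv \<theta>1 (y + of_real \<omega>) * (1/2)))
       / (\<theta>1 (y + of_real \<omega>) * \<theta>1 (y + of_real \<omega>)))) (at z)"
    using DERIV_cmult[OF DERIV_divide[OF d assms]] unfolding y .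
  moreover have "deriv \<theta>1 (y - of_real \<omega>) * (1/2) * \<theta>1 (y + of_real \<omega>) - \<theta>1 (y - of_real \<omega>) * (deriv \<theta>1 (y + of_real \<omega>) * (1/2))
     = deriv \<theta>1 0 * \<theta>1 (2 * of_real \<omega>) / (\<theta>2 (of_real \<omega>))\<^sup>2 * (\<theta>2 y)\<^sup>2 / 2"
    unfolding numerator_square[symmetric] by (simp add: field_simps)
  \<comment> \<open>The normalisation of \<open>R\<close> is the one that cancels every constant
    here, so that G has no constant beyond -i.\<close>
  moreover have "R \<tau> \<omega> * (deriv \<theta>1 0 * \<theta>1 (2 * of_real \<omega>) / (\<theta>2 (of_real \<omega>))\<^sup>2 * (\<theta>2 y)\<^sup>2 / 2) = (\<theta>2 y)\<^sup>2"
    using theta1_2omega_nonzero theta2_omega_nonzero deriv_nonzero by (simp add: R_def field_simps)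
  ultimately show ?thesis
    unfolding Gam_def[abs_def] G_def y y_def[symmetric] by (simp add: power2_eq_square mult.assoc)
qed

lemma G_holomorphic: "G holomorphic_on strip"
proof -
  have "(\<lambda>z. \<theta>2 ((z - of_real \<omega>) / 2)) holomorphic_on UNIV" "(\<lambda>z. \<theta>1 ((z + of_real \<omega>) / 2)) holomorphic_on UNIV"
    using holomorphic_on_compose[OF _ theta2_holomorphic[OF Im_tau, of "(\<lambda>z. (z - of_real \<omega>) / 2) ` UNIV"], unfolded o_def]
      holomorphic_on_compose[OF _ theta1_holomorphic[OF Im_tau, of "(\<lambda>z. (z + of_real \<omega>) / 2) ` UNIV"], unfolded o_def]
    by (simp_all add: holomorphic_intros)
  then have h: "(\<lambda>z. \<theta>2 ((z - of_real \<omega>) / 2)) holomorphic_on strip" "(\<lambda>z. \<theta>1 ((z + of_real \<omega>) / 2)) holomorphic_on strip"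
    by (auto intro: holomorphic_on_subset)
  show ?thesis unfolding G_def[abs_def]
    by (intro holomorphic_intros h) (use theta1_strip in auto)
qed

abbreviation (input) "\<kappa> \<equiv> exp (- (\<i> * of_real (pi / 4)))"

lemmas cnj_rules = cnj_theta1[OF Im_tau Re_tau] cnj_theta2[OF Im_tau Re_tau] cnj_deriv_theta[OF Im_tau Re_tau]

lemma real_iff_cnj: "z \<in> \<real> \<longleftrightarrow> cnj z = z" by (simp add: Reals_cnj_iff)

text \<open>Conjugation multiplies theta1, theta2 and the derivative of theta1 at real points by one
  common phase, and each expression is homogeneous of degree 0 in them. In \<open>U2\<close>
  conjugation exchanges the theta3 and theta4 summands.\<close>

lemma R_real: "R \<tau> \<omega> \<in> \<real>" and U'_real: "U' \<tau> \<omega> \<in> \<real>" and U1'_real: "U1' \<tau> \<omega> \<in> \<real>"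
  and U2_real: "U2 \<tau> \<omega> \<in> \<real>"
proof -
  have k: "exp (- (\<i> * of_real (pi / 4))) \<noteq> 0" by simp
  have k2: "(exp (- (\<i> * of_real (pi / 4))) * a)\<^sup>2 / (exp (- (\<i> * of_real (pi / 4))) * b)\<^sup>2 = a\<^sup>2 / b\<^sup>2" for a b :: complex
    using k by (simp add: power_mult_distrib)
  show "R \<tau> \<omega> \<in> \<real>" "U' \<tau> \<omega> \<in> \<real>" "U1' \<tau> \<omega> \<in> \<real>"
    unfolding real_iff_cnj R_def U'_def U1'_def
    using k by (simp_all add: cnj_rules field_simps power2_eq_square)
  have "cnj ((deriv \<theta>1 0)\<^sup>2 / (\<theta>2 (of_real \<omega>))\<^sup>2) = (deriv \<theta>1 0)\<^sup>2 / (\<theta>2 (of_real \<omega>))\<^sup>2"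
    "cnj ((\<theta>1 (of_real \<omega>))\<^sup>2 / (\<theta>2 0)\<^sup>2) = (\<theta>1 (of_real \<omega>))\<^sup>2 / (\<theta>2 0)\<^sup>2"
    unfolding complex_cnj_divide complex_cnj_power cnj_rules complex_cnj_complex_of_real complex_cnj_zero by (rule k2)+
  moreover have c34: "cnj (theta3 \<tau> (of_real x)) = theta4 \<tau> (of_real x)" "cnj (theta4 \<tau> (of_real x)) = theta3 \<tau> (of_real x)" for x
    using cnj_theta3_of_real[OF Im_tau Re_tau, of x] by (simp, metis complex_cnj_cnj)
  have "cnj ((theta4 \<tau> (of_real \<omega>))\<^sup>2 / (theta3 \<tau> 0)\<^sup>2 + (theta3 \<tau> (of_real \<omega>))\<^sup>2 / (theta4 \<tau> 0)\<^sup>2)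
     = (theta4 \<tau> (of_real \<omega>))\<^sup>2 / (theta3 \<tau> 0)\<^sup>2 + (theta3 \<tau> (of_real \<omega>))\<^sup>2 / (theta4 \<tau> 0)\<^sup>2"
    using c34[of \<omega>] c34[of 0] by simp
  ultimately show "U2 \<tau> \<omega> \<in> \<real>"
    unfolding real_iff_cnj U2_def by (simp only: complex_cnj_mult complex_cnj_add add.assoc)
qed

section \<open>The metric factor |G| in terms of theta functions\<close>

lemma norm_theta_sq:
  "of_real ((norm (\<theta>1 z))\<^sup>2) = \<kappa> * \<theta>1 z * \<theta>1 (cnj z)" "of_real ((norm (\<theta>2 z))\<^sup>2) = \<kappa> * \<theta>2 z * \<theta>2 (cnj z)"
  by (simp_all add: complex_norm_square cnj_rules mult_ac del: of_real_power)

text \<open>\<open>G\<close> is -i times a square, so its modulus needs no square root: a squared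
  modulus is, up to the common phase, a product of theta values at z and cnj z. Theta identities
  thereby apply to e^h.\<close>

lemma norm_G:
  "of_real (norm (G z)) = \<theta>2 ((z - of_real \<omega>) / 2) * \<theta>2 ((cnj z - of_real \<omega>) / 2)
     / (\<theta>1 ((z + of_real \<omega>) / 2) * \<theta>1 ((cnj z + of_real \<omega>) / 2))"
proof -
  have "complex_of_real (norm (G z)) = of_real ((norm (\<theta>2 ((z - of_real \<omega>) / 2)))\<^sup>2) / of_real ((norm (\<theta>1 ((z + of_real \<omega>) / 2)))\<^sup>2)"
    by (simp add: G_def norm_divide norm_mult norm_power del: of_real_power)
  also have "\<dots> = (\<kappa> * \<theta>2 ((z - of_real \<omega>) / 2) * \<theta>2 (cnj ((z - of_real \<omega>) / 2)))
     / (\<kappa> * \<theta>1 ((z + of_real \<omega>) / 2) * \<theta>1 (cnj ((z + of_real \<omega>) / 2)))"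
    unfolding norm_theta_sq ..
  finally show ?thesis by (simp add: field_simps)
qed

lemma four_theta_relation:
  "\<theta>2 (of_real \<omega>) * (\<theta>1 (x + y - of_real \<omega>) * \<theta>1 (x - y + of_real \<omega>) * \<theta>2 (of_real \<omega> + 2 * y)
      - \<theta>1 (x - y - of_real \<omega>) * \<theta>1 (x + y + of_real \<omega>) * \<theta>2 (of_real \<omega> - 2 * y))
   = \<theta>1 (2 * of_real \<omega>) * \<theta>1 (2 * y) * \<theta>2 (x + y) * \<theta>2 (x - y)"
proof -
  define w where "w = complex_of_real \<omega>"
  define p where "p = complex_of_real pi / 2"
  \<comment> \<open>The solution of the linear system listed in \<open>1\<close>. The product
    belonging to a \<plusminus> b, c \<plusminus> d is then the right-hand side, and the other two
    products form the left-hand side.\<close>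
  define a b c d where "a = w + (x - y) / 2 + p / 2" and "b = w - (x - y) / 2 - p / 2"
    and "c = (p - x + y) / 2" and "d = (3 * y + x - p) / 2"
  have 1: "a + b = 2 * w" "a - b = (x - y) + p" "c + d = 2 * y" "c - d = p - (x + y)"
    "a + c = w + p" "a - c = x - y + w" "d + b = (w + 2 * y) - p" "d - b = x + y - w"
    "a + d = x + y + w" "a - d = (w - 2 * y) + p" "b + c = - (x - y - w)" "b - c = w - p"
    unfolding a_def b_def c_def d_def by (simp_all add: field_simps)
  show ?thesis
    using theta1_three_term[OF Im_tau, of a b c d]
    unfolding 1 unfolding p_def shift w_def theta1_minus[OF Im_tau] by (simp add: algebra_simps)
qed

lemma norm_G_eq_W1:
  assumes "0 < x" "x < 2 * pi * Im \<tau>"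
  shows "norm (G (of_real u + \<i> * of_real x)) = 2 * Re (Gam (of_real u + \<i> * of_real x) * cnj (W1 \<tau> \<omega> x))"
proof -
  \<comment> \<open>Conjugation fixes \<open>X\<close> and negates \<open>Y\<close>. Writing twice
    the real part as a sum with its conjugate therefore produces the left-hand side of
    \<open>four_theta_relation\<close> at x = X, y = Y.\<close>
  define X where "X = (complex_of_real u - of_real \<omega>) / 2"
  define Y where "Y = \<i> * of_real x / 2"
  define z where "z = complex_of_real u + \<i> * of_real x"
  define c where "c = deriv \<theta>1 0 / (2 * \<theta>2 (of_real \<omega>))"
  have z: "z \<in> strip" using assms by (simp add: z_def)
  have sub: "(z - of_real \<omega>) / 2 = X + Y" "(cnj z - of_real \<omega>) / 2 = X - Y"
    "(z + of_real \<omega>) / 2 = X + Y + of_real \<omega>" "(cnj z + of_real \<omega>) / 2 = X - Y + of_real \<omega>"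
    "(z - 3 * of_real \<omega>) / 2 = X + Y - of_real \<omega>" "(cnj z - 3 * of_real \<omega>) / 2 = X - Y - of_real \<omega>"
    by (simp_all add: z_def X_def Y_def field_simps)
  have k: "\<kappa> \<noteq> 0" by simp
  have n1: "\<theta>1 (X + Y + of_real \<omega>) \<noteq> 0" using theta1_strip[OF z] unfolding sub .
  have n2: "\<theta>1 (X - Y + of_real \<omega>) \<noteq> 0"
    using n1 k cnj_rules(1)[of "X + Y + of_real \<omega>"] by (auto simp: X_def Y_def)
  have n3: "\<theta>1 (2 * Y) \<noteq> 0" using theta1_imaginary_nonzero[OF Re_tau assms] by (simp add: Y_def)
  have cR: "cnj (R \<tau> \<omega>) = R \<tau> \<omega>" using R_real by (simp add: Reals_cnj_iff)
  have cc: "cnj c = c" using k by (simp add: c_def cnj_rules field_simps)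
  have W: "W1 \<tau> \<omega> x = \<i> * c * (\<theta>2 (of_real \<omega> - 2 * Y) / \<theta>1 (2 * Y))"
    by (simp add: W1_def c_def Y_def)
  have cW: "cnj (W1 \<tau> \<omega> x) = \<i> * c * (\<theta>2 (of_real \<omega> + 2 * Y) / \<theta>1 (2 * Y))"
  proof -
    have "cnj (2 * Y) = - (2 * Y)" by (simp add: Y_def)
    then show ?thesis unfolding W using k by (simp add: cc cnj_rules field_simps)
  qed
  have Gz: "Gam z = - \<i> * R \<tau> \<omega> * \<theta>1 (X + Y - of_real \<omega>) / \<theta>1 (X + Y + of_real \<omega>)"
    unfolding Gam_def sub ..
  have cG: "cnj (Gam z) = \<i> * R \<tau> \<omega> * \<theta>1 (X - Y - of_real \<omega>) / \<theta>1 (X - Y + of_real \<omega>)"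
  proof -
    have cXY: "cnj (X + Y - of_real \<omega>) = X - Y - of_real \<omega>" "cnj (X + Y + of_real \<omega>) = X - Y + of_real \<omega>"
      by (simp_all add: X_def Y_def)
    show ?thesis
      unfolding Gz complex_cnj_divide complex_cnj_mult cR cnj_rules cXY complex_cnj_minus complex_cnj_i by simp
  qed
  have "complex_of_real (2 * Re (Gam z * cnj (W1 \<tau> \<omega> x))) = Gam z * cnj (W1 \<tau> \<omega> x) + cnj (Gam z) * W1 \<tau> \<omega> x"
    using complex_add_cnj[of "Gam z * cnj (W1 \<tau> \<omega> x)"] by simp
  also have "\<dots> = R \<tau> \<omega> * c / (\<theta>1 (2 * Y) * \<theta>1 (X + Y + of_real \<omega>) * \<theta>1 (X - Y + of_real \<omega>))
     * (\<theta>1 (X + Y - of_real \<omega>) * \<theta>1 (X - Y + of_real \<omega>) * \<theta>2 (of_real \<omega> + 2 * Y)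
        - \<theta>1 (X - Y - of_real \<omega>) * \<theta>1 (X + Y + of_real \<omega>) * \<theta>2 (of_real \<omega> - 2 * Y))"
  proof -
    have "- \<i> * r * a / b * (\<i> * c * (e / d)) + \<i> * r * f / g * (\<i> * c * (k / d)) = r * c / (d * b * g) * (a * g * e - f * b * k)"
      if "b \<noteq> 0" "d \<noteq> 0" "g \<noteq> 0" for a b d e f g k r :: complex
    proof -
      have "- \<i> * r * a / b * (\<i> * c * (e / d)) + \<i> * r * f / g * (\<i> * c * (k / d))
         = - (\<i> * \<i>) * (r * c) * (a * e / (b * d) - f * k / (g * d))"
        by (simp add: algebra_simps)
      also have "\<dots> = r * c * (a * e / (b * d) - f * k / (g * d))" by simp
      also have "\<dots> = r * c / (d * b * g) * (a * g * e - f * b * k)"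
        using that by (simp add: field_simps)
      finally show ?thesis .
    qed
    from this[OF n1 n3 n2] show ?thesis unfolding cW unfolding cG unfolding Gz W .
  qed
  also have Rc: "R \<tau> \<omega> * c = \<theta>2 (of_real \<omega>) / \<theta>1 (2 * of_real \<omega>)"
    using theta1_2omega_nonzero theta2_omega_nonzero deriv_nonzero by (simp add: R_def c_def field_simps power2_eq_square)
  also have "\<theta>2 (of_real \<omega>) / \<theta>1 (2 * of_real \<omega>) / (\<theta>1 (2 * Y) * \<theta>1 (X + Y + of_real \<omega>) * \<theta>1 (X - Y + of_real \<omega>))
     * (\<theta>1 (X + Y - of_real \<omega>) * \<theta>1 (X - Y + of_real \<omega>) * \<theta>2 (of_real \<omega> + 2 * Y)
        - \<theta>1 (X - Y - of_real \<omega>) * \<theta>1 (X + Y + of_real \<omega>) * \<theta>2 (of_real \<omega> - 2 * Y))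
    = \<theta>1 (2 * of_real \<omega>) * \<theta>1 (2 * Y) * \<theta>2 (X + Y) * \<theta>2 (X - Y) / (\<theta>1 (2 * of_real \<omega>) * (\<theta>1 (2 * Y) * \<theta>1 (X + Y + of_real \<omega>) * \<theta>1 (X - Y + of_real \<omega>)))"
    unfolding four_theta_relation[symmetric] by simp
  also have "\<dots> = of_real (norm (G z))"
    unfolding norm_G sub using n1 n2 n3 theta1_2omega_nonzero by (simp add: field_simps)
  finally show ?thesis unfolding z_def of_real_eq_iff by simp
qed

text \<open>At u = \<omega> numerator and denominator of \<gamma> are theta1 at Y - \<omega> and Y +
  \<omega>, which are conjugate up to a unit factor. So |\<gamma>| = |R| along this line, which is
  why that \<open>v\<close>-curve lies on a sphere about the origin.\<close>

lemma Gam_omega: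
  assumes "0 < x" "x < 2 * pi * Im \<tau>"
  shows "Gam (of_real \<omega> + \<i> * of_real x) * of_real (norm (G (of_real \<omega> + \<i> * of_real x))) = - R \<tau> \<omega> * G (of_real \<omega> + \<i> * of_real x)"
proof -
  define Y where "Y = \<i> * complex_of_real x / 2"
  define z where "z = complex_of_real \<omega> + \<i> * of_real x"
  have sub: "(z - of_real \<omega>) / 2 = Y" "(cnj z - of_real \<omega>) / 2 = - Y"
    "(z + of_real \<omega>) / 2 = Y + of_real \<omega>" "(cnj z + of_real \<omega>) / 2 = - (Y - of_real \<omega>)"
    "(z - 3 * of_real \<omega>) / 2 = Y - of_real \<omega>"
    by (simp_all add: z_def Y_def field_simps)
  have k: "\<kappa> \<noteq> 0" by simp
  have n1: "\<theta>1 (Y + of_real \<omega>) \<noteq> 0" using theta1_strip[of z] assms unfolding sub by (simp add: z_def)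
  have cY: "cnj (Y + of_real \<omega>) = - (Y - of_real \<omega>)" by (simp add: Y_def)
  have "cnj (\<theta>1 (Y + of_real \<omega>)) = - \<kappa> * \<theta>1 (Y - of_real \<omega>)"
    unfolding cnj_rules cY theta1_minus[OF Im_tau] by simp
  then have n2: "\<theta>1 (Y - of_real \<omega>) \<noteq> 0"
    using n1 by auto
  have "Gam z * of_real (norm (G z)) = - R \<tau> \<omega> * G z"
    unfolding norm_G unfolding Gam_def G_def sub theta1_minus[OF Im_tau] theta2_minus using n1 n2 by (simp add: field_simps power2_eq_square)
  then show ?thesis by (simp add: z_def)
qed

text \<open>Along u = \<omega>, e^(-h) is a quotient of two products \<open>P\<close>; the Wronskian
  relation evaluates the numerator of its derivative as theta1 (2Y) theta1'(0) P(\<omega>, pi/2),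
  which has no zero in the admissible range.\<close>

lemma inverse_norm_G_omega_derivative:
  assumes "0 < x" "x < 2 * pi * Im \<tau>"
  obtains D :: complex where "D \<noteq> 0" "((\<lambda>x. complex_of_real (inverse (norm (G (of_real \<omega> + \<i> * of_real x))))) has_vector_derivative D) (at x)"
proof -
  define P where "P x y = \<theta>1 (x + y) * \<theta>1 (x - y)" for x y
  define P' where "P' x y = deriv \<theta>1 (x + y) * \<theta>1 (x - y) + \<theta>1 (x + y) * deriv \<theta>1 (x - y)" for x y
  define Y where "Y = \<i> * complex_of_real x / 2"
  define c where "c = complex_of_real pi / 2"
  define w where "w = complex_of_real \<omega>"
  have inv: "complex_of_real (inverse (norm (G (of_real \<omega> + \<i> * of_real x)))) = P (\<i> / 2 * of_real x) w / P (\<i> / 2 * of_real x) c" for x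
  proof -
    define z where "z = complex_of_real \<omega> + \<i> * of_real x"
    define Y where "Y = \<i> / 2 * complex_of_real x"
    have sub: "(z - of_real \<omega>) / 2 = Y" "(cnj z - of_real \<omega>) / 2 = - Y"
      "(z + of_real \<omega>) / 2 = Y + of_real \<omega>" "(cnj z + of_real \<omega>) / 2 = - (Y - of_real \<omega>)"
      by (simp_all add: z_def Y_def field_simps)
    show ?thesis
      unfolding of_real_inverse z_def[symmetric] Y_def[symmetric] norm_G sub unfolding P_def c_def shift w_def
        theta1_minus[OF Im_tau] theta2_minus
      by (simp add: mult_ac)
  qed
  have Pc: "P a c = - (\<theta>2 a)\<^sup>2" for a unfolding P_def c_def shift by (simp add: power2_eq_square)
  have n: "P Y c \<noteq> 0"
    using theta2_strip[of "of_real \<omega> + \<i> * of_real x"] assms unfolding Pc by (simp add: Y_def)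
  have PD: "((\<lambda>x. P x y) has_field_derivative P' x y) (at x)" for x y
    unfolding P_def P'_def by (rule derivative_eq_intros Im_tau refl)+ (simp add: algebra_simps)
  define D where "D = (P' Y w * P Y c - P Y w * P' Y c) / (P Y c * P Y c)"
  have "((\<lambda>a. P a w / P a c) has_field_derivative D) (at (\<i> / 2 * of_real x))"
    using DERIV_divide[OF PD PD n] by (simp add: D_def Y_def)
  moreover have "((\<lambda>a. \<i> / 2 * a) has_field_derivative \<i> / 2) (at (of_real x))"
    using DERIV_cmult_Id by blast
  ultimately have "((\<lambda>a. P (\<i> / 2 * a) w / P (\<i> / 2 * a) c) has_field_derivative D * (\<i> / 2)) (at (of_real x))"
    by (rule DERIV_chain2[where f = "\<lambda>a. P a w / P a c" and g = "\<lambda>a. \<i> / 2 * a"])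
  then have deriv: "((\<lambda>a. P (\<i> / 2 * of_real a) w / P (\<i> / 2 * of_real a) c) has_vector_derivative D * (\<i> / 2)) (at x)"
    by (rule has_vector_derivative_real_field)
  have "P' Y w * P Y c - P Y w * P' Y c = \<theta>1 (2 * Y) * deriv \<theta>1 0 * P w c"
    using theta1_wronskian[OF Im_tau, of Y c w] unfolding P_def P'_def by (simp add: mult_ac)
  moreover have "\<theta>1 (2 * Y) \<noteq> 0" "P w c \<noteq> 0"
    using theta1_imaginary_nonzero[OF Re_tau assms] theta2_omega_nonzero by (simp_all add: Y_def Pc, simp add: w_def)
  ultimately have "D \<noteq> 0"
    using deriv_nonzero n unfolding D_def by simp
  then have "D * (\<i> / 2) \<noteq> 0" by simp
  from this deriv[folded inv] show ?thesis by (rule that)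
qed

end

section \<open>Quaternionic frames\<close>

definition qcnj :: "quat \<Rightarrow> quat" where "qcnj p = (cnj (fst p), - snd p)"

lemma qinv_unit: "norm p = 1 \<Longrightarrow> qinv p = qcnj p"
  by (simp add: qinv_def qcnj_def)

lemma qcnj_qmult: "qcnj (p \<otimes>\<^sub>q q) = qcnj q \<otimes>\<^sub>q qcnj p"
  by (simp add: qcnj_def qmult_def algebra_simps)

lemma qmult_qcnj_unit:
  assumes "norm p = 1"
  shows "qcnj p \<otimes>\<^sub>q p = (1, 0)" "p \<otimes>\<^sub>q qcnj p = (1, 0)"
proof -
  have "p \<noteq> 0" using assms by auto
  then show "qcnj p \<otimes>\<^sub>q p = (1, 0)" "p \<otimes>\<^sub>q qcnj p = (1, 0)"
    using qinv_left qinv_right by (simp_all add: assms flip: qinv_unit)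
qed

lemma qmult_one [simp]: "(1, 0) \<otimes>\<^sub>q p = p" "p \<otimes>\<^sub>q (1, 0) = p"
  by (simp_all add: qmult_def)

lemma qmult_linear_simps:
  "(a + b) \<otimes>\<^sub>q c = a \<otimes>\<^sub>q c + b \<otimes>\<^sub>q c" "a \<otimes>\<^sub>q (b + c) = a \<otimes>\<^sub>q b + a \<otimes>\<^sub>q c"
  "(a - b) \<otimes>\<^sub>q c = a \<otimes>\<^sub>q c - b \<otimes>\<^sub>q c" "a \<otimes>\<^sub>q (b - c) = a \<otimes>\<^sub>q b - a \<otimes>\<^sub>q c"
  "(t *\<^sub>R a) \<otimes>\<^sub>q b = t *\<^sub>R (a \<otimes>\<^sub>q b)" "a \<otimes>\<^sub>q (t *\<^sub>R b) = t *\<^sub>R (a \<otimes>\<^sub>q b)"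
  "(- a) \<otimes>\<^sub>q b = - (a \<otimes>\<^sub>q b)" "a \<otimes>\<^sub>q (- b) = - (a \<otimes>\<^sub>q b)"
  by (simp_all add: qmult_def algebra_simps scaleR_conv_of_real)

lemma bounded_bilinear_qmult: "bounded_bilinear (\<otimes>\<^sub>q)"
proof -
  have "bilinear (\<otimes>\<^sub>q)"
    unfolding bilinear_def by (intro allI conjI linearI; simp only: qmult_linear_simps)
  then show ?thesis by (simp add: bilinear_conv_bounded_bilinear)
qed

lemma linear_vec_of_quat: "linear vec_of_quat"
  by (rule linearI) (simp_all add: vec_of_quat_def vec_eq_iff forall_3)

lemmas vec_of_quat_linear_simps = linear_add[OF linear_vec_of_quat] linear_diff[OF linear_vec_of_quat]
  linear_scale[OF linear_vec_of_quat] linear_neg[OF linear_vec_of_quat]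

lemma linear_qcnj: "linear qcnj"
  by (rule linearI) (simp_all add: qcnj_def scaleR_conv_of_real)

lemma linear_quat_of_vec: "linear quat_of_vec"
  by (rule linearI) (simp_all add: quat_of_vec_def complex_eq_iff)

definition rotv :: "quat \<Rightarrow> quat \<Rightarrow> real^3" where
  "rotv p x = vec_of_quat (qcnj p \<otimes>\<^sub>q x \<otimes>\<^sub>q p)"

lemma linear_rotv: "linear (rotv p)"
  by (rule linearI) (simp_all add: rotv_def qmult_linear_simps vec_of_quat_linear_simps)

lemmas rotv_linear_simps = linear_add[OF linear_rotv] linear_diff[OF linear_rotv]
  linear_scale[OF linear_rotv] linear_neg[OF linear_rotv]

text \<open>The real part is half the reduced trace, hence cyclic.\<close>

lemma Re_fst_conjugate:
  assumes "norm p = 1"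
  shows "Re (fst (qcnj p \<otimes>\<^sub>q x \<otimes>\<^sub>q p)) = Re (fst x)"
proof -
  have "Re (fst (a \<otimes>\<^sub>q b)) = Re (fst (b \<otimes>\<^sub>q a))" for a b
    by (simp add: qmult_def algebra_simps)
  then have "Re (fst (qcnj p \<otimes>\<^sub>q x \<otimes>\<^sub>q p)) = Re (fst (p \<otimes>\<^sub>q (qcnj p \<otimes>\<^sub>q x)))" .
  then show ?thesis using assms by (simp add: qmult_qcnj_unit flip: qmult_assoc)
qed

lemma quat_of_vec_rotv:
  assumes "norm p = 1" "Re (fst x) = 0"
  shows "quat_of_vec (rotv p x) = qcnj p \<otimes>\<^sub>q x \<otimes>\<^sub>q p"
  unfolding rotv_def using assms by (intro quat_of_vec_of_quat) (simp add: Re_fst_conjugate)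

lemma conjugate_qmult:
  assumes "norm p = 1"
  shows "(qcnj p \<otimes>\<^sub>q x \<otimes>\<^sub>q p) \<otimes>\<^sub>q (qcnj p \<otimes>\<^sub>q y \<otimes>\<^sub>q p) = qcnj p \<otimes>\<^sub>q (x \<otimes>\<^sub>q y) \<otimes>\<^sub>q p"
proof -
  have "(qcnj p \<otimes>\<^sub>q x \<otimes>\<^sub>q p) \<otimes>\<^sub>q (qcnj p \<otimes>\<^sub>q y \<otimes>\<^sub>q p) = qcnj p \<otimes>\<^sub>q x \<otimes>\<^sub>q (p \<otimes>\<^sub>q qcnj p) \<otimes>\<^sub>q y \<otimes>\<^sub>q p"
    by (simp add: qmult_assoc)
  then show ?thesis using assms by (simp add: qmult_qcnj_unit qmult_assoc)
qed

lemma inner_vec_quat: "x \<bullet> y = - Re (fst (quat_of_vec x \<otimes>\<^sub>q quat_of_vec y))"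
  by (simp add: quat_of_vec_def qmult_def inner_vec_def sum_3)

lemma inner_rotv:
  assumes "norm p = 1" "Re (fst x) = 0" "Re (fst y) = 0"
  shows "rotv p x \<bullet> rotv p y = - Re (fst (x \<otimes>\<^sub>q y))"
  by (simp add: inner_vec_quat quat_of_vec_rotv assms conjugate_qmult Re_fst_conjugate)

lemma cross3_rotv:
  assumes "norm p = 1" "Re (fst x) = 0" "Re (fst y) = 0"
  shows "cross3 (rotv p x) (rotv p y) = rotv p (x \<otimes>\<^sub>q y)"
  by (simp add: cross3_quat quat_of_vec_rotv assms conjugate_qmult) (simp add: rotv_def)

text \<open>Moving frame: \<open>\<Phi>' = c k \<Phi>\<close> turns conjugation by \<open>\<Phi>\<close> into the commutator with \<open>c k\<close>.\<close>

lemma rotv_has_vector_derivative: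
  assumes "(\<Phi> has_vector_derivative (0, \<i> * c) \<otimes>\<^sub>q \<Phi> v) (at v)"
  shows "((\<lambda>v. rotv (\<Phi> v) x) has_vector_derivative rotv (\<Phi> v) (x \<otimes>\<^sub>q (0, \<i> * c) - (0, \<i> * c) \<otimes>\<^sub>q x)) (at v)"
proof -
  let ?k = "(0, \<i> * c)"
  have q: "((\<lambda>v. qcnj (\<Phi> v)) has_vector_derivative qcnj (?k \<otimes>\<^sub>q \<Phi> v)) (at v)"
    using bounded_linear.has_vector_derivative[OF linear_qcnj[unfolded linear_conv_bounded_linear] assms]
    by simp
  have "qcnj (?k \<otimes>\<^sub>q \<Phi> v) = - (qcnj (\<Phi> v) \<otimes>\<^sub>q ?k)"
    unfolding qcnj_qmult by (simp add: qcnj_def qmult_def)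
  note q' = q[unfolded this]
  have "((\<lambda>v. qcnj (\<Phi> v) \<otimes>\<^sub>q x) has_vector_derivative - (qcnj (\<Phi> v) \<otimes>\<^sub>q ?k) \<otimes>\<^sub>q x) (at v)"
    using bounded_bilinear.has_vector_derivative[OF bounded_bilinear_qmult q' has_vector_derivative_const[of x]]
    by (simp add: bounded_bilinear.zero_right[OF bounded_bilinear_qmult])
  from bounded_bilinear.has_vector_derivative[OF bounded_bilinear_qmult this assms]
  have "((\<lambda>v. qcnj (\<Phi> v) \<otimes>\<^sub>q x \<otimes>\<^sub>q \<Phi> v) has_vector_derivative
      qcnj (\<Phi> v) \<otimes>\<^sub>q (x \<otimes>\<^sub>q ?k - ?k \<otimes>\<^sub>q x) \<otimes>\<^sub>q \<Phi> v) (at v)"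
    by (simp add: qmult_linear_simps qmult_assoc)
  from bounded_linear.has_vector_derivative[OF linear_vec_of_quat[unfolded linear_conv_bounded_linear] this]
  show ?thesis by (simp add: rotv_def)
qed

locale frame_curve =
  fixes \<Phi> :: "real \<Rightarrow> quat" and c :: "real \<Rightarrow> complex"
  assumes unit: "norm (\<Phi> v) = 1"
    and \<Phi>_deriv: "(\<Phi> has_vector_derivative (0, \<i> * c v) \<otimes>\<^sub>q \<Phi> v) (at v)"
begin

definition fI :: "real \<Rightarrow> real^3" where "fI v = rotv (\<Phi> v) qi"

text \<open>The pair (0, a) is a j, so this places the complex plane in the plane orthogonal to
  \<open>fI v\<close>; the curve \<gamma> j is moved in this way.\<close>

definition fC :: "real \<Rightarrow> complex \<Rightarrow> real^3" where "fC v a = rotv (\<Phi> v) (0, a)"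

lemma fC_linear: "linear (fC v)"
proof -
  have "linear (\<lambda>a :: complex. (0, a) :: quat)" by (rule linearI) simp_all
  from linear_compose[OF this linear_rotv] show ?thesis by (simp add: fC_def[abs_def] o_def)
qed

lemmas fC_simps = linear_add[OF fC_linear] linear_diff[OF fC_linear] linear_scale[OF fC_linear] linear_neg[OF fC_linear]

lemma inner_fC: "fC v a \<bullet> fC v b = Re (a * cnj b)" "fI v \<bullet> fI v = 1" "fI v \<bullet> fC v a = 0" "fC v a \<bullet> fI v = 0"
  unfolding fC_def fI_def by (simp_all add: inner_rotv unit qi_def qmult_def)

lemma cross3_fC: "cross3 (fC v a) (fC v b) = Im (cnj a * b) *\<^sub>R fI v" "cross3 (fI v) (fC v a) = fC v (\<i> * a)"
  "cross3 (fC v a) (fI v) = fC v (- (\<i> * a))"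
proof -
  have "rotv (\<Phi> v) ((0, a) \<otimes>\<^sub>q (0, b)) = Im (cnj a * b) *\<^sub>R rotv (\<Phi> v) qi"
  proof -
    have "(0, a) \<otimes>\<^sub>q (0, b) = Im (cnj a * b) *\<^sub>R qi + (- Re (a * cnj b)) *\<^sub>R (1, 0)"
      by (simp add: qmult_def qi_def complex_eq_iff)
    moreover have "rotv (\<Phi> v) (1, 0) = 0"
      by (simp add: rotv_def qmult_qcnj_unit unit) (simp add: vec_of_quat_def vec_eq_iff forall_3)
    ultimately show ?thesis by (simp add: rotv_linear_simps del: scaleR_Pair)
  qed
  then show "cross3 (fC v a) (fC v b) = Im (cnj a * b) *\<^sub>R fI v"
    unfolding fC_def fI_def by (simp add: cross3_rotv unit)
  show "cross3 (fI v) (fC v a) = fC v (\<i> * a)" "cross3 (fC v a) (fI v) = fC v (- (\<i> * a))"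
    unfolding fC_def fI_def by (simp_all add: cross3_rotv unit qi_def) (simp_all add: qmult_def mult_ac)
qed

lemma fI_deriv: "(fI has_vector_derivative - fC v (2 * c v)) (at v)"
proof -
  have e: "qi \<otimes>\<^sub>q (0, \<i> * c v) - (0, \<i> * c v) \<otimes>\<^sub>q qi = (0, - (2 * c v))"
    by (simp add: qi_def qmult_def complex_eq_iff)
  show ?thesis
    using rotv_has_vector_derivative[OF \<Phi>_deriv[of v], where x = qi]
    unfolding e fI_def[symmetric] fC_def[symmetric] fC_simps .
qed

lemma fC_const_deriv: "((\<lambda>v. fC v a) has_vector_derivative (2 * Re (a * cnj (c v))) *\<^sub>R fI v) (at v)"
proof -
  have e: "(0, a) \<otimes>\<^sub>q (0, \<i> * c v) - (0, \<i> * c v) \<otimes>\<^sub>q (0, a) = (2 * Re (a * cnj (c v))) *\<^sub>R qi"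
    by (simp add: qmult_def qi_def complex_eq_iff)
  show ?thesis
    using rotv_has_vector_derivative[OF \<Phi>_deriv[of v], where x = "(0, a)"]
    unfolding e rotv_linear_simps fI_def[symmetric] fC_def[symmetric] .
qed

lemma fC_deriv:
  assumes "(a has_vector_derivative a') (at v)"
  shows "((\<lambda>v. fC v (a v)) has_vector_derivative fC v a' + (2 * Re (a v * cnj (c v))) *\<^sub>R fI v) (at v)"
proof -
  have e: "fC v z = Re z *\<^sub>R fC v 1 + Im z *\<^sub>R fC v \<i>" for v z
  proof -
    have "fC v z = fC v (Re z *\<^sub>R 1 + Im z *\<^sub>R \<i>)"
      by (rule arg_cong[where f = "fC v"]) (simp add: complex_eq_iff)
    then show ?thesis by (simp only: fC_simps)
  qed
  have d: "((\<lambda>v. Re (a v)) has_real_derivative Re a') (at v)" "((\<lambda>v. Im (a v)) has_real_derivative Im a') (at v)"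
    using assms by (auto simp: has_vector_derivative_complex_iff)
  have "((\<lambda>v. Re (a v) *\<^sub>R fC v 1 + Im (a v) *\<^sub>R fC v \<i>) has_vector_derivative
      (Re (a v) *\<^sub>R ((2 * Re (1 * cnj (c v))) *\<^sub>R fI v) + Re a' *\<^sub>R fC v 1) +
      (Im (a v) *\<^sub>R ((2 * Re (\<i> * cnj (c v))) *\<^sub>R fI v) + Im a' *\<^sub>R fC v \<i>)) (at v)"
    by (intro has_vector_derivative_add has_vector_derivative_scaleR fC_const_deriv d)
  moreover have "(Re (a v) *\<^sub>R ((2 * Re (1 * cnj (c v))) *\<^sub>R fI v) + Re a' *\<^sub>R fC v 1) +
      (Im (a v) *\<^sub>R ((2 * Re (\<i> * cnj (c v))) *\<^sub>R fI v) + Im a' *\<^sub>R fC v \<i>)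
     = fC v a' + (2 * Re (a v * cnj (c v))) *\<^sub>R fI v"
    unfolding e[of v a'] by (simp add: scaleR_add_left scaleR_add_right distrib_left mult_ac)
  moreover have "(\<lambda>v. fC v (a v)) = (\<lambda>v. Re (a v) *\<^sub>R fC v 1 + Im (a v) *\<^sub>R fC v \<i>)"
    by (rule ext, rule e)
  ultimately show ?thesis by (simp only:)
qed

end

lemma frame_imp_frame_curve:
  assumes "frame \<tau> \<omega> w r \<Phi>"
  shows "frame_curve \<Phi> (\<lambda>v. of_real (r v) * W1 \<tau> \<omega> (w v))"
proof
  fix v
  have 1: "norm (\<Phi> v) = 1" "\<Phi> differentiable at v"
    "vector_derivative \<Phi> (at v) \<otimes>\<^sub>q qinv (\<Phi> v) = qcomplex (of_real (r v) * W1 \<tau> \<omega> (w v)) \<otimes>\<^sub>q qk"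
    using assms by (auto simp: frame_def)
  show "norm (\<Phi> v) = 1" by fact
  let ?k = "(0, \<i> * (of_real (r v) * W1 \<tau> \<omega> (w v)))"
  have k: "qcomplex (of_real (r v) * W1 \<tau> \<omega> (w v)) \<otimes>\<^sub>q qk = ?k"
    by (simp add: qcomplex_def qk_def qmult_def mult_ac)
  have "vector_derivative \<Phi> (at v) = vector_derivative \<Phi> (at v) \<otimes>\<^sub>q (qinv (\<Phi> v) \<otimes>\<^sub>q \<Phi> v)"
    using 1(1) by (simp add: qinv_unit qmult_qcnj_unit)
  also have "\<dots> = ?k \<otimes>\<^sub>q \<Phi> v" by (simp add: 1(3) k flip: qmult_assoc)
  finally show "(\<Phi> has_vector_derivative ?k \<otimes>\<^sub>q \<Phi> v) (at v)"
    using 1(2) by (metis vector_derivative_works)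
qed

text \<open>With a periodic coefficient, \<Phi>(v) and \<Phi>(v + \<V>) solve the same linear
  equation, so their quotient is constant.\<close>

lemma (in frame_curve) monodromy:
  assumes "\<And>v. c (v + \<V>) = c v"
  shows "\<Phi> (v + \<V>) = \<Phi> v \<otimes>\<^sub>q (qcnj (\<Phi> 0) \<otimes>\<^sub>q \<Phi> \<V>)"
proof -
  define D where "D v = qcnj (\<Phi> v) \<otimes>\<^sub>q \<Phi> (v + \<V>)" for v
  have "(D has_vector_derivative 0) (at v)" for v
  proof -
    let ?k = "(0, \<i> * c v)"
    have q: "((\<lambda>v. qcnj (\<Phi> v)) has_vector_derivative qcnj (?k \<otimes>\<^sub>q \<Phi> v)) (at v)"
      using bounded_linear.has_vector_derivative[OF linear_qcnj[unfolded linear_conv_bounded_linear] \<Phi>_deriv] .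
    have k: "qcnj (?k \<otimes>\<^sub>q \<Phi> v) = - (qcnj (\<Phi> v) \<otimes>\<^sub>q ?k)"
      unfolding qcnj_qmult by (simp add: qcnj_def qmult_def)
    have "((\<lambda>v. v + \<V>) has_real_derivative 1) (at v)" by (auto intro!: derivative_eq_intros)
    from vector_diff_chain_at[OF this[unfolded has_real_derivative_iff_has_vector_derivative] \<Phi>_deriv]
    have s: "((\<lambda>v. \<Phi> (v + \<V>)) has_vector_derivative ?k \<otimes>\<^sub>q \<Phi> (v + \<V>)) (at v)"
      by (simp add: o_def assms)
    show ?thesis
      unfolding D_def[abs_def] using bounded_bilinear.has_vector_derivative[OF bounded_bilinear_qmult q s]
      by (simp add: k qmult_linear_simps qmult_assoc)
  qed
  then obtain d where "\<And>v. D v = d"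
    using has_vector_derivative_zero_constant[of UNIV D] by (metis convex_UNIV UNIV_I)
  then have "D v = D 0" by simp
  then have "\<Phi> v \<otimes>\<^sub>q (qcnj (\<Phi> v) \<otimes>\<^sub>q \<Phi> (v + \<V>)) = \<Phi> v \<otimes>\<^sub>q (qcnj (\<Phi> 0) \<otimes>\<^sub>q \<Phi> \<V>)"
    unfolding D_def by simp
  then show ?thesis by (simp add: qmult_qcnj_unit[OF unit] flip: qmult_assoc)
qed

section \<open>Differential geometry of the cylinder\<close>

text \<open>Polar decomposition: the real part of the logarithmic derivative drives the modulus; its
  imaginary part will drive the direction.\<close>

lemma cmod_has_real_derivative:
  assumes "(F has_vector_derivative F') (at t)" "F t \<noteq> 0"
  shows "((\<lambda>t. cmod (F t)) has_real_derivative cmod (F t) * Re (F' / F t)) (at t)"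
proof -
  have d: "((\<lambda>t. Re (F t)) has_real_derivative Re F') (at t)" "((\<lambda>t. Im (F t)) has_real_derivative Im F') (at t)"
    using assms by (auto simp: has_vector_derivative_complex_iff)
  define N where "N = (Re (F t))\<^sup>2 + (Im (F t))\<^sup>2"
  have N: "N > 0" using assms(2) by (simp add: N_def complex_neq_0)
  have "((\<lambda>t. (Re (F t))\<^sup>2 + (Im (F t))\<^sup>2) has_real_derivative 2 * (Re F' * Re (F t) + Im F' * Im (F t))) (at t)"
    using DERIV_add[OF DERIV_power[OF d(1), of 2] DERIV_power[OF d(2), of 2]] by (simp add: algebra_simps)
  from DERIV_chain2[OF DERIV_real_sqrt[OF N, unfolded N_def] this]
  have "((\<lambda>t. sqrt ((Re (F t))\<^sup>2 + (Im (F t))\<^sup>2)) has_real_derivative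
      inverse (sqrt N) / 2 * (2 * (Re F' * Re (F t) + Im F' * Im (F t)))) (at t)"
    unfolding N_def .
  moreover have "inverse (sqrt N) / 2 * (2 * (Re F' * Re (F t) + Im F' * Im (F t))) = sqrt N * ((Re F' * Re (F t) + Im F' * Im (F t)) / N)"
  proof -
    have "inverse (sqrt N) = sqrt N / N" using N by (simp add: real_div_sqrt field_simps)
    then have "inverse (sqrt N) / 2 * (2 * c) = sqrt N * (c / N)" for c by simp
    then show ?thesis .
  qed
  ultimately show ?thesis unfolding cmod_def Re_divide N_def[symmetric] by simp
qed

lemma direction_has_vector_derivative:
  assumes "(F has_vector_derivative F') (at t)" "F t \<noteq> 0"
  shows "((\<lambda>t. F t / of_real (cmod (F t))) has_vector_derivative \<i> * of_real (Im (F' / F t)) * (F t / of_real (cmod (F t)))) (at t)"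
proof -
  define n where "n = cmod (F t)"
  define q where "q = F' / F t"
  have n: "n \<noteq> 0" using assms(2) by (simp add: n_def)
  have F': "F' = q * F t" using assms(2) by (simp add: q_def)
  have "((\<lambda>t. inverse (cmod (F t))) has_real_derivative - (inverse n * (n * Re q) * inverse n)) (at t)"
    using DERIV_inverse'[OF cmod_has_real_derivative[OF assms]] n by (simp add: n_def q_def)
  from has_vector_derivative_scaleR[OF this assms(1)]
  have "((\<lambda>t. inverse (cmod (F t)) *\<^sub>R F t) has_vector_derivative
     inverse n *\<^sub>R F' + (- (inverse n * (n * Re q) * inverse n)) *\<^sub>R F t) (at t)"
    by (simp add: n_def)
  moreover have "inverse n *\<^sub>R F' + (- (inverse n * (n * Re q) * inverse n)) *\<^sub>R F t = \<i> * of_real (Im q) * (F t / of_real n)"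
  proof -
    have e: "inverse n * (n * Re q) * inverse n = inverse n * Re q" using n by simp
    have "inverse n *\<^sub>R F' + (- (inverse n * (n * Re q) * inverse n)) *\<^sub>R F t
      = (q - of_real (Re q)) * (F t / of_real n)"
      unfolding e F' by (simp add: scaleR_conv_of_real divide_inverse algebra_simps)
    also have "q - of_real (Re q) = \<i> * of_real (Im q)" by (simp add: complex_eq_iff)
    finally show ?thesis .
  qed
  moreover have "(\<lambda>t. inverse (cmod (F t)) *\<^sub>R F t) = (\<lambda>t. F t / of_real (cmod (F t)))"
    by (simp add: scaleR_conv_of_real divide_inverse mult.commute)
  ultimately show ?thesis by (simp only: n_def q_def)
qed

lemma orthonormal_expand_3:
  fixes a b c x :: "real^3"
  assumes "a \<bullet> a = 1" "b \<bullet> b = 1" "c \<bullet> c = 1" "a \<bullet> b = 0" "a \<bullet> c = 0" "b \<bullet> c = 0"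
  shows "x = (x \<bullet> a) *\<^sub>R a + (x \<bullet> b) *\<^sub>R b + (x \<bullet> c) *\<^sub>R c"
proof -
  have dist: "a \<noteq> b" "a \<noteq> c" "b \<noteq> c" using assms by auto
  have po: "pairwise orthogonal {a, b, c}"
    using assms by (auto simp: pairwise_def orthogonal_def inner_commute)
  have nz: "0 \<notin> {a, b, c}" using assms by auto
  have "independent {a, b, c}" by (rule pairwise_orthogonal_independent[OF po nz])
  moreover have "card {a, b, c} = DIM(real^3)" using dist by simp
  ultimately have "span {a, b, c} = UNIV"
    by (metis UNIV_I basis_card_eq_dim card_ge_dim_independent dim_UNIV subset_UNIV top.extremum_uniqueI order_refl)
  then have "x \<in> span {a, b, c}" by simp
  then have "(\<Sum>i\<in>{a, b, c}. (x \<bullet> i) *\<^sub>R i) = x"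
    by (intro orthonormal_basis_expand po) (use assms in \<open>auto simp: norm_eq_1\<close>)
  then show ?thesis using dist by (simp add: add.assoc)
qed

context theta_cylinder
begin

abbreviation pt :: "real \<Rightarrow> real \<Rightarrow> complex" where "pt u x \<equiv> of_real u + \<i> * of_real x"

text \<open>Since $h = \log|G|$, \<open>L\<close> is $h_u - i h_{\mathrm w}$.\<close>

definition L :: "complex \<Rightarrow> complex" where "L z = deriv G z / G z"

definition E :: "complex \<Rightarrow> complex" where "E z = G z / of_real (cmod (G z))"

text \<open>On the strip |E| = 1, so X E = 2 \<open>W1\<close>: the real and imaginary parts of
  \<open>X\<close> are the coordinates of 2 \<open>W1\<close> in the rotating basis E, iE.\<close>

definition X :: "complex \<Rightarrow> complex" where "X z = 2 * W1 \<tau> \<omega> (Im z) * cnj (E z)"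

lemma strip_pt: "z \<in> strip \<Longrightarrow> z = pt (Re z) (Im z)" "z \<in> strip \<Longrightarrow> 0 < Im z \<and> Im z < 2 * pi * Im \<tau>"
  by (simp_all add: strip_def complex_eq_iff)

lemma L_holomorphic: "L holomorphic_on strip"
  unfolding L_def[abs_def]
  by (intro holomorphic_intros G_holomorphic open_strip) (use G_nonzero in auto)

lemma G_path:
  assumes "(\<zeta> has_vector_derivative \<zeta>') (at t)" "\<zeta> t \<in> strip"
  shows Gam_path: "((\<lambda>t. Gam (\<zeta> t)) has_vector_derivative \<zeta>' * G (\<zeta> t)) (at t)"
    and cmod_G_path: "((\<lambda>t. cmod (G (\<zeta> t))) has_real_derivative cmod (G (\<zeta> t)) * Re (\<zeta>' * L (\<zeta> t))) (at t)"
    and E_path: "((\<lambda>t. E (\<zeta> t)) has_vector_derivative \<i> * of_real (Im (\<zeta>' * L (\<zeta> t))) * E (\<zeta> t)) (at t)"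
    and L_path: "((\<lambda>t. L (\<zeta> t)) has_vector_derivative \<zeta>' * deriv L (\<zeta> t)) (at t)"
proof -
  show "((\<lambda>t. Gam (\<zeta> t)) has_vector_derivative \<zeta>' * G (\<zeta> t)) (at t)"
    using field_vector_diff_chain_at[OF assms(1) Gam_has_derivative] theta1_strip assms(2) by (simp add: o_def)
  show "((\<lambda>t. L (\<zeta> t)) has_vector_derivative \<zeta>' * deriv L (\<zeta> t)) (at t)"
    using field_vector_diff_chain_at[OF assms(1) holomorphic_derivI[OF L_holomorphic open_strip assms(2)]] by (simp add: o_def)
  have d: "((\<lambda>t. G (\<zeta> t)) has_vector_derivative \<zeta>' * deriv G (\<zeta> t)) (at t)"
    using field_vector_diff_chain_at[OF assms(1) holomorphic_derivI[OF G_holomorphic open_strip assms(2)]] by (simp add: o_def)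
  show "((\<lambda>t. cmod (G (\<zeta> t))) has_real_derivative cmod (G (\<zeta> t)) * Re (\<zeta>' * L (\<zeta> t))) (at t)"
    using cmod_has_real_derivative[OF d G_nonzero[OF assms(2)]] by (simp add: L_def)
  show "((\<lambda>t. E (\<zeta> t)) has_vector_derivative \<i> * of_real (Im (\<zeta>' * L (\<zeta> t))) * E (\<zeta> t)) (at t)"
    using direction_has_vector_derivative[OF d G_nonzero[OF assms(2)]] by (simp add: L_def E_def)
qed

lemma pt_deriv_u: "((\<lambda>u. pt u x) has_vector_derivative 1) (at u)"
  and pt_deriv_x: "((\<lambda>x. pt u x) has_vector_derivative \<i>) (at x)"
  by (auto intro!: derivative_eq_intros simp: has_vector_derivative_complex_iff)

lemma cmod_E: "z \<in> strip \<Longrightarrow> cmod (E z) = 1" "z \<in> strip \<Longrightarrow> E z * cnj (E z) = 1" "z \<in> strip \<Longrightarrow> G z = of_real (cmod (G z)) * E z"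
proof -
  assume z: "z \<in> strip"
  then show 1: "cmod (E z) = 1" using G_nonzero by (simp add: E_def norm_divide)
  show "E z * cnj (E z) = 1" using complex_norm_square[of "E z"] 1 by simp
  show "G z = of_real (cmod (G z)) * E z" using G_nonzero[OF z] by (simp add: E_def)
qed

text \<open>The u-derivative of e^h = 2 Re (\<gamma> cnj W1), divided by e^h.\<close>

lemma Re_L_eq_Re_X:
  assumes "z \<in> strip"
  shows "Re (L z) = Re (X z)"
proof -
  define u x where "u = Re z" and "x = Im z"
  have z: "z = pt u x" and x: "0 < x" "x < 2 * pi * Im \<tau>"
    using strip_pt[OF assms] by (auto simp: u_def x_def)
  have "((\<lambda>u. 2 * Re (Gam (pt u x) * cnj (W1 \<tau> \<omega> x))) has_real_derivative 2 * Re (G z * cnj (W1 \<tau> \<omega> x))) (at u)"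
  proof -
    have "((\<lambda>u. Gam (pt u x) * cnj (W1 \<tau> \<omega> x)) has_vector_derivative G z * cnj (W1 \<tau> \<omega> x)) (at u)"
      using has_vector_derivative_mult_left[OF Gam_path[OF pt_deriv_u]] assms unfolding z by simp
    then show ?thesis
      by (intro DERIV_cmult) (simp only: has_vector_derivative_complex_iff)
  qed
  moreover have "((\<lambda>u. cmod (G (pt u x))) has_real_derivative cmod (G z) * Re (L z)) (at u)"
    using cmod_G_path[OF pt_deriv_u] assms unfolding z by simp
  ultimately have "cmod (G z) * Re (L z) = 2 * Re (G z * cnj (W1 \<tau> \<omega> x))"
    unfolding norm_G_eq_W1[OF x, symmetric] by (rule DERIV_unique[rotated])
  also have "\<dots> = cmod (G z) * (2 * Re (E z * cnj (W1 \<tau> \<omega> x)))"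
    by (subst cmod_E(3)[OF assms]) (simp add: algebra_simps)
  finally have "Re (L z) = 2 * Re (E z * cnj (W1 \<tau> \<omega> x))" using G_nonzero[OF assms] by simp
  also have "\<dots> = Re (X z)" by (simp add: X_def x_def algebra_simps)
  finally show ?thesis .
qed

lemma X_deriv_u:
  assumes "pt u x \<in> strip"
  shows "((\<lambda>u. X (pt u x)) has_vector_derivative - \<i> * of_real (Im (L (pt u x))) * X (pt u x)) (at u)"
proof -
  have "((\<lambda>u. cnj (E (pt u x))) has_vector_derivative cnj (\<i> * of_real (Im (L (pt u x))) * E (pt u x))) (at u)"
    using has_vector_derivative_cnj[OF E_path[OF pt_deriv_u assms]] by simp
  from has_vector_derivative_mult_right[OF this, of "2 * W1 \<tau> \<omega> x"] show ?thesis
    by (simp add: X_def mult_ac)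
qed

text \<open>Differentiating \<open>Re_L_eq_Re_X\<close> once more in u gives h_uu, which is -h_ww
  since \<open>L\<close> is holomorphic. This supplies the second derivative of the metric without
  another theta identity.\<close>

lemma Re_deriv_L:
  assumes "z \<in> strip"
  shows "Re (deriv L z) = Im (L z) * Im (X z)"
proof -
  define u x where "u = Re z" and "x = Im z"
  have z: "z = pt u x" and x: "0 < x" "x < 2 * pi * Im \<tau>"
    using strip_pt[OF assms] by (auto simp: u_def x_def)
  have s: "pt u x \<in> strip" for u using x by simp
  have "((\<lambda>u. Re (L (pt u x))) has_real_derivative Re (deriv L z)) (at u)"
    using L_path[OF pt_deriv_u s] unfolding z by (simp add: has_vector_derivative_complex_iff)
  moreover have "((\<lambda>u. Re (X (pt u x))) has_real_derivative Im (L z) * Im (X z)) (at u)"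
    using X_deriv_u[OF s, of u] unfolding z by (simp add: has_vector_derivative_complex_iff)
  ultimately show ?thesis unfolding Re_L_eq_Re_X[OF s] by (rule DERIV_unique)
qed

end

locale isothermic_cylinder = theta_cylinder +
  fixes w r :: "real \<Rightarrow> real" and \<Phi> :: "real \<Rightarrow> quat"
  assumes adm: "admissible \<tau> w r" and fr: "frame \<tau> \<omega> w r \<Phi>"

sublocale isothermic_cylinder \<subseteq> frame_curve \<Phi> "\<lambda>v. of_real (r v) * W1 \<tau> \<omega> (w v)"
  using fr by (rule frame_imp_frame_curve)

context isothermic_cylinder
begin

definition wd :: "real \<Rightarrow> real" where "wd = deriv w"
definition wdd :: "real \<Rightarrow> real" where "wdd = deriv wd"
definition rd :: "real \<Rightarrow> real" where "rd = deriv r"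

lemma w_range: "0 < w v" "w v < 2 * pi * Im \<tau>"
  and w_deriv: "(w has_real_derivative wd v) (at v)"
  and wd_deriv: "(wd has_real_derivative wdd v) (at v)"
  and r_deriv: "(r has_real_derivative rd v) (at v)"
  and r_wd: "(r v)\<^sup>2 + (wd v)\<^sup>2 = 1"
proof -
  have a: "0 < w v" "w v < 2 * pi * Im \<tau>" "(r v)\<^sup>2 = 1 - (deriv w v)\<^sup>2"
    and s: "\<And>n t. (deriv ^^ n) w differentiable at t" "\<And>n t. (deriv ^^ n) r differentiable at t"
    using adm by (auto simp: admissible_def smooth_def)
  show "0 < w v" "w v < 2 * pi * Im \<tau>" "(r v)\<^sup>2 + (wd v)\<^sup>2 = 1" using a by (auto simp: wd_def)
  have "w differentiable at v" "deriv w differentiable at v" "r differentiable at v"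
    using s(1)[of 0 v] s(1)[of 1 v] s(2)[of 0 v] by auto
  then show "(w has_real_derivative wd v) (at v)" "(wd has_real_derivative wdd v) (at v)" "(r has_real_derivative rd v) (at v)"
    unfolding wd_def wdd_def rd_def by (simp_all add: DERIV_deriv_iff_real_differentiable)
qed

lemma r_rd: "r v * rd v + wd v * wdd v = 0"
proof -
  have "((\<lambda>v. (r v)\<^sup>2 + (wd v)\<^sup>2) has_real_derivative 2 * (r v * rd v + wd v * wdd v)) (at v)"
    by (auto intro!: derivative_eq_intros r_deriv wd_deriv simp: algebra_simps)
  moreover have "((\<lambda>v. (r v)\<^sup>2 + (wd v)\<^sup>2) has_real_derivative 0) (at v)"
    unfolding r_wd by simp
  ultimately show ?thesis using DERIV_unique by fastforce
qed

abbreviation \<zeta> :: "real \<Rightarrow> real \<Rightarrow> complex" where "\<zeta> u v \<equiv> pt u (w v)"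

lemma \<zeta>_strip [simp]: "\<zeta> u v \<in> strip" using w_range by simp

lemma \<zeta>_deriv_v: "((\<lambda>v. \<zeta> u v) has_vector_derivative \<i> * of_real (wd v)) (at v)"
  using w_deriv by (auto intro!: derivative_eq_intros simp: has_vector_derivative_complex_iff)

definition e1 :: "real \<Rightarrow> real \<Rightarrow> real^3" where "e1 u v = fC v (E (\<zeta> u v))"
definition eM :: "real \<Rightarrow> real \<Rightarrow> real^3" where "eM u v = fC v (\<i> * E (\<zeta> u v))"
text \<open>Since r^2 + w'^2 = 1, \<open>e2\<close> and \<open>nv\<close> arise from
  \<open>fI\<close> and \<open>eM\<close> by an orthogonal change of basis: with r = cos \<phi> and
  w' = sin \<phi>, \<phi> measures the turning of the tangent of the \<open>v\<close>-curve against
  the plane normal.\<close>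

definition e2 :: "real \<Rightarrow> real \<Rightarrow> real^3" where "e2 u v = r v *\<^sub>R fI v + wd v *\<^sub>R eM u v"
definition nv :: "real \<Rightarrow> real \<Rightarrow> real^3" where "nv u v = wd v *\<^sub>R fI v - r v *\<^sub>R eM u v"
text \<open>$e^h$ times the normal curvature of the \<open>v\<close>-curve.\<close>

definition B :: "real \<Rightarrow> real \<Rightarrow> real" where
  "B u v = r v * Im (X (\<zeta> u v)) - (wdd v * r v - rd v * wd v)"

lemma inner_frame:
  "e1 u v \<bullet> e1 u v = 1" "eM u v \<bullet> eM u v = 1" "e1 u v \<bullet> eM u v = 0" "eM u v \<bullet> e1 u v = 0"
  "e1 u v \<bullet> fI v = 0" "fI v \<bullet> e1 u v = 0" "eM u v \<bullet> fI v = 0" "fI v \<bullet> eM u v = 0"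
proof -
  have "Re (a * E (\<zeta> u v) * cnj (b * E (\<zeta> u v))) = Re (a * cnj b)" for a b
  proof -
    have "a * E (\<zeta> u v) * cnj (b * E (\<zeta> u v)) = a * cnj b * (E (\<zeta> u v) * cnj (E (\<zeta> u v)))" by simp
    then show ?thesis by (simp only: cmod_E(2)[OF \<zeta>_strip]) simp
  qed
  from this[of 1 1] this[of \<i> \<i>] this[of 1 \<i>] this[of \<i> 1]
  show "e1 u v \<bullet> e1 u v = 1" "eM u v \<bullet> eM u v = 1" "e1 u v \<bullet> eM u v = 0" "eM u v \<bullet> e1 u v = 0"
    unfolding e1_def eM_def inner_fC by simp_all
qed (simp_all add: e1_def eM_def inner_fC)

lemma orthonormal_frame:
  "e1 u v \<bullet> e2 u v = 0" "e1 u v \<bullet> nv u v = 0" "e2 u v \<bullet> nv u v = 0"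
  "e2 u v \<bullet> e1 u v = 0" "nv u v \<bullet> e1 u v = 0" "nv u v \<bullet> e2 u v = 0"
  "e2 u v \<bullet> e2 u v = 1" "nv u v \<bullet> nv u v = 1"
  using r_wd[of v] unfolding e2_def nv_def
  by (simp_all add: inner_simps inner_frame inner_fC power2_eq_square algebra_simps)

lemma frame_expand: "x = (x \<bullet> e1 u v) *\<^sub>R e1 u v + (x \<bullet> e2 u v) *\<^sub>R e2 u v + (x \<bullet> nv u v) *\<^sub>R nv u v"
  by (rule orthonormal_expand_3) (simp_all add: orthonormal_frame inner_frame)

lemma eM_eq: "eM u v = wd v *\<^sub>R e2 u v - r v *\<^sub>R nv u v"
proof -
  have "wd v *\<^sub>R e2 u v - r v *\<^sub>R nv u v = ((r v)\<^sup>2 + (wd v)\<^sup>2) *\<^sub>R eM u v"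
    unfolding e2_def nv_def by (simp add: algebra_simps power2_eq_square)
  then show ?thesis by (simp add: r_wd)
qed

lemma cross3_frame: "cross3 (e1 u v) (e2 u v) = nv u v"
proof -
  have "cross3 (e1 u v) (e2 u v) = r v *\<^sub>R fC v (- (\<i> * E (\<zeta> u v))) + wd v *\<^sub>R (Im (cnj (E (\<zeta> u v)) * (\<i> * E (\<zeta> u v))) *\<^sub>R fI v)"
    unfolding e1_def e2_def eM_def cross_add_right cross_mult_right cross3_fC ..
  also have "cnj (E (\<zeta> u v)) * (\<i> * E (\<zeta> u v)) = \<i> * (E (\<zeta> u v) * cnj (E (\<zeta> u v)))" by simp
  also have "\<dots> = \<i>" by (simp only: cmod_E(2)[OF \<zeta>_strip] mult_1_right)
  finally show ?thesis by (simp add: nv_def eM_def fC_simps)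
qed

lemma cyl_eq: "cyl \<tau> \<omega> w \<Phi> u v = fC v (Gam (\<zeta> u v))"
  unfolding cyl_def fC_def rotv_def gamma_eq_Gam qinv_unit[OF unit]
  by (simp add: qmult_assoc qcomplex_def qj_def, simp add: qmult_def)

abbreviation "f \<equiv> cyl \<tau> \<omega> w \<Phi>"

lemma fC_has_vector_derivative_u:
  assumes "(a has_vector_derivative a') (at u)"
  shows "((\<lambda>u. fC v (a u)) has_vector_derivative fC v a') (at u)"
  using bounded_linear.has_vector_derivative[OF fC_linear[unfolded linear_conv_bounded_linear] assms] .

lemma fC_times_real: "fC v (of_real t * a) = t *\<^sub>R fC v a"
  using fC_simps(3)[of v t a] by (simp add: scaleR_conv_of_real)

lemma f_deriv_u: "((\<lambda>u. f u v) has_vector_derivative cmod (G (\<zeta> u v)) *\<^sub>R e1 u v) (at u)"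
proof -
  have "((\<lambda>u. f u v) has_vector_derivative fC v (1 * G (\<zeta> u v))) (at u)"
    unfolding cyl_eq by (intro fC_has_vector_derivative_u Gam_path pt_deriv_u \<zeta>_strip)
  then show ?thesis
    unfolding e1_def mult_1_left fC_times_real[symmetric] cmod_E(3)[OF \<zeta>_strip, symmetric] .
qed

lemma e1_deriv_u: "((\<lambda>u. e1 u v) has_vector_derivative Im (L (\<zeta> u v)) *\<^sub>R eM u v) (at u)"
proof -
  have "((\<lambda>u. e1 u v) has_vector_derivative fC v (\<i> * of_real (Im (1 * L (\<zeta> u v))) * E (\<zeta> u v))) (at u)"
    unfolding e1_def by (intro fC_has_vector_derivative_u E_path pt_deriv_u \<zeta>_strip)
  then show ?thesis unfolding eM_def fC_times_real[symmetric] by (simp add: mult_ac)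
qed

lemma eM_deriv_u: "((\<lambda>u. eM u v) has_vector_derivative - Im (L (\<zeta> u v)) *\<^sub>R e1 u v) (at u)"
proof -
  have "((\<lambda>u. eM u v) has_vector_derivative fC v (\<i> * (\<i> * of_real (Im (1 * L (\<zeta> u v))) * E (\<zeta> u v)))) (at u)"
    unfolding eM_def by (intro fC_has_vector_derivative_u has_vector_derivative_mult_right E_path pt_deriv_u \<zeta>_strip)
  moreover have "\<i> * (\<i> * of_real (Im (1 * L (\<zeta> u v))) * E (\<zeta> u v)) = of_real (- Im (L (\<zeta> u v))) * E (\<zeta> u v)"
    by (simp add: mult.assoc[symmetric])
  ultimately show ?thesis unfolding e1_def fC_times_real[symmetric] by simp
qed

lemma nv_deriv_u: "((\<lambda>u. nv u v) has_vector_derivative (r v * Im (L (\<zeta> u v))) *\<^sub>R e1 u v) (at u)"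
proof -
  have "((\<lambda>u. wd v *\<^sub>R fI v - r v *\<^sub>R eM u v) has_vector_derivative 0 - r v *\<^sub>R (- Im (L (\<zeta> u v)) *\<^sub>R e1 u v)) (at u)"
    by (intro has_vector_derivative_diff has_vector_derivative_const
        bounded_linear.has_vector_derivative[OF bounded_linear_scaleR_right] eM_deriv_u)
  then show ?thesis unfolding nv_def by simp
qed

text \<open>The metric identity makes the \<open>fI\<close> component equal to r e^h, while the
  motion of \<gamma> along w contributes w' e^h along \<open>eM\<close>. Together with
  \<open>f_deriv_u\<close> this shows that the parametrisation is conformal.\<close>

lemma f_deriv_v: "((\<lambda>v. f u v) has_vector_derivative cmod (G (\<zeta> u v)) *\<^sub>R e2 u v) (at v)"
proof -
  have "((\<lambda>v. f u v) has_vector_derivative fC v (\<i> * of_real (wd v) * G (\<zeta> u v)) +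
     (2 * Re (Gam (\<zeta> u v) * cnj (of_real (r v) * W1 \<tau> \<omega> (w v)))) *\<^sub>R fI v) (at v)"
    unfolding cyl_eq by (intro fC_deriv Gam_path \<zeta>_deriv_v \<zeta>_strip)
  moreover have "fC v (\<i> * of_real (wd v) * G (\<zeta> u v)) = (wd v * cmod (G (\<zeta> u v))) *\<^sub>R eM u v"
    unfolding eM_def fC_times_real[symmetric] by (subst cmod_E(3)[OF \<zeta>_strip]) (simp add: mult_ac)
  moreover have "2 * Re (Gam (\<zeta> u v) * cnj (of_real (r v) * W1 \<tau> \<omega> (w v))) = r v * cmod (G (\<zeta> u v))"
    unfolding norm_G_eq_W1[OF w_range] by (simp add: algebra_simps)
  moreover have "(wd v * cmod (G (\<zeta> u v))) *\<^sub>R eM u v + (r v * cmod (G (\<zeta> u v))) *\<^sub>R fI v = cmod (G (\<zeta> u v)) *\<^sub>R e2 u v"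
    unfolding e2_def by (simp add: scaleR_add_right mult_ac add.commute)
  ultimately show ?thesis by (simp only:)
qed

lemma E_W1: "2 * Re (E (\<zeta> u v) * cnj (of_real (r v) * W1 \<tau> \<omega> (w v))) = r v * Re (L (\<zeta> u v))"
  "2 * Re (\<i> * E (\<zeta> u v) * cnj (of_real (r v) * W1 \<tau> \<omega> (w v))) = r v * Im (X (\<zeta> u v))"
  unfolding Re_L_eq_Re_X[OF \<zeta>_strip] by (simp_all add: X_def algebra_simps)

lemma E_deriv_v: "((\<lambda>v. E (\<zeta> u v)) has_vector_derivative of_real (wd v * Re (L (\<zeta> u v))) * (\<i> * E (\<zeta> u v))) (at v)"
proof -
  have "\<i> * of_real (Im (\<i> * of_real (wd v) * L (\<zeta> u v))) * E (\<zeta> u v) = of_real (wd v * Re (L (\<zeta> u v))) * (\<i> * E (\<zeta> u v))"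
    by simp
  then show ?thesis using E_path[OF \<zeta>_deriv_v \<zeta>_strip, of u v] by (simp only:)
qed

lemma e1_deriv_v: "((\<lambda>v. e1 u v) has_vector_derivative Re (L (\<zeta> u v)) *\<^sub>R e2 u v) (at v)"
  using fC_deriv[OF E_deriv_v, of u v] unfolding e1_def e2_def eM_def E_W1 fC_times_real
  by (simp add: scaleR_add_right mult_ac add.commute)

lemma eM_deriv_v:
  "((\<lambda>v. eM u v) has_vector_derivative - (wd v * Re (L (\<zeta> u v))) *\<^sub>R e1 u v + (r v * Im (X (\<zeta> u v))) *\<^sub>R fI v) (at v)"
proof -
  have "\<i> * (of_real (wd v * Re (L (\<zeta> u v))) * (\<i> * E (\<zeta> u v))) = of_real (- (wd v * Re (L (\<zeta> u v)))) * E (\<zeta> u v)"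
    by (simp add: algebra_simps)
  then show ?thesis
    using fC_deriv[OF has_vector_derivative_mult_right[OF E_deriv_v, of \<i>], of u v]
    unfolding eM_def e1_def by (simp only: E_W1 fC_times_real)
qed

lemma fI_deriv_v:
  "(fI has_vector_derivative - ((r v * Re (L (\<zeta> u v))) *\<^sub>R e1 u v + (r v * Im (X (\<zeta> u v))) *\<^sub>R eM u v)) (at v)"
proof -
  define e where "e = E (\<zeta> u v)"
  define x where "x = X (\<zeta> u v)"
  have "2 * W1 \<tau> \<omega> (w v) * (e * cnj e) = x * e"
    unfolding e_def x_def by (simp add: X_def mult_ac)
  then have W: "2 * W1 \<tau> \<omega> (w v) = (of_real (Re x) + \<i> * of_real (Im x)) * e"
    unfolding e_def cmod_E(2)[OF \<zeta>_strip] complex_eq[symmetric] by simp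
  have "2 * (of_real (r v) * W1 \<tau> \<omega> (w v)) = of_real (r v) * (2 * W1 \<tau> \<omega> (w v))" by simp
  also have "\<dots> = of_real (r v * Re x) * e + of_real (r v * Im x) * (\<i> * e)"
    unfolding W by (simp add: algebra_simps)
  finally have eq: "2 * (of_real (r v) * W1 \<tau> \<omega> (w v)) = of_real (r v * Re x) * e + of_real (r v * Im x) * (\<i> * e)" .
  have "(fI has_vector_derivative - fC v (of_real (r v * Re x) * e + of_real (r v * Im x) * (\<i> * e))) (at v)"
    using fI_deriv[of v] by (simp only: eq)
  then show ?thesis
    by (simp only: fC_simps(1) fC_times_real e1_def eM_def e_def x_def Re_L_eq_Re_X[OF \<zeta>_strip])
qed

text \<open>The \<open>e1\<close> components cancel, so the derivative of the normal is tangent to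
  the \<open>v\<close>-curve: Rodrigues' criterion for a curvature line. Both remaining coefficients
  contain the factor \<open>B\<close> by r^2 + w'^2 = 1 and its derivative.\<close>

lemma nv_deriv_v: "((\<lambda>v. nv u v) has_vector_derivative - B u v *\<^sub>R e2 u v) (at v)"
proof -
  let ?x = "Im (X (\<zeta> u v))" and ?l = "Re (L (\<zeta> u v))"
  have "((\<lambda>v. nv u v) has_vector_derivative
     (wd v *\<^sub>R (- ((r v * ?l) *\<^sub>R e1 u v + (r v * ?x) *\<^sub>R eM u v)) + wdd v *\<^sub>R fI v)
     - (r v *\<^sub>R (- (wd v * ?l) *\<^sub>R e1 u v + (r v * ?x) *\<^sub>R fI v) + rd v *\<^sub>R eM u v)) (at v)"
    unfolding nv_def by (intro has_vector_derivative_diff has_vector_derivative_scaleR wd_deriv r_deriv fI_deriv_v eM_deriv_v)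
  moreover have "(wd v *\<^sub>R (- ((r v * ?l) *\<^sub>R e1 u v + (r v * ?x) *\<^sub>R eM u v)) + wdd v *\<^sub>R fI v)
     - (r v *\<^sub>R (- (wd v * ?l) *\<^sub>R e1 u v + (r v * ?x) *\<^sub>R fI v) + rd v *\<^sub>R eM u v)
    = (wdd v - (r v)\<^sup>2 * ?x) *\<^sub>R fI v + (- (wd v * r v * ?x) - rd v) *\<^sub>R eM u v"
    by (simp add: algebra_simps power2_eq_square)
  moreover have "wdd v - (r v)\<^sup>2 * ?x = - B u v * r v" "- (wd v * r v * ?x) - rd v = - B u v * wd v"
    using r_wd[of v] r_rd[of v] unfolding B_def by algebra+
  ultimately show ?thesis by (simp add: e2_def scaleR_add_right)
qed

text \<open>With \<open>\<xi> = Z - f\<close> and \<open>k = 1\<close> this is Joachimsthal's theorem for a sphere, with constant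
  \<open>\<xi>\<close> and \<open>k = 0\<close> the one for a plane.\<close>

lemma constant_contact_coefficients:
  assumes d: "\<And>v. (\<xi> has_vector_derivative - (k * cmod (G (\<zeta> u v))) *\<^sub>R e2 u v) (at v)"
    and o: "\<And>v. \<xi> v \<bullet> e2 u v = 0"
  obtains \<alpha> \<beta> where "\<And>v. \<xi> v = \<alpha> *\<^sub>R e1 u v + \<beta> *\<^sub>R nv u v"
    "\<And>v. k * cmod (G (\<zeta> u v)) + \<alpha> * Re (L (\<zeta> u v)) - \<beta> * B u v = 0"
proof -
  \<comment> \<open>The derivatives of \<xi> and of \<open>e1\<close> are both multiples of
    \<open>e2\<close>, to which \<open>e1\<close> and \<xi> are orthogonal; the same works for
    \<open>nv\<close>.\<close>
  have "((\<lambda>v. \<xi> v \<bullet> e1 u v) has_vector_derivative 0) (at v)" for v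
    using bounded_bilinear.has_vector_derivative[OF bounded_bilinear_inner d e1_deriv_v, of u v]
    by (simp add: o orthonormal_frame)
  then obtain \<alpha> where \<alpha>: "\<And>v. \<xi> v \<bullet> e1 u v = \<alpha>"
    using has_vector_derivative_zero_constant[of UNIV "\<lambda>v. \<xi> v \<bullet> e1 u v"] by (metis convex_UNIV UNIV_I)
  have "((\<lambda>v. \<xi> v \<bullet> nv u v) has_vector_derivative 0) (at v)" for v
    using bounded_bilinear.has_vector_derivative[OF bounded_bilinear_inner d nv_deriv_v, of u v]
    by (simp add: o orthonormal_frame)
  then obtain \<beta> where \<beta>: "\<And>v. \<xi> v \<bullet> nv u v = \<beta>"
    using has_vector_derivative_zero_constant[of UNIV "\<lambda>v. \<xi> v \<bullet> nv u v"] by (metis convex_UNIV UNIV_I)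
  have \<xi>: "\<xi> v = \<alpha> *\<^sub>R e1 u v + \<beta> *\<^sub>R nv u v" for v
    using frame_expand[of "\<xi> v" u v] by (simp add: \<alpha> \<beta> o)
  have "k * cmod (G (\<zeta> u v)) + \<alpha> * Re (L (\<zeta> u v)) - \<beta> * B u v = 0" for v
  proof -
    have "((\<lambda>v. \<alpha> *\<^sub>R e1 u v + \<beta> *\<^sub>R nv u v) has_vector_derivative
       \<alpha> *\<^sub>R (Re (L (\<zeta> u v)) *\<^sub>R e2 u v) + \<beta> *\<^sub>R (- B u v *\<^sub>R e2 u v)) (at v)"
      by (intro has_vector_derivative_add bounded_linear.has_vector_derivative[OF bounded_linear_scaleR_right] e1_deriv_v nv_deriv_v)
    then have "- (k * cmod (G (\<zeta> u v))) *\<^sub>R e2 u v = \<alpha> *\<^sub>R (Re (L (\<zeta> u v)) *\<^sub>R e2 u v) + \<beta> *\<^sub>R (- B u v *\<^sub>R e2 u v)"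
      using d[of v] unfolding \<xi>[abs_def] using vector_derivative_unique_at by blast
    from arg_cong[OF this, of "\<lambda>x. x \<bullet> e2 u v"] show ?thesis
      by (simp add: inner_simps orthonormal_frame)
  qed
  with \<xi> show ?thesis using that by blast
qed

end

lemma has_vector_derivative_of_constant:
  assumes "(g has_vector_derivative D) (at x)" "\<And>t. g t = c"
  shows "D = 0"
proof -
  have "g = (\<lambda>_. c)" using assms(2) by blast
  then show ?thesis using assms(1) has_vector_derivative_const vector_derivative_unique_at by metis
qed

lemma norm_quat_sq: "(norm p)\<^sup>2 = (Re (fst p))\<^sup>2 + (Im (fst p))\<^sup>2 + (Re (snd p))\<^sup>2 + (Im (snd p))\<^sup>2" for p :: quat
  by (simp add: norm_prod_def cmod_power2)

lemma norm_qmult: "norm (p \<otimes>\<^sub>q q) = norm p * norm q"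
proof -
  have "(norm (p \<otimes>\<^sub>q q))\<^sup>2 = (norm p)\<^sup>2 * (norm q)\<^sup>2"
    unfolding norm_quat_sq by (simp add: qmult_def power2_eq_square algebra_simps)
  then show ?thesis by (metis norm_ge_zero power_mult_distrib mult_nonneg_nonneg power2_eq_imp_eq)
qed

lemma norm_qcnj: "norm (qcnj p) = norm p"
  by (simp add: qcnj_def norm_prod_def)

lemma norm_rotv_quat_of_vec:
  assumes "norm p = 1"
  shows "norm (rotv p (quat_of_vec x)) = norm x"
proof -
  have "Re (fst (quat_of_vec x)) = 0" by (simp add: quat_of_vec_def)
  then have "rotv p (quat_of_vec x) \<bullet> rotv p (quat_of_vec x) = x \<bullet> x"
    using assms by (simp add: inner_rotv) (simp add: inner_vec_quat)
  then show ?thesis by (simp add: norm_eq_sqrt_inner)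
qed

section \<open>The metric along u = \<omega> and genericity\<close>

context theta_cylinder
begin

definition \<rho> :: real where "\<rho> = Re (R \<tau> \<omega>)"

lemma R_eq: "R \<tau> \<omega> = of_real \<rho>" "\<rho> \<noteq> 0"
  using R_real R_nonzero by (auto simp: \<rho>_def complex_is_Real_iff complex_eq_iff)

lemma Gam_omega_eq:
  assumes "0 < x" "x < 2 * pi * Im \<tau>"
  shows "Gam (pt \<omega> x) = - of_real \<rho> * E (pt \<omega> x)"
proof -
  have "G (pt \<omega> x) \<noteq> 0" using G_nonzero assms by simp
  then show ?thesis using Gam_omega[OF assms] unfolding E_def R_eq by (simp add: field_simps)
qed

text \<open>Inserting \<gamma> = -\<rho> E into e^h = 2 Re (\<gamma> cnj W1) gives e^h = -\<rho>
  h_u.\<close>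

lemma Re_L_omega:
  assumes "0 < x" "x < 2 * pi * Im \<tau>"
  shows "Re (L (pt \<omega> x)) = - cmod (G (pt \<omega> x)) / \<rho>"
proof -
  have "cmod (G (pt \<omega> x)) = - \<rho> * (2 * Re (E (pt \<omega> x) * cnj (W1 \<tau> \<omega> x)))"
    unfolding norm_G_eq_W1[OF assms] Gam_omega_eq[OF assms] by (simp add: algebra_simps)
  also have "2 * Re (E (pt \<omega> x) * cnj (W1 \<tau> \<omega> x)) = Re (L (pt \<omega> x))"
    using assms by (simp add: Re_L_eq_Re_X X_def algebra_simps)
  finally show ?thesis using R_eq(2) by (simp add: field_simps)
qed

lemma Im_L_omega_nonzero:
  assumes "0 < x" "x < 2 * pi * Im \<tau>"
  shows "Im (L (pt \<omega> x)) \<noteq> 0"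
proof
  assume z: "Im (L (pt \<omega> x)) = 0"
  have s: "pt \<omega> x \<in> strip" using assms by simp
  have "((\<lambda>x. cmod (G (pt \<omega> x))) has_real_derivative 0) (at x)"
    using cmod_G_path[OF pt_deriv_x s] z by simp
  then have "((\<lambda>x. inverse (cmod (G (pt \<omega> x)))) has_real_derivative 0) (at x)"
    using DERIV_inverse'[of "\<lambda>x. cmod (G (pt \<omega> x))" 0 x UNIV] G_nonzero[OF s] by simp
  then have "((\<lambda>x. inverse (cmod (G (pt \<omega> x)))) has_vector_derivative 0) (at x)"
    by (simp only: has_real_derivative_iff_has_vector_derivative)
  from bounded_linear.has_vector_derivative[OF bounded_linear_of_real this]
  have 0: "((\<lambda>x. complex_of_real (inverse (cmod (G (pt \<omega> x))))) has_vector_derivative 0) (at x)"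
    by (simp only: of_real_0)
  obtain D :: complex where "D \<noteq> 0"
    "((\<lambda>x. complex_of_real (inverse (cmod (G (pt \<omega> x))))) has_vector_derivative D) (at x)"
    using inverse_norm_G_omega_derivative[OF assms] by blast
  with vector_derivative_unique_at[OF 0] show False by blast
qed

lemma h_eq:
  assumes "0 < x" "x < 2 * pi * Im \<tau>"
  shows "h \<tau> \<omega> u x = ln (cmod (G (pt u x)))"
proof -
  have "((\<lambda>y. gamma \<tau> \<omega> y x) has_vector_derivative G (pt u x)) (at u)"
    unfolding gamma_eq_Gam using Gam_path[OF pt_deriv_u] assms by fastforce
  then show ?thesis by (simp add: h_def vector_derivative_at)
qed

lemma deriv_h_omega:
  assumes "0 < x" "x < 2 * pi * Im \<tau>"
  shows "deriv (h \<tau> \<omega> \<omega>) x = - Im (L (pt \<omega> x))"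
proof (rule DERIV_imp_deriv)
  have s: "pt \<omega> x \<in> strip" using assms by simp
  have n: "cmod (G (pt \<omega> x)) > 0" using G_nonzero[OF s] by simp
  have "((\<lambda>x. ln (cmod (G (pt \<omega> x)))) has_real_derivative - Im (L (pt \<omega> x))) (at x)"
  proof -
    have "inverse (cmod (G (pt \<omega> x))) * (cmod (G (pt \<omega> x)) * Re (\<i> * L (pt \<omega> x))) = - Im (L (pt \<omega> x))"
      using n by (simp add: mult.assoc[symmetric])
    then show ?thesis using DERIV_chain2[OF DERIV_ln[OF n] cmod_G_path[OF pt_deriv_x s]] by (simp only:)
  qed
  then show "(h \<tau> \<omega> \<omega> has_real_derivative - Im (L (pt \<omega> x))) (at x)"
    by (rule has_field_derivative_transform_within_open[of _ _ _ "{0<..<2 * pi * Im \<tau>}"]) (use assms in \<open>auto simp: h_eq\<close>)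
qed

end

context isothermic_cylinder
begin

text \<open>This is -h_w at u = \<omega>, so that s_w = s p for s = e^(-h).\<close>

definition p :: "real \<Rightarrow> real" where "p v = Im (L (\<zeta> \<omega> v))"
definition y :: "real \<Rightarrow> real" where "y v = Im (X (\<zeta> \<omega> v))"
definition s :: "real \<Rightarrow> real" where "s v = inverse (cmod (G (\<zeta> \<omega> v)))"

lemma s_pos: "s v > 0" using G_nonzero[OF \<zeta>_strip] by (simp add: s_def)

lemma cmod_G_omega: "cmod (G (\<zeta> \<omega> v)) = 1 / s v" by (simp add: s_def divide_inverse)

lemma p_nonzero: "p v \<noteq> 0" using Im_L_omega_nonzero w_range by (simp add: p_def)

lemma Re_L_omega_s: "Re (L (\<zeta> \<omega> v)) = - 1 / (\<rho> * s v)"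
  using Re_L_omega[OF w_range] by (simp add: cmod_G_omega)

lemma exp_h: "exp (- h \<tau> \<omega> \<omega> (w v)) = s v" "s_fun \<tau> \<omega> w v = s v"
  using G_nonzero[OF \<zeta>_strip] by (simp_all add: s_fun_def h_eq w_range s_def exp_minus)

lemma s_deriv: "(s has_real_derivative s v * p v * wd v) (at v)"
proof -
  have g: "cmod (G (\<zeta> \<omega> v)) \<noteq> 0" using G_nonzero[OF \<zeta>_strip] by simp
  show ?thesis
    using DERIV_inverse'[OF cmod_G_path[OF \<zeta>_deriv_v \<zeta>_strip] g] g
    unfolding s_def[abs_def] p_def by (simp add: field_simps)
qed

lemma p_deriv: "(p has_real_derivative wd v * p v * y v) (at v)"
proof -
  have "((\<lambda>v. Im (L (\<zeta> \<omega> v))) has_real_derivative Im (\<i> * of_real (wd v) * deriv L (\<zeta> \<omega> v))) (at v)"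
    using L_path[OF \<zeta>_deriv_v \<zeta>_strip, of \<omega> v] by (simp only: has_vector_derivative_complex_iff)
  then show ?thesis unfolding p_def[abs_def] y_def by (simp add: Re_deriv_L[OF \<zeta>_strip] mult.assoc)
qed

text \<open>If \<open>w\<close> were constant, the normals of the planes of the \<open>u\<close>-curves, which are the
  multiples of \<open>fI v\<close>, would stay in a plane.\<close>

lemma w_nonconstant:
  assumes "generic_planes f"
  obtains v where "wd v \<noteq> 0"
proof (rule ccontr)
  assume "\<not> thesis"
  then have wd0: "wd v = 0" for v using that by blast
  \<comment> \<open>A normal is orthogonal to \<open>e1 u v\<close> for all u; differentiating in u
    at \<omega>, where the in-plane rotation rate \<open>p\<close> is nonzero, makes it orthogonal
    to \<open>eM\<close> as well.\<close>
  have normal: "N = (N \<bullet> fI v) *\<^sub>R fI v" if N: "\<forall>u. N \<bullet> f u v = d" for N v d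
  proof -
    have e: "N \<bullet> e1 u v = 0" for u
    proof -
      have "((\<lambda>u. N \<bullet> f u v) has_vector_derivative N \<bullet> (cmod (G (\<zeta> u v)) *\<^sub>R e1 u v)) (at u)"
        by (rule bounded_linear.has_vector_derivative[OF bounded_linear_inner_right f_deriv_u])
      then have "N \<bullet> (cmod (G (\<zeta> u v)) *\<^sub>R e1 u v) = 0"
        using N by (intro has_vector_derivative_of_constant) auto
      then show ?thesis using G_nonzero[OF \<zeta>_strip] by simp
    qed
    have "((\<lambda>u. N \<bullet> e1 u v) has_vector_derivative N \<bullet> (p v *\<^sub>R eM \<omega> v)) (at \<omega>)"
      using bounded_linear.has_vector_derivative[OF bounded_linear_inner_right e1_deriv_u] by (simp add: p_def)
    then have "N \<bullet> (p v *\<^sub>R eM \<omega> v) = 0"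
      by (rule has_vector_derivative_of_constant) (rule e)
    then have m: "N \<bullet> eM \<omega> v = 0" using p_nonzero by simp
    show ?thesis
      using orthonormal_expand_3[of "fI v" "e1 \<omega> v" "eM \<omega> v" N] by (simp add: inner_frame inner_fC e m)
  qed
  have w0: "w v = w 0" for v
    using DERIV_isconst_all[of w] w_deriv wd0 by metis
  have W0: "W1 \<tau> \<omega> (w v) \<noteq> 0" for v
    using norm_G_eq_W1[OF w_range, of \<omega> v] G_nonzero[OF \<zeta>_strip, of \<omega> v] by auto
  \<comment> \<open>This is the rotation axis of the frame. For constant \<open>w\<close> it does
    not move, and it is orthogonal to every \<open>fI v\<close>.\<close>
  define C where "C v = fC v (\<i> * W1 \<tau> \<omega> (w v))" for v
  have dC: "(C has_vector_derivative 0) (at v)" for v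
  proof -
    have "C = (\<lambda>v. fC v (\<i> * W1 \<tau> \<omega> (w 0)))" unfolding C_def[abs_def] using w0 by metis
    moreover have "2 * Re (\<i> * W1 \<tau> \<omega> (w 0) * cnj (of_real (r v) * W1 \<tau> \<omega> (w v))) = 0"
      unfolding w0[of v] by (simp add: algebra_simps)
    ultimately show ?thesis
      using fC_const_deriv[of "\<i> * W1 \<tau> \<omega> (w 0)" v] by (simp only: scaleR_zero_left)
  qed
  obtain C0 where C0: "\<And>v. C v = C0"
    by (rule has_vector_derivative_zero_constant[of UNIV C]) (simp_all add: dC)
  have "C0 \<bullet> C0 = (cmod (W1 \<tau> \<omega> (w 0)))\<^sup>2"
    unfolding C0[of 0, symmetric] C_def inner_fC by (simp add: cmod_power2, simp add: power2_eq_square)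
  then have "C0 \<bullet> C0 \<noteq> 0" using W0[of 0] by simp
  moreover have "span {N. \<exists>v d. \<forall>u. N \<bullet> f u v = d} \<subseteq> {x. C0 \<bullet> x = 0}"
  proof (rule span_minimal)
    show "subspace {x. C0 \<bullet> x = 0}" by (rule subspace_hyperplane)
    have "C0 \<bullet> fI v = 0" for v unfolding C0[of v, symmetric] C_def by (rule inner_fC)
    then have "C0 \<bullet> N = 0" if N: "\<forall>u. N \<bullet> f u v = d" for N v d
      using arg_cong[OF normal[OF N], of "\<lambda>x. C0 \<bullet> x"] by simp
    then show "{N. \<exists>v d. \<forall>u. N \<bullet> f u v = d} \<subseteq> {x. C0 \<bullet> x = 0}" by blast
  qed
  ultimately show False using assms unfolding generic_planes_def by blast
qed

section \<open>Contact with spheres and planes, and the axis\<close>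

lemma on_sphere_contact:
  assumes "on_sphere_about (f u) z"
  obtains \<alpha> \<beta> where "\<And>v. z = f u v + \<alpha> *\<^sub>R e1 u v + \<beta> *\<^sub>R nv u v"
    "\<And>v. cmod (G (\<zeta> u v)) + \<alpha> * Re (L (\<zeta> u v)) - \<beta> * B u v = 0"
proof -
  obtain c where c: "dist z (f u v) = c" for v
    using assms unfolding on_sphere_about_def by (auto simp: image_subset_iff)
  define \<xi> where "\<xi> v = z - f u v" for v
  have d: "(\<xi> has_vector_derivative - (cmod (G (\<zeta> u v))) *\<^sub>R e2 u v) (at v)" for v
    unfolding \<xi>_def[abs_def] using has_vector_derivative_diff[OF has_vector_derivative_const f_deriv_v] by simp
  have "\<xi> v \<bullet> e2 u v = 0" for v
  proof -
    have "((\<lambda>v. \<xi> v \<bullet> \<xi> v) has_vector_derivative \<xi> v \<bullet> (- (cmod (G (\<zeta> u v))) *\<^sub>R e2 u v) + (- (cmod (G (\<zeta> u v))) *\<^sub>R e2 u v) \<bullet> \<xi> v) (at v)"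
      by (rule bounded_bilinear.has_vector_derivative[OF bounded_bilinear_inner d d])
    moreover have "\<xi> v \<bullet> \<xi> v = c\<^sup>2" for v using c[of v] by (simp add: \<xi>_def dist_norm flip: power2_norm_eq_inner)
    ultimately have "\<xi> v \<bullet> (- (cmod (G (\<zeta> u v))) *\<^sub>R e2 u v) + (- (cmod (G (\<zeta> u v))) *\<^sub>R e2 u v) \<bullet> \<xi> v = 0"
      by (rule has_vector_derivative_of_constant)
    then show ?thesis using G_nonzero[OF \<zeta>_strip] by (simp add: inner_commute)
  qed
  then obtain \<alpha> \<beta> where ab: "\<And>v. \<xi> v = \<alpha> *\<^sub>R e1 u v + \<beta> *\<^sub>R nv u v"
    "\<And>v. 1 * cmod (G (\<zeta> u v)) + \<alpha> * Re (L (\<zeta> u v)) - \<beta> * B u v = 0"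
    using constant_contact_coefficients[of \<xi> 1 u] d by (simp only: mult_1) blast
  show ?thesis by (rule that[of \<alpha> \<beta>]) (use ab in \<open>auto simp: \<xi>_def algebra_simps\<close>)
qed

lemma planar_contact:
  assumes "planar_curve (f u)"
  obtains \<alpha> \<beta> where "(\<alpha>, \<beta>) \<noteq> (0, 0)" "\<And>v. \<alpha> * Re (L (\<zeta> u v)) - \<beta> * B u v = 0"
proof -
  obtain N d where N: "N \<noteq> 0" "\<And>v. N \<bullet> f u v = d"
    using assms unfolding planar_curve_def by blast
  have "N \<bullet> e2 u v = 0" for v
  proof -
    have "((\<lambda>v. N \<bullet> f u v) has_vector_derivative N \<bullet> (cmod (G (\<zeta> u v)) *\<^sub>R e2 u v)) (at v)"
      by (rule bounded_linear.has_vector_derivative[OF bounded_linear_inner_right f_deriv_v])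
    then have "N \<bullet> (cmod (G (\<zeta> u v)) *\<^sub>R e2 u v) = 0"
      using N(2) by (rule has_vector_derivative_of_constant)
    then show ?thesis using G_nonzero[OF \<zeta>_strip] by simp
  qed
  then obtain \<alpha> \<beta> where ab: "\<And>v. N = \<alpha> *\<^sub>R e1 u v + \<beta> *\<^sub>R nv u v"
    "\<And>v. 0 * cmod (G (\<zeta> u v)) + \<alpha> * Re (L (\<zeta> u v)) - \<beta> * B u v = 0"
    using constant_contact_coefficients[of "\<lambda>_. N" 0 u] by auto
  show ?thesis by (rule that[of \<alpha> \<beta>]) (use ab N in auto)
qed

text \<open>The monodromy maps every \<open>v\<close>-curve to itself, so it fixes the centre of a non-planar one.\<close>

lemma center_on_axis:
  assumes per: "from_fundamental_piece f w r \<V>" and ax: "axis_angle \<Phi> \<V> A \<theta>"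
    and sph: "on_sphere_about (f u) z" and np: "\<not> planar_curve (f u)"
  shows "z = (z \<bullet> A) *\<^sub>R A"
proof -
  define M where "M = qcnj (\<Phi> 0) \<otimes>\<^sub>q \<Phi> \<V>"
  have A: "A \<bullet> A = 1" using ax by (simp add: axis_angle_def norm_eq_1)
  obtain \<epsilon> :: real where \<epsilon>: "\<epsilon> = 1 \<or> \<epsilon> = -1"
    and M: "M = \<epsilon> *\<^sub>R (qcomplex (of_real (cos (\<theta>/2))) + sin (\<theta>/2) *\<^sub>R quat_of_vec A)"
    using ax unfolding axis_angle_def M_def qinv_unit[OF unit] by blast
  have "\<Phi> (v + \<V>) = \<Phi> v \<otimes>\<^sub>q M" for v
    unfolding M_def by (rule monodromy) (use per in \<open>simp add: from_fundamental_piece_def\<close>)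
  then have \<Phi>: "\<Phi> (v + \<V>) = \<Phi> v \<otimes>\<^sub>q M" for v .
  have Mu: "norm M = 1" by (simp add: M_def norm_qmult norm_qcnj unit)
  have shift: "f u (v + \<V>) = rotv M (quat_of_vec (f u v))" for u v
  proof -
    have "w (v + \<V>) = w v" using per by (simp add: from_fundamental_piece_def)
    then show ?thesis
      unfolding cyl_eq fC_def by (simp add: quat_of_vec_rotv unit) (simp add: rotv_def \<Phi> qcnj_qmult qmult_assoc)
  qed
  \<comment> \<open>Otherwise M = 1 or M = -1, conjugation by M is trivial and f is \<V>-periodic,
    which a fundamental piece excludes.\<close>
  have sin: "sin (\<theta>/2) \<noteq> 0"
  proof
    assume "sin (\<theta>/2) = 0"
    define t where "t = \<epsilon> * cos (\<theta>/2)"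
    have Mt: "M = t *\<^sub>R (1, 0)" using \<open>sin (\<theta>/2) = 0\<close> by (simp add: M t_def qcomplex_def scaleR_conv_of_real)
    then have "\<bar>t\<bar> = 1" using Mu by (simp add: norm_prod_def)
    then have "t * t = 1" by (metis abs_mult_self_eq mult_1)
    moreover have "qcnj M = t *\<^sub>R (1, 0)" unfolding Mt by (simp add: qcnj_def)
    ultimately have "rotv M q = vec_of_quat q" for q
      unfolding rotv_def Mt by (simp only: qmult_linear_simps qmult_one scaleR_scaleR scaleR_one)
    then have "f u (v + \<V>) = f u v" for u v
      unfolding shift by (simp add: vec_of_quat_of_vec)
    then show False using per by (simp add: from_fundamental_piece_def)
  qed
  obtain c where c: "dist z (f u v) = c" for v
    using sph unfolding on_sphere_about_def by (auto simp: image_subset_iff)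
  define z' where "z' = rotv M (quat_of_vec z)"
  have c': "dist z' (f u v) = c" for v
  proof -
    have "z' - f u v = rotv M (quat_of_vec z - quat_of_vec (f u (v - \<V>)))"
      using shift[of u "v - \<V>"] by (simp add: z'_def rotv_linear_simps)
    also have "\<dots> = rotv M (quat_of_vec (z - f u (v - \<V>)))"
      by (simp add: linear_diff[OF linear_quat_of_vec])
    finally show ?thesis using c[of "v - \<V>"] by (simp add: dist_norm norm_rotv_quat_of_vec Mu)
  qed
  \<comment> \<open>Both points have the same constant distance to the curve. If they differed, the
    curve would lie in their perpendicular bisector plane.\<close>
  have "z' = z"
  proof (rule ccontr)
    assume ne: "z' \<noteq> z"
    have "(z' - z) \<bullet> f u v = (z' \<bullet> z' - z \<bullet> z) / 2" for v
    proof -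
      have "(z - f u v) \<bullet> (z - f u v) = (z' - f u v) \<bullet> (z' - f u v)"
        using c[of v] c'[of v] by (simp add: dist_norm flip: power2_norm_eq_inner)
      then show ?thesis by (simp add: inner_simps inner_commute algebra_simps)
    qed
    then have "planar_curve (f u)" unfolding planar_curve_def using ne by (intro exI[of _ "z' - z"] exI[of _ "(z' \<bullet> z' - z \<bullet> z) / 2"]) auto
    with np show False by simp
  qed
  have "quat_of_vec z = qcnj M \<otimes>\<^sub>q quat_of_vec z \<otimes>\<^sub>q M"
    using quat_of_vec_rotv[OF Mu, of "quat_of_vec z"] \<open>z' = z\<close> by (simp add: z'_def quat_of_vec_def)
  then have "M \<otimes>\<^sub>q quat_of_vec z = M \<otimes>\<^sub>q (qcnj M \<otimes>\<^sub>q quat_of_vec z \<otimes>\<^sub>q M)" by simp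
  also have "\<dots> = (M \<otimes>\<^sub>q qcnj M) \<otimes>\<^sub>q quat_of_vec z \<otimes>\<^sub>q M" by (simp only: qmult_assoc)
  finally have comm: "M \<otimes>\<^sub>q quat_of_vec z = quat_of_vec z \<otimes>\<^sub>q M"
    by (simp only: qmult_qcnj_unit[OF Mu] qmult_one)
  \<comment> \<open>The scalar part of M is central, so commuting with M means commuting with A; for
    imaginary quaternions this says that the cross product vanishes.\<close>
  have "quat_of_vec A \<otimes>\<^sub>q quat_of_vec z = quat_of_vec z \<otimes>\<^sub>q quat_of_vec A"
  proof -
    have "qcomplex (of_real (cos (\<theta>/2))) = cos (\<theta>/2) *\<^sub>R (1, 0)"
      by (simp add: qcomplex_def scaleR_conv_of_real)
    with comm have "\<epsilon> *\<^sub>R (sin (\<theta>/2) *\<^sub>R (quat_of_vec A \<otimes>\<^sub>q quat_of_vec z)) = \<epsilon> *\<^sub>R (sin (\<theta>/2) *\<^sub>R (quat_of_vec z \<otimes>\<^sub>q quat_of_vec A))"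
      unfolding M by (simp only: qmult_linear_simps qmult_one scaleR_add_right add_left_cancel)
    then show ?thesis using sin \<epsilon> by auto
  qed
  then have "cross3 A z = cross3 z A" by (simp add: cross3_quat)
  then have "cross3 A z = - cross3 A z" using cross_skew[of z A] by simp
  then have "cross3 A z = 0" unfolding vec_eq_iff by simp
  \<comment> \<open>The double cross product with the unit vector A is (A \<bullet> z) A -
    z.\<close>
  then have "cross3 A (cross3 A z) = 0" by simp
  then show ?thesis unfolding Lagrange by (simp add: A inner_commute)
qed

end

section \<open>Spherical curvature lines\<close>

locale spherical_cylinder = isothermic_cylinder +
  fixes \<delta> :: real and s\<^sub>1 s\<^sub>2 :: complex
  assumes gen: "generic_planes (cyl \<tau> \<omega> w \<Phi>)" and data: "spherical_data \<tau> \<omega> w r \<delta> s\<^sub>1 s\<^sub>2"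
begin

text \<open>Both symmetric functions of \<open>s\<^sub>1\<close>, \<open>s\<^sub>2\<close> are real,
  whether the two are real or conjugate, so \<open>Re\<close> loses nothing. In this locale \<pi> is
  their product, unlike the circle constant \<open>pi\<close>.\<close>

definition \<sigma> :: real where "\<sigma> = Re (s\<^sub>1 + s\<^sub>2)"
definition \<pi> :: real where "\<pi> = Re (s\<^sub>1 * s\<^sub>2)"
definition c1 :: real where "c1 = Re (U1' \<tau> \<omega>)"
definition c2 :: real where "c2 = Re (U2 \<tau> \<omega>)"
definition c0 :: real where "c0 = Re (U' \<tau> \<omega>)"
definition quad :: "real \<Rightarrow> real" where "quad x = x\<^sup>2 - \<sigma> * x + \<pi>"
definition cubic :: "real \<Rightarrow> real" where "cubic x = 2 * c1 * x ^ 3 - c2 * x\<^sup>2 - 2 * c0 * x - 1 / \<rho>\<^sup>2"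

lemma real_constants:
  "U1' \<tau> \<omega> = of_real c1" "U2 \<tau> \<omega> = of_real c2" "U' \<tau> \<omega> = of_real c0" "U \<tau> \<omega> = of_real (- 1 / \<rho>)"
  using U1'_real U2_real U'_real
  by (auto simp: c1_def c2_def c0_def U_def R_eq(1) complex_is_Real_iff complex_eq_iff)

lemma symmetric_functions: "s\<^sub>1 + s\<^sub>2 = of_real \<sigma>" "s\<^sub>1 * s\<^sub>2 = of_real \<pi>"
proof -
  have "s\<^sub>1 \<in> \<real> \<and> s\<^sub>2 \<in> \<real> \<or> s\<^sub>2 = cnj s\<^sub>1" using data by (simp add: spherical_data_def)
  then show "s\<^sub>1 + s\<^sub>2 = of_real \<sigma>" "s\<^sub>1 * s\<^sub>2 = of_real \<pi>"
    by (auto simp: \<sigma>_def \<pi>_def complex_is_Real_iff complex_eq_iff)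
qed

lemma delta_nonzero: "\<delta> \<noteq> 0" using data by (simp add: spherical_data_def)

lemma quad_eq: "(of_real x - s\<^sub>1) * (of_real x - s\<^sub>2) = of_real (quad x)"
proof -
  have "(of_real x - s\<^sub>1) * (of_real x - s\<^sub>2) = (of_real x)\<^sup>2 - (s\<^sub>1 + s\<^sub>2) * of_real x + s\<^sub>1 * s\<^sub>2"
    by (simp add: algebra_simps power2_eq_square)
  then show ?thesis unfolding symmetric_functions quad_def by simp
qed

lemma Q_eq: "Q \<tau> \<omega> \<delta> s\<^sub>1 s\<^sub>2 x = of_real (- (quad x)\<^sup>2 + \<delta>\<^sup>2 * cubic x)"
  unfolding Q_def Q3_def power_mult_distrib[symmetric] quad_eq real_constants
  by (simp add: cubic_def power_divide)

lemma r_p: "r v * p v = - quad (s v) / (s v * \<delta>)"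
proof -
  have "complex_of_real (deriv (h \<tau> \<omega> \<omega>) (w v) * r v) = (of_real (s v) - s\<^sub>1) * (of_real (s v) - s\<^sub>2) / of_real (s v * \<delta>)"
    using data by (simp add: spherical_data_def exp_h)
  then have "complex_of_real (- p v * r v) = of_real (quad (s v) / (s v * \<delta>))"
    unfolding quad_eq deriv_h_omega[OF w_range] p_def by simp
  then show ?thesis unfolding of_real_eq_iff by (simp add: mult.commute)
qed

lemma sqrtQ_eq: "sqrtQ \<tau> \<omega> w \<delta> s\<^sub>1 s\<^sub>2 v = \<delta> * (s v * p v * wd v)"
proof -
  have "s_fun \<tau> \<omega> w = s" by (rule ext) (rule exp_h)
  then have "(s has_real_derivative sqrtQ \<tau> \<omega> w \<delta> s\<^sub>1 s\<^sub>2 v / \<delta>) (at v)"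
    using data by (simp add: spherical_data_def)
  then have "sqrtQ \<tau> \<omega> w \<delta> s\<^sub>1 s\<^sub>2 v / \<delta> = s v * p v * wd v" using s_deriv DERIV_unique by blast
  then show ?thesis using delta_nonzero by (simp add: field_simps)
qed

text \<open>The hypotheses on \<open>s\<close> give (r p s \<delta>)^2 = (quad s)^2 and (\<delta> s
  p w')^2 = -(quad s)^2 + \<delta>^2 cubic s. Adding them and using r^2 + w'^2 = 1 eliminates the
  quadratic and leaves s_w^2.\<close>

lemma s_p_squared:
  assumes "wd v \<noteq> 0"
  shows "(s v * p v)\<^sup>2 = cubic (s v)"
proof -
  define x where "x = \<delta> * (s v * p v * wd v)"
  define q where "q = - (quad (s v))\<^sup>2 + \<delta>\<^sup>2 * cubic (s v)"
  have x: "x \<noteq> 0" using assms delta_nonzero s_pos[of v] p_nonzero by (simp add: x_def)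
  have "s_fun \<tau> \<omega> w = s" by (rule ext) (rule exp_h)
  then have "x = sgn x * sqrt q"
    using sqrtQ_eq[of v] unfolding sqrtQ_def Q_eq DERIV_imp_deriv[OF s_deriv] x_def q_def
    by (simp add: DERIV_imp_deriv[OF s_deriv])
  \<comment> \<open>The sign factor vanishes where s' does, so \<open>q\<close> can be recovered
    only for x \<noteq> 0; there the equation also excludes a negative \<open>q\<close>.\<close>
  then have "\<bar>x\<bar> = sqrt q" using x by (cases "x > 0") simp_all
  then have "q = x\<^sup>2" using x
    by (metis abs_ge_zero power2_abs real_sqrt_ge_0_iff real_sqrt_pow2)
  moreover have "r v * p v * (s v * \<delta>) = - quad (s v)"
    unfolding r_p using s_pos[of v] delta_nonzero by simp
  then have "(quad (s v))\<^sup>2 = (r v * p v * (s v * \<delta>))\<^sup>2" by simp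
  ultimately have "\<delta>\<^sup>2 * cubic (s v) = (r v * p v * (s v * \<delta>))\<^sup>2 + x\<^sup>2" by (simp add: q_def)
  also have "\<dots> = \<delta>\<^sup>2 * (s v * p v)\<^sup>2 * ((r v)\<^sup>2 + (wd v)\<^sup>2)"
    by (simp add: x_def power_mult_distrib algebra_simps)
  finally show ?thesis using delta_nonzero by (simp add: r_wd)
qed

text \<open>Differentiating r p s \<delta> + quad s = 0 in v and dividing by s p w' expresses y, and
  with it the curvature term \<open>B\<close>, through s alone.\<close>

lemma B_omega:
  assumes "wd v \<noteq> 0"
  shows "B \<omega> v = (\<pi> / s v - s v) / \<delta>"
proof -
  have sp: "s v \<noteq> 0" using s_pos[of v] by simp
  have "r v * p v * s v * \<delta> + quad (s v) = 0" for v
    using r_p[of v] s_pos[of v] delta_nonzero by (simp add: field_simps)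
  then have "((\<lambda>v. r v * p v * s v * \<delta> + quad (s v)) has_real_derivative 0) (at v)" by simp
  moreover have "((\<lambda>v. r v * p v * s v * \<delta> + ((s v)\<^sup>2 - \<sigma> * s v + \<pi>)) has_real_derivative
     ((rd v * p v + wd v * p v * y v * r v) * s v + s v * p v * wd v * (r v * p v)) * \<delta>
      + (2 * s v * (s v * p v * wd v) - \<sigma> * (s v * p v * wd v))) (at v)"
    by (rule derivative_eq_intros r_deriv p_deriv s_deriv refl)+ (simp add: algebra_simps)
  ultimately have "((rd v * p v + wd v * p v * y v * r v) * s v + s v * p v * wd v * (r v * p v)) * \<delta>
      + (2 * s v * (s v * p v * wd v) - \<sigma> * (s v * p v * wd v)) = 0"
    unfolding quad_def by (rule DERIV_unique[rotated])
  then have "(s v * p v) * ((rd v + wd v * y v * r v + wd v * (r v * p v)) * \<delta> + (2 * s v - \<sigma>) * wd v) = 0"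
    by (simp add: algebra_simps)
  then have "(rd v + wd v * y v * r v + wd v * (r v * p v)) * \<delta> + (2 * s v - \<sigma>) * wd v = 0"
    using sp p_nonzero by simp
  \<comment> \<open>With r = cos \<phi> and w' = sin \<phi> this is r' = - sin \<phi> \<phi>', and
    the bracket is \<phi>', the term that occurs in \<open>B\<close>.\<close>
  moreover have "rd v = - wd v * (wdd v * r v - rd v * wd v)"
    using r_wd[of v] r_rd[of v] by algebra
  ultimately have "wd v * ((B \<omega> v + r v * p v) * \<delta> + (2 * s v - \<sigma>)) = 0"
    unfolding B_def y_def by algebra
  then have "(B \<omega> v + r v * p v) * \<delta> + (2 * s v - \<sigma>) = 0" using assms by simp
  moreover have "r v * p v * \<delta> = - quad (s v) / s v"
    unfolding r_p using delta_nonzero by simp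
  ultimately have "B \<omega> v * \<delta> = quad (s v) / s v - (2 * s v - \<sigma>)"
    by (simp add: distrib_right)
  also have "\<dots> = \<pi> / s v - s v" using sp by (simp add: quad_def field_simps power2_eq_square)
  finally show ?thesis using delta_nonzero by (simp add: field_simps)
qed

lemma open_wd_nonzero: "open {v. wd v \<noteq> 0}"
proof -
  have "continuous_on UNIV wd" using wd_deriv by (meson DERIV_continuous_on has_field_derivative_at_within)
  then show ?thesis by (intro open_Collect_neq) auto
qed

text \<open>Derivative of (s p)^2 = cubic s on the open set w' \<noteq> 0. Eliminating p^2 by the
  same identity removes the \<open>c2\<close> term.\<close>

lemma p_y:
  assumes "wd v \<noteq> 0"
  shows "p v * y v = c1 * s v + c0 / s v + 1 / (\<rho>\<^sup>2 * (s v)\<^sup>2)"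
proof -
  have sp: "s v \<noteq> 0" using s_pos[of v] by simp
  have "((\<lambda>v. (s v * p v)\<^sup>2) has_real_derivative 2 * (s v * p v) * (s v * p v * wd v * p v + wd v * p v * y v * s v)) (at v)"
    by (rule derivative_eq_intros p_deriv s_deriv refl)+ simp
  then have "((\<lambda>v. cubic (s v)) has_real_derivative 2 * (s v * p v) * (s v * p v * wd v * p v + wd v * p v * y v * s v)) (at v)"
    by (rule has_field_derivative_transform_within_open[OF _ open_wd_nonzero]) (use assms s_p_squared in auto)
  moreover have "((\<lambda>v. 2 * c1 * (s v) ^ 3 - c2 * (s v)\<^sup>2 - 2 * c0 * s v - 1 / \<rho>\<^sup>2) has_real_derivative
      (6 * c1 * (s v)\<^sup>2 - 2 * c2 * s v - 2 * c0) * (s v * p v * wd v)) (at v)"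
    by (rule derivative_eq_intros s_deriv refl)+ (simp add: algebra_simps power2_eq_square)
  ultimately have "2 * (s v * p v) * (s v * p v * wd v * p v + wd v * p v * y v * s v) = (6 * c1 * (s v)\<^sup>2 - 2 * c2 * s v - 2 * c0) * (s v * p v * wd v)"
    unfolding cubic_def by (rule DERIV_unique)
  then have "(s v * p v * wd v) * (2 * s v * (p v)\<^sup>2 + 2 * s v * (p v * y v)) = (s v * p v * wd v) * (6 * c1 * (s v)\<^sup>2 - 2 * c2 * s v - 2 * c0)"
    by (simp add: algebra_simps power2_eq_square)
  then have "2 * s v * (p v)\<^sup>2 + 2 * s v * (p v * y v) = 6 * c1 * (s v)\<^sup>2 - 2 * c2 * s v - 2 * c0"
    using sp p_nonzero assms by simp
  then have "2 * (s v)\<^sup>2 * (p v * y v) = s v * (6 * c1 * (s v)\<^sup>2 - 2 * c2 * s v - 2 * c0) - 2 * cubic (s v)"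
    unfolding s_p_squared[OF assms, symmetric] by algebra
  then have "(s v)\<^sup>2 * (p v * y v) = c1 * (s v) ^ 3 + c0 * s v + 1 / \<rho>\<^sup>2"
    unfolding cubic_def by (simp add: algebra_simps power2_eq_square power3_eq_cube)
  then have "p v * y v = (c1 * (s v) ^ 3 + c0 * s v + 1 / \<rho>\<^sup>2) / (s v)\<^sup>2" using sp by (simp add: field_simps)
  then show ?thesis using sp by (simp add: add_divide_distrib power2_eq_square power3_eq_cube)
qed

text \<open>Where w' \<noteq> 0 the derivative s p w' of \<open>s\<close> is nonzero, so
  \<open>s\<close> takes other values nearby. Two contact equations are needed for the two unknown
  coefficients of the centre.\<close>

lemma two_parameters:
  obtains a b where "wd a \<noteq> 0" "wd b \<noteq> 0" "s a \<noteq> s b"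
proof -
  obtain a where a: "wd a \<noteq> 0" using w_nonconstant[OF gen] by blast
  have "((\<lambda>v. (s v - s a) / (v - a)) \<longlongrightarrow> s a * p a * wd a) (at a)"
    using s_deriv[of a] by (simp add: has_field_derivative_iff)
  then have "eventually (\<lambda>v. (s v - s a) / (v - a) \<noteq> 0) (at a)"
    by (rule tendsto_imp_eventually_ne) (use a s_pos[of a] p_nonzero[of a] in simp)
  moreover have "eventually (\<lambda>v. wd v \<noteq> 0) (nhds a)"
    using eventually_nhds_in_open[OF open_wd_nonzero, of a] a by simp
  then have "eventually (\<lambda>v. wd v \<noteq> 0) (at a)"
    unfolding eventually_at_filter by (rule eventually_mono) simp
  ultimately have "eventually (\<lambda>v. wd v \<noteq> 0 \<and> s v \<noteq> s a) (at a)"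
    by eventually_elim auto
  then obtain b where "wd b \<noteq> 0" "s b \<noteq> s a"
    using eventually_happens'[of "at a"] by auto
  with a show ?thesis using that by metis
qed

text \<open>Cramer's rule for the contact equations at two parameters \<open>a\<close>, \<open>b\<close> makes the coefficients
  of the centre differentiable in \<open>u\<close>.\<close>

lemma center_derivative:
  assumes Z: "sphere_centers f Z"
  obtains Z' where "(Z has_vector_derivative Z') (at \<omega>)"
    "\<And>v. Z' = (1 / s v + \<rho>\<^sup>2 * (c0 + \<pi> * c1)) *\<^sub>R e1 \<omega> v + (\<rho> * p v * wd v) *\<^sub>R e2 \<omega> v
        + (- \<delta> * \<rho> * c1 - \<rho> * p v * r v) *\<^sub>R nv \<omega> v"
    "eventually (\<lambda>u. u \<in> proper_spheres f) (nhds \<omega>)"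
proof -
  obtain a b where ab: "wd a \<noteq> 0" "wd b \<noteq> 0" "s a \<noteq> s b" using two_parameters .
  define g l where "g v u = cmod (G (\<zeta> u v))" and "l v u = Re (L (\<zeta> u v))" for v u
  \<comment> \<open>Up to sign, the determinant of the contact equations at \<open>a\<close> and
    \<open>b\<close>.\<close>
  define D where "D u = l a u * B u b - l b u * B u a" for u
  define \<alpha> where "\<alpha> u = (g b u * B u a - g a u * B u b) / D u" for u
  define \<beta> where "\<beta> u = (g b u * l a u - g a u * l b u) / D u" for u
  have g_d: "((\<lambda>u. g v u) has_real_derivative g v u * l v u) (at u)" for u v
    unfolding g_def l_def using cmod_G_path[OF pt_deriv_u \<zeta>_strip] by simp
  have l_d: "((\<lambda>u. l v u) has_real_derivative Im (L (\<zeta> u v)) * Im (X (\<zeta> u v))) (at u)" for u v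
  proof -
    have "((\<lambda>u. Re (L (\<zeta> u v))) has_real_derivative Re (deriv L (\<zeta> u v))) (at u)"
      using L_path[OF pt_deriv_u \<zeta>_strip, of v u] by (simp add: has_vector_derivative_complex_iff)
    then show ?thesis unfolding l_def by (simp add: Re_deriv_L[OF \<zeta>_strip])
  qed
  have B_d: "\<exists>B'. ((\<lambda>u. B u v) has_real_derivative B') (at u)" for u v
  proof -
    have "((\<lambda>u. Im (X (\<zeta> u v))) has_real_derivative Im (- \<i> * of_real (Im (L (\<zeta> u v))) * X (\<zeta> u v))) (at u)"
      using X_deriv_u[OF \<zeta>_strip, of v u] by (simp only: has_vector_derivative_complex_iff)
    from DERIV_diff[OF DERIV_cmult[OF this, of "r v"] DERIV_const] show ?thesis unfolding B_def by blast
  qed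
  obtain Ba Bb where Bab: "((\<lambda>u. B u a) has_real_derivative Ba) (at \<omega>)" "((\<lambda>u. B u b) has_real_derivative Bb) (at \<omega>)"
    using B_d by blast
  have at_omega: "g v \<omega> = 1 / s v" "l v \<omega> = - 1 / (\<rho> * s v)" for v
    by (simp_all add: g_def l_def cmod_G_omega Re_L_omega_s)
  have sa: "s a > 0" "s b > 0" by (rule s_pos)+
  \<comment> \<open>In D(\<omega>) the terms with \<pi> cancel and a multiple of s(b)^2 - s(a)^2
    remains; positivity of s makes the squares distinct.\<close>
  have "(s a)\<^sup>2 \<noteq> (s b)\<^sup>2" using ab(3) sa by (simp add: power2_eq_iff_nonneg)
  moreover have "D \<omega> = ((s b)\<^sup>2 - (s a)\<^sup>2) / (\<rho> * \<delta> * s a * s b)"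
    unfolding D_def at_omega B_omega[OF ab(1)] B_omega[OF ab(2)]
    using sa R_eq(2) delta_nonzero by (simp add: field_simps power2_eq_square)
  ultimately have D0: "D \<omega> \<noteq> 0" using sa R_eq(2) delta_nonzero by simp
  have D_d: "\<exists>D'. (D has_real_derivative D') (at \<omega>)"
    using DERIV_diff[OF DERIV_mult[OF l_d Bab(2)] DERIV_mult[OF l_d Bab(1)]] unfolding D_def[abs_def] by blast
  then have "isCont D \<omega>" using DERIV_isCont by blast
  then have "(D \<longlongrightarrow> D \<omega>) (nhds \<omega>)"
    unfolding isCont_def by (simp only: tendsto_at_iff_tendsto_nhds)
  then have ev: "eventually (\<lambda>u. D u \<noteq> 0) (nhds \<omega>)"
    using D0 by (rule tendsto_imp_eventually_ne)
  have cramer: "\<alpha> u * l a u - \<beta> u * B u a = - g a u" "\<alpha> u * l b u - \<beta> u * B u b = - g b u" if "D u \<noteq> 0" for u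
    using that unfolding \<alpha>_def \<beta>_def by (simp_all add: field_simps) (simp_all add: D_def algebra_simps)
  have unique: "x = \<alpha> u \<and> y = \<beta> u" if "D u \<noteq> 0" "x * l a u - y * B u a = - g a u" "x * l b u - y * B u b = - g b u" for u x y
  proof -
    have "x * D u = g b u * B u a - g a u * B u b" "y * D u = g b u * l a u - g a u * l b u"
      using that(2,3) unfolding D_def by algebra+
    then show ?thesis using that(1) by (simp add: \<alpha>_def \<beta>_def field_simps)
  qed
  \<comment> \<open>A plane would give a nontrivial solution of the homogeneous system with
    determinant \<open>D u\<close>.\<close>
  have proper: "u \<in> proper_spheres f" if "D u \<noteq> 0" for u
  proof -
    have False if pl: "planar_curve (f u)"
    proof -
      obtain x y where xy: "(x, y) \<noteq> (0, 0)" "\<And>v. x * Re (L (\<zeta> u v)) - y * B u v = 0"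
        using planar_contact[OF pl] by blast
      have "x * D u = 0" "y * D u = 0"
        using xy(2)[of a] xy(2)[of b] unfolding D_def l_def by algebra+
      with xy(1) \<open>D u \<noteq> 0\<close> show False by simp
    qed
    then show ?thesis by (auto simp: proper_spheres_def)
  qed
  have Zu: "Z u = f u v + \<alpha> u *\<^sub>R e1 u v + \<beta> u *\<^sub>R nv u v" if "D u \<noteq> 0" for u v
  proof -
    have "on_sphere_about (f u) (Z u)" using Z proper[OF that] by (simp add: sphere_centers_def)
    then obtain x y where xy: "\<And>v. Z u = f u v + x *\<^sub>R e1 u v + y *\<^sub>R nv u v"
      "\<And>v. cmod (G (\<zeta> u v)) + x * Re (L (\<zeta> u v)) - y * B u v = 0"
      using on_sphere_contact by blast
    have "x = \<alpha> u \<and> y = \<beta> u"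
      by (rule unique[OF that]) (use xy(2)[of a] xy(2)[of b] in \<open>simp_all add: g_def l_def\<close>)
    then show ?thesis using xy(1) by simp
  qed
  \<comment> \<open>At \<omega> the pair (\<rho>, 0), whose centre is the origin, solves both
    equations, hence is the Cramer solution.\<close>
  have ab0: "\<rho> = \<alpha> \<omega>" "0 = \<beta> \<omega>"
    using unique[OF D0, of \<rho> 0] R_eq(2) by (simp_all add: at_omega)
  obtain \<alpha>' \<beta>' where d: "(\<alpha> has_real_derivative \<alpha>') (at \<omega>)" "(\<beta> has_real_derivative \<beta>') (at \<omega>)"
  proof -
    obtain D' where D': "(D has_real_derivative D') (at \<omega>)" using D_d by blast
    have "\<exists>x. (\<alpha> has_real_derivative x) (at \<omega>)" "\<exists>x. (\<beta> has_real_derivative x) (at \<omega>)"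
      using DERIV_divide[OF DERIV_diff[OF DERIV_mult[OF g_d Bab(1)] DERIV_mult[OF g_d Bab(2)]] D' D0]
        DERIV_divide[OF DERIV_diff[OF DERIV_mult[OF g_d l_d] DERIV_mult[OF g_d l_d]] D' D0]
      unfolding \<alpha>_def[abs_def] \<beta>_def[abs_def] by blast+
    then show ?thesis using that by blast
  qed
  \<comment> \<open>The contact equation differentiated in u at \<omega> for fixed v. The derivative
    of \<open>B\<close> is multiplied by \<beta>(\<omega>) = 0 and the terms 1/(\<rho> s^2) cancel.
    After multiplication by s an affine equation in s^2 remains, with coefficients that do not
    involve v.\<close>
  have eq: "s v ^ 2 * (\<rho> * c1 + \<beta>' / \<delta>) + (\<rho> * c0 - \<alpha>' / \<rho> - \<beta>' * \<pi> / \<delta>) = 0"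
    if v: "wd v \<noteq> 0" and B': "((\<lambda>u. B u v) has_real_derivative B') (at \<omega>)"
      and c: "\<And>u. D u \<noteq> 0 \<Longrightarrow> \<alpha> u * l v u - \<beta> u * B u v = - g v u" for v B'
  proof -
    have sv: "s v > 0" by (rule s_pos)
    have "((\<lambda>u. \<alpha> u * l v u - \<beta> u * B u v) has_real_derivative
       (\<alpha>' * l v \<omega> + (Im (L (\<zeta> \<omega> v)) * Im (X (\<zeta> \<omega> v))) * \<alpha> \<omega>) - (\<beta>' * B \<omega> v + B' * \<beta> \<omega>)) (at \<omega>)"
      by (intro DERIV_diff DERIV_mult d l_d B')
    moreover have "((\<lambda>u. \<alpha> u * l v u - \<beta> u * B u v) has_real_derivative - (g v \<omega> * l v \<omega>)) (at \<omega>)"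
    proof (rule DERIV_cong_ev[THEN iffD2])
      show "eventually (\<lambda>u. \<alpha> u * l v u - \<beta> u * B u v = - g v u) (nhds \<omega>)"
        using ev by eventually_elim (rule c)
      show "((\<lambda>u. - g v u) has_real_derivative - (g v \<omega> * l v \<omega>)) (at \<omega>)"
        by (rule DERIV_minus[OF g_d])
    qed auto
    ultimately have "(\<alpha>' * l v \<omega> + (p v * y v) * \<rho>) - \<beta>' * B \<omega> v = - (g v \<omega> * l v \<omega>)"
      using DERIV_unique unfolding ab0[symmetric] p_def y_def by fastforce
    then have e: "- \<alpha>' / (\<rho> * s v) + (c1 * s v + c0 / s v + 1 / (\<rho>\<^sup>2 * (s v)\<^sup>2)) * \<rho> - \<beta>' * ((\<pi> / s v - s v) / \<delta>) = 1 / (\<rho> * (s v)\<^sup>2)"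
      unfolding at_omega p_y[OF v] B_omega[OF v] by (simp add: power2_eq_square)
    have "s v * (- \<alpha>' / (\<rho> * s v) + (c1 * s v + c0 / s v + 1 / (\<rho>\<^sup>2 * (s v)\<^sup>2)) * \<rho> - \<beta>' * ((\<pi> / s v - s v) / \<delta>))
       = s v ^ 2 * (\<rho> * c1 + \<beta>' / \<delta>) + (\<rho> * c0 - \<alpha>' / \<rho> - \<beta>' * \<pi> / \<delta>) + 1 / (\<rho> * s v)"
      using sv R_eq(2) delta_nonzero by (simp add: field_simps power2_eq_square)
    moreover have "s v * (1 / (\<rho> * (s v)\<^sup>2)) = 1 / (\<rho> * s v)"
      using sv by (simp add: power2_eq_square)
    ultimately show ?thesis unfolding e by simp
  qed
  have ea: "(s a)\<^sup>2 * (\<rho> * c1 + \<beta>' / \<delta>) + (\<rho> * c0 - \<alpha>' / \<rho> - \<beta>' * \<pi> / \<delta>) = 0"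
    by (rule eq[OF ab(1) Bab(1) cramer(1)])
  have eb: "(s b)\<^sup>2 * (\<rho> * c1 + \<beta>' / \<delta>) + (\<rho> * c0 - \<alpha>' / \<rho> - \<beta>' * \<pi> / \<delta>) = 0"
    by (rule eq[OF ab(2) Bab(2) cramer(2)])
  \<comment> \<open>An affine function of s^2 with two distinct zeros vanishes identically, which
    determines \<beta>' and then \<alpha>'.\<close>
  have "((s a)\<^sup>2 - (s b)\<^sup>2) * (\<rho> * c1 + \<beta>' / \<delta>) = 0" using ea eb by algebra
  then have z: "\<rho> * c1 + \<beta>' / \<delta> = 0" using \<open>(s a)\<^sup>2 \<noteq> (s b)\<^sup>2\<close> by simp
  then have \<beta>': "\<beta>' = - \<delta> * \<rho> * c1" using delta_nonzero by (simp add: field_simps)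
  have "\<rho> * c0 - \<alpha>' / \<rho> - \<beta>' * \<pi> / \<delta> = 0" using ea z by simp
  then have \<alpha>': "\<alpha>' = \<rho>\<^sup>2 * (c0 + \<pi> * c1)"
    unfolding \<beta>' using delta_nonzero R_eq(2) by (simp add: field_simps power2_eq_square)
  \<comment> \<open>Here \<open>v\<close> is arbitrary, also with w'(v) = 0: \<alpha>' and \<beta>'
    are already fixed by \<open>a\<close> and \<open>b\<close>.\<close>
  have Zd: "(Z has_vector_derivative (1 / s v + \<alpha>') *\<^sub>R e1 \<omega> v + (\<rho> * p v * wd v) *\<^sub>R e2 \<omega> v
        + (\<beta>' - \<rho> * p v * r v) *\<^sub>R nv \<omega> v) (at \<omega>)" for v
  proof -
    have "((\<lambda>u. f u v + \<alpha> u *\<^sub>R e1 u v + \<beta> u *\<^sub>R nv u v) has_vector_derivative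
       cmod (G (\<zeta> \<omega> v)) *\<^sub>R e1 \<omega> v + (\<alpha> \<omega> *\<^sub>R (Im (L (\<zeta> \<omega> v)) *\<^sub>R eM \<omega> v) + \<alpha>' *\<^sub>R e1 \<omega> v)
        + (\<beta> \<omega> *\<^sub>R ((r v * Im (L (\<zeta> \<omega> v))) *\<^sub>R e1 \<omega> v) + \<beta>' *\<^sub>R nv \<omega> v)) (at \<omega>)"
      by (intro has_vector_derivative_add has_vector_derivative_scaleR d f_deriv_u e1_deriv_u nv_deriv_u)
    moreover have "cmod (G (\<zeta> \<omega> v)) *\<^sub>R e1 \<omega> v + (\<alpha> \<omega> *\<^sub>R (Im (L (\<zeta> \<omega> v)) *\<^sub>R eM \<omega> v) + \<alpha>' *\<^sub>R e1 \<omega> v)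
        + (\<beta> \<omega> *\<^sub>R ((r v * Im (L (\<zeta> \<omega> v))) *\<^sub>R e1 \<omega> v) + \<beta>' *\<^sub>R nv \<omega> v)
      = (1 / s v + \<alpha>') *\<^sub>R e1 \<omega> v + (\<rho> * p v * wd v) *\<^sub>R e2 \<omega> v + (\<beta>' - \<rho> * p v * r v) *\<^sub>R nv \<omega> v"
      unfolding cmod_G_omega ab0[symmetric] p_def[symmetric] eM_eq by (simp add: algebra_simps)
    ultimately have dv: "((\<lambda>u. f u v + \<alpha> u *\<^sub>R e1 u v + \<beta> u *\<^sub>R nv u v) has_vector_derivative
      (1 / s v + \<alpha>') *\<^sub>R e1 \<omega> v + (\<rho> * p v * wd v) *\<^sub>R e2 \<omega> v + (\<beta>' - \<rho> * p v * r v) *\<^sub>R nv \<omega> v) (at \<omega>)"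
      by (simp only:)
    obtain S where S: "open S" "\<omega> \<in> S" "\<And>u. u \<in> S \<Longrightarrow> D u \<noteq> 0"
      using ev unfolding eventually_nhds by blast
    show ?thesis
      by (rule has_vector_derivative_transform_within_open[OF dv S(1,2)]) (rule Zu[OF S(3), symmetric])
  qed
  show ?thesis
  proof (rule that[of "(1 / s a + \<alpha>') *\<^sub>R e1 \<omega> a + (\<rho> * p a * wd a) *\<^sub>R e2 \<omega> a + (\<beta>' - \<rho> * p a * r a) *\<^sub>R nv \<omega> a"])
    show "eventually (\<lambda>u. u \<in> proper_spheres f) (nhds \<omega>)"
      using ev by eventually_elim (rule proper)
    show "(1 / s a + \<alpha>') *\<^sub>R e1 \<omega> a + (\<rho> * p a * wd a) *\<^sub>R e2 \<omega> a + (\<beta>' - \<rho> * p a * r a) *\<^sub>R nv \<omega> a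
      = (1 / s v + \<rho>\<^sup>2 * (c0 + \<pi> * c1)) *\<^sub>R e1 \<omega> v + (\<rho> * p v * wd v) *\<^sub>R e2 \<omega> v + (- \<delta> * \<rho> * c1 - \<rho> * p v * r v) *\<^sub>R nv \<omega> v" for v
      unfolding \<alpha>'[symmetric] \<beta>'[symmetric] by (rule vector_derivative_unique_at[OF Zd Zd])
  qed (rule Zd)
qed

text \<open>The identity r^2 + w'^2 = 1 merges the \<open>p\<close> terms into p^2 and r p, which
  are known through cubic s and quad s. All terms depending on s then cancel, as they must for the
  length of a vector that does not depend on v.\<close>

lemma norm_center_derivative_squared:
  assumes "wd v \<noteq> 0"
  shows "(1 / s v + \<rho>\<^sup>2 * (c0 + \<pi> * c1))\<^sup>2 + (\<rho> * p v * wd v)\<^sup>2 + (- \<delta> * \<rho> * c1 - \<rho> * p v * r v)\<^sup>2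
     = \<rho>\<^sup>2 * (2 * \<sigma> * c1 + \<delta>\<^sup>2 * c1\<^sup>2 - c2) + \<rho> ^ 4 * (c0 + \<pi> * c1)\<^sup>2"
proof -
  have sv: "s v \<noteq> 0" using s_pos[of v] by simp
  have "(\<rho> * p v * wd v)\<^sup>2 + (- \<delta> * \<rho> * c1 - \<rho> * p v * r v)\<^sup>2
     = \<rho>\<^sup>2 * (p v)\<^sup>2 * ((r v)\<^sup>2 + (wd v)\<^sup>2) + (\<delta> * \<rho> * c1)\<^sup>2 + 2 * \<delta> * \<rho>\<^sup>2 * c1 * (r v * p v)"
    by algebra
  also have "\<dots> = \<rho>\<^sup>2 * (cubic (s v) / (s v)\<^sup>2) + (\<delta> * \<rho> * c1)\<^sup>2 - 2 * \<rho>\<^sup>2 * c1 * quad (s v) / s v"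
    unfolding r_wd s_p_squared[OF assms, symmetric] r_p using sv delta_nonzero by (simp add: power_mult_distrib)
  also have "\<dots> = \<rho>\<^sup>2 * (2 * \<sigma> * c1 + \<delta>\<^sup>2 * c1\<^sup>2 - c2) - 2 * (\<rho>\<^sup>2 * (c0 + \<pi> * c1)) / s v - 1 / (s v)\<^sup>2"
    unfolding cubic_def quad_def using sv R_eq(2)
    by (simp add: field_simps power2_eq_square power3_eq_cube)
  finally have "(\<rho> * p v * wd v)\<^sup>2 + (- \<delta> * \<rho> * c1 - \<rho> * p v * r v)\<^sup>2
     = \<rho>\<^sup>2 * (2 * \<sigma> * c1 + \<delta>\<^sup>2 * c1\<^sup>2 - c2) - 2 * (\<rho>\<^sup>2 * (c0 + \<pi> * c1)) / s v - 1 / (s v)\<^sup>2" .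
  moreover have "(1 / s v + \<rho>\<^sup>2 * (c0 + \<pi> * c1))\<^sup>2 = 1 / (s v)\<^sup>2 + 2 * (\<rho>\<^sup>2 * (c0 + \<pi> * c1)) / s v + \<rho> ^ 4 * (c0 + \<pi> * c1)\<^sup>2"
    using sv by (simp add: power2_eq_square power4_eq_xxxx field_simps)
  ultimately show ?thesis by linarith
qed

lemma partials_omega:
  "s v *\<^sub>R partial_u f \<omega> v = e1 \<omega> v" "s v *\<^sub>R partial_v f \<omega> v = e2 \<omega> v" "gauss_map f \<omega> v = nv \<omega> v"
proof -
  have pu: "partial_u f \<omega> v = (1 / s v) *\<^sub>R e1 \<omega> v" and pv: "partial_v f \<omega> v = (1 / s v) *\<^sub>R e2 \<omega> v"
    unfolding partial_u_def partial_v_def cmod_G_omega[symmetric]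
    by (rule vector_derivative_at f_deriv_u f_deriv_v)+
  have "norm (nv \<omega> v) = 1" by (simp add: norm_eq_1 orthonormal_frame)
  then show "s v *\<^sub>R partial_u f \<omega> v = e1 \<omega> v" "s v *\<^sub>R partial_v f \<omega> v = e2 \<omega> v" "gauss_map f \<omega> v = nv \<omega> v"
    using s_pos[of v] by (simp_all add: gauss_map_def pu pv cross_mult_left cross_mult_right cross3_frame Let_def)
qed

text \<open>All three coefficients are real, so \<open>Re\<close> discards nothing; the signed root
  and the quadratic are translated back into p, w' and r.\<close>

lemma axis_coefficients:
  "Re (z1 \<tau> \<omega> s\<^sub>1 s\<^sub>2 N (s v)) = (1 / s v + \<rho>\<^sup>2 * (c0 + \<pi> * c1)) / N"
  "Re (z2 \<tau> \<omega> \<delta> N (s v) (sqrtQ \<tau> \<omega> w \<delta> s\<^sub>1 s\<^sub>2 v)) = \<rho> * p v * wd v / N"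
  "Re (z3 \<tau> \<omega> \<delta> s\<^sub>1 s\<^sub>2 N (s v)) = (- \<delta> * \<rho> * c1 - \<rho> * p v * r v) / N"
proof -
  have sv: "s v \<noteq> 0" using s_pos[of v] by simp
  have "z1 \<tau> \<omega> s\<^sub>1 s\<^sub>2 N (s v) = of_real (1 / (s v * N) * (1 + s v * \<rho>\<^sup>2 * (c0 + \<pi> * c1)))"
    unfolding z1_def real_constants R_eq(1) symmetric_functions by simp
  then show "Re (z1 \<tau> \<omega> s\<^sub>1 s\<^sub>2 N (s v)) = (1 / s v + \<rho>\<^sup>2 * (c0 + \<pi> * c1)) / N"
    using sv by (simp add: field_simps)
  have "z2 \<tau> \<omega> \<delta> N (s v) (sqrtQ \<tau> \<omega> w \<delta> s\<^sub>1 s\<^sub>2 v) = of_real (\<rho> / (s v * \<delta> * N) * (\<delta> * (s v * p v * wd v)))"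
    unfolding z2_def R_eq(1) sqrtQ_eq by simp
  then show "Re (z2 \<tau> \<omega> \<delta> N (s v) (sqrtQ \<tau> \<omega> w \<delta> s\<^sub>1 s\<^sub>2 v)) = \<rho> * p v * wd v / N"
    using sv delta_nonzero by simp
  have e3: "z3 \<tau> \<omega> \<delta> s\<^sub>1 s\<^sub>2 N (s v) = of_real (\<rho> / (s v * \<delta> * N) * (- (\<delta>\<^sup>2) * c1 * s v + quad (s v)))"
    unfolding z3_def real_constants R_eq(1) quad_eq by simp
  have q: "quad (s v) = - (r v * p v * (s v * \<delta>))" unfolding r_p using sv delta_nonzero by simp
  show "Re (z3 \<tau> \<omega> \<delta> s\<^sub>1 s\<^sub>2 N (s v)) = (- \<delta> * \<rho> * c1 - \<rho> * p v * r v) / N"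
  proof -
    have "\<rho> * (- (\<delta>\<^sup>2) * c1 * s v + quad (s v)) / (s v * \<delta>) = - \<delta> * \<rho> * c1 - \<rho> * p v * r v"
      unfolding q using sv delta_nonzero by (simp add: field_simps power2_eq_square)
    moreover have "\<rho> / (s v * \<delta> * N) * x = \<rho> * x / (s v * \<delta>) / N" for x by simp
    ultimately show ?thesis unfolding e3 Re_complex_of_real by (simp only:)
  qed
qed

end

theorem proposition11:
  fixes \<tau>\<^sub>0 \<tau> :: complex and \<omega> :: real and w r :: "real \<Rightarrow> real" and \<Phi> :: "real \<Rightarrow> quat"
    and \<V> \<theta> \<delta> :: real and A :: "real^3" and s\<^sub>1 s\<^sub>2 :: complex
    and f :: surface and Z :: "real \<Rightarrow> real^3"
  assumes "planar_isothermic_cylinder \<tau>\<^sub>0 \<tau> \<omega> w r \<Phi>"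
    and "f = cyl \<tau> \<omega> w \<Phi>"
    and "from_fundamental_piece f w r \<V>"
    and "axis_angle \<Phi> \<V> A \<theta>"
    and "spherical_v_curves f"
    and "spherical_data \<tau> \<omega> w r \<delta> s\<^sub>1 s\<^sub>2"
    and "sphere_centers f Z"
  shows "collinear (Z ` proper_spheres f) \<and>
    (\<exists>Z'. (Z has_vector_derivative Z') (at \<omega>) \<and>
      (A = Z' /\<^sub>R norm Z' \<or> - A = Z' /\<^sub>R norm Z') \<and>
      (\<forall>v. let s = s_fun \<tau> \<omega> w v; E = exp (- h \<tau> \<omega> \<omega> (w v)) in
        Z' /\<^sub>R norm Z' =
            Re (z1 \<tau> \<omega> s\<^sub>1 s\<^sub>2 (norm Z') s) *\<^sub>R (E *\<^sub>R partial_u f \<omega> v)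
          + Re (z2 \<tau> \<omega> \<delta> (norm Z') s (sqrtQ \<tau> \<omega> w \<delta> s\<^sub>1 s\<^sub>2 v)) *\<^sub>R (E *\<^sub>R partial_v f \<omega> v)
          + Re (z3 \<tau> \<omega> \<delta> s\<^sub>1 s\<^sub>2 (norm Z') s) *\<^sub>R gauss_map f \<omega> v) \<and>
      complex_of_real ((norm Z')\<^sup>2) =
          (R \<tau> \<omega>)\<^sup>2 * (2 * (s\<^sub>1 + s\<^sub>2) * U1' \<tau> \<omega> + of_real (\<delta>\<^sup>2) * (U1' \<tau> \<omega>)\<^sup>2 - U2 \<tau> \<omega>)
        + (R \<tau> \<omega>) ^ 4 * (U' \<tau> \<omega> + s\<^sub>1 * s\<^sub>2 * U1' \<tau> \<omega>)\<^sup>2)"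
proof -
  interpret spherical_cylinder \<tau> \<omega> w r \<Phi> \<delta> s\<^sub>1 s\<^sub>2
    using assms(1,6) by unfold_locales (auto simp: planar_isothermic_cylinder_def)
  note f = assms(2)
  have Zf: "sphere_centers (cyl \<tau> \<omega> w \<Phi>) Z" using assms(7) by (simp add: f)
  have axis: "Z u = (Z u \<bullet> A) *\<^sub>R A" if "u \<in> proper_spheres f" for u
    using center_on_axis[of \<V> A \<theta> u "Z u"] assms(3,4,7) that
    by (simp add: f sphere_centers_def proper_spheres_def)
  have A: "norm A = 1" using assms(4) by (simp add: axis_angle_def)
  have collinear: "collinear (Z ` proper_spheres f)"
    unfolding collinear_def
  proof (intro exI[of _ A] ballI)
    fix x x' assume "x \<in> Z ` proper_spheres f" "x' \<in> Z ` proper_spheres f"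
    then have "x - x' = (x \<bullet> A - x' \<bullet> A) *\<^sub>R A"
      using axis by (auto simp: scaleR_diff_left)
    then show "\<exists>c. x - x' = c *\<^sub>R A" by blast
  qed
  obtain Z' where Z': "(Z has_vector_derivative Z') (at \<omega>)"
    and Z'_eq: "\<And>v. Z' = (1 / s v + \<rho>\<^sup>2 * (c0 + \<pi> * c1)) *\<^sub>R e1 \<omega> v + (\<rho> * p v * wd v) *\<^sub>R e2 \<omega> v
        + (- \<delta> * \<rho> * c1 - \<rho> * p v * r v) *\<^sub>R nv \<omega> v"
    and ev: "eventually (\<lambda>u. u \<in> proper_spheres (cyl \<tau> \<omega> w \<Phi>)) (nhds \<omega>)"
    by (rule center_derivative[OF Zf]) blast
  obtain a where a: "wd a \<noteq> 0" using w_nonconstant[OF gen] .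
  \<comment> \<open>One nonzero component suffices for Z' \<noteq> 0; the one along
    \<open>e2\<close> is nonzero because w'(a), \<rho> and p are.\<close>
  have "Z' \<bullet> e2 \<omega> a = \<rho> * p a * wd a"
    by (subst Z'_eq[of a]) (simp add: inner_simps orthonormal_frame)
  then have Z'0: "Z' \<noteq> 0" using a R_eq(2) p_nonzero[of a] by auto
  \<comment> \<open>Near \<omega> all centres lie on the line through the origin spanned by A, hence
    so does the derivative.\<close>
  have Z'_axis: "Z' = (Z' \<bullet> A) *\<^sub>R A"
  proof -
    obtain S where S: "open S" "\<omega> \<in> S" "\<And>u. u \<in> S \<Longrightarrow> u \<in> proper_spheres f"
      using ev unfolding eventually_nhds f by blast
    have d: "((\<lambda>u. (Z u \<bullet> A) *\<^sub>R A) has_vector_derivative (Z' \<bullet> A) *\<^sub>R A) (at \<omega>)"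
      using bounded_linear.has_vector_derivative[OF bounded_linear_scaleR_left
          bounded_linear.has_vector_derivative[OF bounded_linear_inner_left Z']] .
    have "(Z has_vector_derivative (Z' \<bullet> A) *\<^sub>R A) (at \<omega>)"
      by (rule has_vector_derivative_transform_within_open[OF d S(1,2)]) (rule axis[OF S(3), symmetric])
    then show ?thesis by (rule vector_derivative_unique_at[OF Z'])
  qed
  have pm: "A = Z' /\<^sub>R norm Z' \<or> - A = Z' /\<^sub>R norm Z'"
  proof -
    define k where "k = Z' \<bullet> A"
    have k: "Z' = k *\<^sub>R A" using Z'_axis by (simp add: k_def)
    then have "norm Z' = \<bar>k\<bar>" "k \<noteq> 0" using A Z'0 by auto
    then show ?thesis unfolding k by (cases "k > 0") auto
  qed
  have formula: "Z' /\<^sub>R norm Z' =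
            Re (z1 \<tau> \<omega> s\<^sub>1 s\<^sub>2 (norm Z') (s v)) *\<^sub>R (s v *\<^sub>R partial_u f \<omega> v)
          + Re (z2 \<tau> \<omega> \<delta> (norm Z') (s v) (sqrtQ \<tau> \<omega> w \<delta> s\<^sub>1 s\<^sub>2 v)) *\<^sub>R (s v *\<^sub>R partial_v f \<omega> v)
          + Re (z3 \<tau> \<omega> \<delta> s\<^sub>1 s\<^sub>2 (norm Z') (s v)) *\<^sub>R gauss_map f \<omega> v" for v
  proof -
    have "Z' /\<^sub>R n = (x / n) *\<^sub>R e1 \<omega> v + (y / n) *\<^sub>R e2 \<omega> v + (z / n) *\<^sub>R nv \<omega> v"
      if "Z' = x *\<^sub>R e1 \<omega> v + y *\<^sub>R e2 \<omega> v + z *\<^sub>R nv \<omega> v" for x y z n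
      unfolding that by (simp add: scaleR_add_right divide_inverse mult.commute)
    from this[OF Z'_eq] show ?thesis unfolding f partials_omega axis_coefficients .
  qed
  have "(norm Z')\<^sup>2 = \<rho>\<^sup>2 * (2 * \<sigma> * c1 + \<delta>\<^sup>2 * c1\<^sup>2 - c2) + \<rho> ^ 4 * (c0 + \<pi> * c1)\<^sup>2"
  proof -
    have "(x *\<^sub>R e1 \<omega> a + y *\<^sub>R e2 \<omega> a + z *\<^sub>R nv \<omega> a) \<bullet> (x *\<^sub>R e1 \<omega> a + y *\<^sub>R e2 \<omega> a + z *\<^sub>R nv \<omega> a) = x\<^sup>2 + y\<^sup>2 + z\<^sup>2" for x y z
      by (simp add: inner_simps orthonormal_frame inner_frame power2_eq_square)
    then have "Z' \<bullet> Z' = (1 / s a + \<rho>\<^sup>2 * (c0 + \<pi> * c1))\<^sup>2 + (\<rho> * p a * wd a)\<^sup>2 + (- \<delta> * \<rho> * c1 - \<rho> * p a * r a)\<^sup>2"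
      unfolding Z'_eq[of a, symmetric] using Z'_eq[of a] by metis
    then show ?thesis unfolding norm_center_derivative_squared[OF a] by (simp add: power2_norm_eq_inner)
  qed
  then have norm: "complex_of_real ((norm Z')\<^sup>2) =
          (R \<tau> \<omega>)\<^sup>2 * (2 * (s\<^sub>1 + s\<^sub>2) * U1' \<tau> \<omega> + of_real (\<delta>\<^sup>2) * (U1' \<tau> \<omega>)\<^sup>2 - U2 \<tau> \<omega>)
        + (R \<tau> \<omega>) ^ 4 * (U' \<tau> \<omega> + s\<^sub>1 * s\<^sub>2 * U1' \<tau> \<omega>)\<^sup>2"
    unfolding R_eq(1) real_constants symmetric_functions by simp
  show ?thesis
    unfolding Let_def exp_h using collinear Z' pm formula norm by blast
qed

end
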